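(* Let $m\ge1$, $n\ge0$, and let $\sigma$ be the anti-involution of $\mathrm{Cl}(m,n)$ with $\sigma(f_m)=-f_m$, $\sigma(f_i)=f_i$ for $1\le i\le m-1$ and $\sigma(e_j)=e_j$ for $1\le j\le n$. The following assignments define an isomorphism of Lie groups $\Phi:\mathrm{Sp}_2(\mathrm{ClGr}(m,n),\sigma)\to\mathrm{Spin}_0(m+1,n+1)$: $$\begin{array}{rcll} \mathrm{diag}(y,\sigma(y)^{-1})&\mapsto&\iota_0(y)&\text{for }y\in\mathrm{Spin}(m,n),\\ \mathrm{diag}(\lambda,\lambda^{-1})&\mapsto&\frac{\lambda+\lambda^{-1}}2+f_{m+1}e_{n+1}\frac{\lambda-\lambda^{-1}}2&\text{for }\lambda>0,\\ R(f_mv)&\mapsto&1+\frac{f_{m+1}+e_{n+1}}2\,v&\text{for }v\in V^\sigma,\\ L(f_mv)&\mapsto&1+\frac{f_{m+1}-e_{n+1}}2\,v&\text{for }v\in V^\sigma,\\ R(1)&\mapsto&1+\frac{f_{m+1}+e_{n+1}}2\,f_m,\\ L(1)&\mapsto&1-\frac{f_{m+1}-e_{n+1}}2\,f_m. \end{array}$$ Moreover, the differential of $\Phi$ at $\mathrm{Id}$ is the Lie algebra isomorphism $\varphi:\mathfrak{sp}_2(B(m,n),\sigma)\to\mathfrak{spin}(m+1,n+1)$ given by $$\begin{array}{rcll} \mathrm{diag}(a,a)&\mapsto&a&\text{for }a\in B^{-\sigma}(m,n),\\ \mathrm{diag}(f_me_i,-f_me_i)&\mapsto&f_me_i&\text{for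 }1\le i\le n,\\ \mathrm{diag}(f_mf_i,-f_mf_i)&\mapsto&f_mf_i&\text{for }1\le i\le m-1,\\ \mathrm{diag}(1,-1)&\mapsto&f_{m+1}e_{n+1},\\ S(f_mv)&\mapsto&f_{m+1}v&\text{for }v\in V^\sigma,\\ A(f_mv)&\mapsto&v\,e_{n+1}&\text{for }v\in V^\sigma,\\ S(1)&\mapsto&-f_me_{n+1},\\ A(1)&\mapsto&f_mf_{m+1}. \end{array}$$
   Context: $\mathbb R^{m,n}$ is $V=\mathbb R^{m+n}$ with a symmetric bilinear form $b$ and orthogonal basis $f_1,\dots,f_m,e_1,\dots,e_n$ with $b(f_i,f_i)=-1$, $b(e_j,e_j)=1$. $\mathrm{Cl}(m,n)$ is the real Clifford algebra generated by $V$ with $v^2=b(v,v)$; $\mathrm{Cl}_{even}(m,n)$ is the subalgebra generated by products $vw$, $v,w\in V$. An isometric involution $\sigma$ of $V$ extends uniquely to an anti-involution $\sigma$ of $\mathrm{Cl}(m,n)$. Here $V^\sigma=\mathrm{Span}_{\mathbb R}(f_1,\dots,f_{m-1},e_1,\dots,e_n)$ is the $+1$-eigenspace of $\sigma$ on $V$. $B(m,n)=\mathrm{Span}_{\mathbb R}(vw\mid v,w\in V)$, a Lie subalgebra of $\mathrm{Cl}(m,n)$ (bracket $[x,y]=xy-yx$); $B^{\pm\sigma}(m,n)=\{x\in B(m,n)\mid\sigma(x)=\pm x\}$. $\mathfrak{spin}(m,n)=\mathrm{Span}_{\mathbb R}(e_ie_j\ (i\ne j),\ f_ke_i,\ f_kf_l\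 (k\neq l))$. Clifford group: $\mathrm{ClGr}(m,n)=\{x\in\mathrm{Cl}_{even}(m,n)^\times\mid \alpha(x)vx^{-1}\in V\ \forall v\in V\}$, where $\alpha$ is the algebra involution induced by $v\mapsto-v$; $\mathrm{ClGr}_0(m,n)$ is its identity component. Its Lie algebra is $B(m,n)$. With $(\cdot)^t$ the anti-involution of $\mathrm{Cl}(m,n)$ that is the identity on $V$, $N(x)=x^tx\in\mathbb R^\times$ for $x\in\mathrm{ClGr}(m,n)$. Put $\mathrm{Spin}(m,n)=\{x\in\mathrm{ClGr}(m,n)\mid |N(x)|=1\}$ and $\mathrm{Spin}_0(m,n)=\{x\in\mathrm{ClGr}_0(m,n)\mid N(x)=1\}$. The inclusion $\mathbb R^{m,n}\subset\mathbb R^{m+1,n+1}$ (with basis $f_1,\dots,f_{m+1},e_1,\dots,e_{n+1}$) induces $\iota:\mathrm{Spin}(m,n)\hookrightarrow\mathrm{Spin}(m+1,n+1)$. The injective homomorphism $\iota_0:\mathrm{Spin}(m,n)\to\mathrm{Spin}_0(m+1,n+1)$ is $\iota_0(x)=\iota(x)$ if $N(x)=1$ and $\iota_0(x)=\iota(x)f_{m+1}e_{n+1}$ if $N(x)=-1$. Matrices over $A=\mathrm{Cl}(m,n)$: $R(x)=\begin{pmatrix}1&x\\0&1\end{pmatrix}$, $L(x)=\begin{pmatrix}1&0\\ x&1\end{pmatrix}$, $S(x)=\begin{pmatrix}0&x\\ x&0\end{pmatrix}$, $A(x)=\begin{pmatrix}0&-x\\ x&0\end{pmatrix}$. $\mathrm{Sp}_2(A,\sigma)$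 is the group of $M\in\mathrm{GL}_2(A)$ with $\sigma(M)^t\Omega M=\Omega$, $\Omega=\begin{pmatrix}0&1\\-1&0\end{pmatrix}$ (here $t$ is matrix transposition, $\sigma$ applied entrywise). For $G=\mathrm{ClGr}(m,n)$, $\mathrm{Sp}_2(G,\sigma)$ is the topological closure in $\mathrm{Sp}_2(A,\sigma)$ of $\{L(y)\,\mathrm{diag}(x,\sigma(x)^{-1})\,R(z)\mid x\in G,\ y,z\in B^\sigma(m,n)\}$; it is a Lie group with Lie algebra $\mathfrak{sp}_2(B(m,n),\sigma)=\left\{\begin{pmatrix}x&z\\ y&-\sigma(x)\end{pmatrix}\mid x\in B(m,n),\ y,z\in B^\sigma(m,n)\right\}$. *)

theory Defs
  imports "HOL-Analysis.Analysis" "HOL-Algebra.Group"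
begin

section \<open>The real Clifford algebras\<close>

text \<open>
  All the algebras \<open>Cl(m,n)\<close> are realised inside one real normed algebra \<open>cliff\<close>, the Clifford
  algebra on countably many anticommuting generators \<open>f\<^sub>i\<close> (square \<open>-1\<close>) and \<open>e\<^sub>j\<close> (square \<open>1\<close>);
  \<open>Cl(m,n)\<close> is the subalgebra generated by \<open>f\<^sub>1,\<dots>,f\<^sub>m,e\<^sub>1,\<dots>,e\<^sub>n\<close>. In particular the inclusion
  \<open>Cl(m,n) \<subseteq> Cl(m+1,n+1)\<close> induced by the inclusion of the bases is a literal inclusion of sets.

  An element of \<open>cliff\<close> is the family of its coefficients with respect to the basis of blades
  \<open>e\<^sub>A\<close>, where \<open>A\<close> ranges over the finite sets of generators and \<open>e\<^sub>A\<close> is the product of the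
  elements of \<open>A\<close> in the order \<open>f\<^sub>0 < f\<^sub>1 < \<dots> < e\<^sub>0 < e\<^sub>1 < \<dots>\<close>.
\<close>

datatype gen = F nat | E nat

text \<open>
  \<open>gsgn a b\<close> is \<open>-1\<close> if \<open>a > b\<close> (the two generators have to be interchanged), the square of \<open>a\<close>
  if \<open>a = b\<close>, and \<open>1\<close> if \<open>a < b\<close>. Thus \<open>e\<^sub>A e\<^sub>B\<close> is \<open>bsgn A B\<close> times the blade of the symmetric
  difference of \<open>A\<close> and \<open>B\<close>.
\<close>

fun gsgn :: "gen \<Rightarrow> gen \<Rightarrow> real" where
  "gsgn (F i) (F j) = (if j \<le> i then -1 else 1)"
| "gsgn (E i) (E j) = (if j < i then -1 else 1)"
| "gsgn (F i) (E j) = 1"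
| "gsgn (E i) (F j) = -1"

definition bsgn :: "gen set \<Rightarrow> gen set \<Rightarrow> real" where
  "bsgn A B = (\<Prod>a\<in>A. \<Prod>b\<in>B. gsgn a b)"

abbreviation sdiff :: "gen set \<Rightarrow> gen set \<Rightarrow> gen set" where
  "sdiff A B \<equiv> sym_diff A B"

lemma gsgn_sq [simp]: "gsgn a b * gsgn a b = 1"
  by (cases "(a, b)" rule: gsgn.cases) auto

lemma prod_sdiff:
  fixes g :: "gen \<Rightarrow> real"
  assumes "finite A" "finite B" "\<And>a. g a * g a = 1"
  shows "prod g (sdiff A B) = prod g A * prod g B"
proof -
  have 1: "prod g A = prod g (A - B) * prod g (A \<inter> B)"
    using assms(1) by (metis Int_Diff_Un Int_Diff_disjoint finite_Diff finite_Int inf_commute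
        mult.commute prod.union_disjoint)
  have 2: "prod g B = prod g (B - A) * prod g (A \<inter> B)"
    using assms(2) by (metis Int_Diff_Un Int_Diff_disjoint finite_Diff finite_Int inf_commute
        mult.commute prod.union_disjoint)
  have 3: "prod g (A \<inter> B) * prod g (A \<inter> B) = 1"
    by (simp add: assms(3) flip: prod.distrib)
  have 4: "prod g (sdiff A B) = prod g (A - B) * prod g (B - A)"
    using assms by (intro prod.union_disjoint) auto
  show ?thesis
    unfolding 4 by (subst 1, subst 2) (use 3 in \<open>simp add: algebra_simps\<close>)
qed

lemma bsgn_sdiff_left:
  assumes "finite A" "finite B" shows "bsgn (sdiff A B) C = bsgn A C * bsgn B C"
  unfolding bsgn_def by (rule prod_sdiff) (use assms in \<open>simp_all flip: prod.distrib\<close>)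

lemma bsgn_sdiff_right:
  assumes "finite A" "finite B" shows "bsgn C (sdiff A B) = bsgn C A * bsgn C B"
proof -
  have "(\<Prod>b\<in>sdiff A B. gsgn c b) = (\<Prod>b\<in>A. gsgn c b) * (\<Prod>b\<in>B. gsgn c b)" for c
    by (rule prod_sdiff) (use assms in simp_all)
  then show ?thesis unfolding bsgn_def by (simp add: prod.distrib)
qed

lemma bsgn_sq [simp]: "bsgn A B * bsgn A B = 1"
  unfolding bsgn_def by (simp flip: prod.distrib)

lemma bsgn_empty [simp]: "bsgn {} B = 1" "bsgn A {} = 1"
  by (simp_all add: bsgn_def)

lemma abs_bsgn [simp]: "\<bar>bsgn A B\<bar> = 1"
  using bsgn_sq[of A B] by (simp add: abs_square_eq_1 flip: power2_eq_square)

typedef cliff = "{x :: gen set \<Rightarrow> real. \<exists>U. finite U \<and> (\<forall>A. x A \<noteq> 0 \<longrightarrow> A \<subseteq> U)}"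
  morphisms coef Abs_cliff
  by (rule exI[of _ "\<lambda>_. 0"]) auto

setup_lifting type_definition_cliff

lemma cliff_eqI: "(\<And>A. coef x A = coef y A) \<Longrightarrow> x = y"
  by (simp add: coef_inject[symmetric] ext)

lemma coef_bound: "\<exists>U. finite U \<and> (\<forall>A. coef x A \<noteq> 0 \<longrightarrow> A \<subseteq> U)"
  using coef[of x] by simp

definition supp :: "cliff \<Rightarrow> gen set set" where
  "supp x = {A. coef x A \<noteq> 0}"

lemma supp_bound:
  obtains U where "finite U" "supp x \<subseteq> Pow U"
  using coef_bound[of x] unfolding supp_def by blast

lemma supp_bound2:
  obtains U where "finite U" "supp x \<subseteq> Pow U" "supp y \<subseteq> Pow U"
proof -
  obtain U where "finite U" "supp x \<subseteq> Pow U" by (rule supp_bound)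
  moreover obtain V where "finite V" "supp y \<subseteq> Pow V" by (rule supp_bound)
  ultimately show ?thesis using that[of "U \<union> V"] by blast
qed

lemma supp_bound3:
  obtains U where "finite U" "supp x \<subseteq> Pow U" "supp y \<subseteq> Pow U" "supp z \<subseteq> Pow U"
proof -
  obtain U where "finite U" "supp x \<subseteq> Pow U" "supp y \<subseteq> Pow U" by (rule supp_bound2)
  moreover obtain V where "finite V" "supp z \<subseteq> Pow V" by (rule supp_bound)
  ultimately show ?thesis using that[of "U \<union> V"] by blast
qed

lemma finite_supp [simp]: "finite (supp x)"
  by (rule supp_bound[of x]) (auto intro: finite_subset)

lemma coef_outside: "supp x \<subseteq> Pow U \<Longrightarrow> \<not> A \<subseteq> U \<Longrightarrow> coef x A = 0"
  unfolding supp_def by blast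

lemma sum_supp:
  assumes "finite U" "supp x \<subseteq> Pow U" "\<And>A. coef x A = 0 \<Longrightarrow> h A = 0"
  shows "(\<Sum>A\<in>supp x. h A) = (\<Sum>A\<in>Pow U. h A)"
  by (rule sum.mono_neutral_left) (use assms in \<open>auto simp: supp_def\<close>)

instantiation cliff :: real_vector
begin

lift_definition zero_cliff :: cliff is "\<lambda>_. 0"
  by (rule exI[of _ "{}"]) simp

lift_definition plus_cliff :: "cliff \<Rightarrow> cliff \<Rightarrow> cliff" is "\<lambda>x y A. x A + y A"
proof -
  fix x y :: "gen set \<Rightarrow> real"
  assume x: "\<exists>U. finite U \<and> (\<forall>A. x A \<noteq> 0 \<longrightarrow> A \<subseteq> U)"
    and y: "\<exists>U. finite U \<and> (\<forall>A. y A \<noteq> 0 \<longrightarrow> A \<subseteq> U)"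
  obtain U where U: "finite U" "\<forall>A. x A \<noteq> 0 \<longrightarrow> A \<subseteq> U" using x by (elim exE conjE)
  obtain V where V: "finite V" "\<forall>A. y A \<noteq> 0 \<longrightarrow> A \<subseteq> V" using y by (elim exE conjE)
  show "\<exists>U. finite U \<and> (\<forall>A. x A + y A \<noteq> 0 \<longrightarrow> A \<subseteq> U)"
  proof (intro exI[of _ "U \<union> V"] conjI allI impI)
    fix A assume "x A + y A \<noteq> 0"
    then have "x A \<noteq> 0 \<or> y A \<noteq> 0" by auto
    then have "A \<subseteq> U \<or> A \<subseteq> V" using U(2) V(2) by metis
    then show "A \<subseteq> U \<union> V" by blast
  qed (use U V in simp)
qed

lift_definition uminus_cliff :: "cliff \<Rightarrow> cliff" is "\<lambda>x A. - x A" by simp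

lift_definition scaleR_cliff :: "real \<Rightarrow> cliff \<Rightarrow> cliff" is "\<lambda>r x A. r * x A"
  by (erule exE, rule_tac x = U in exI) simp

definition minus_cliff :: "cliff \<Rightarrow> cliff \<Rightarrow> cliff" where "minus_cliff x y = x + - y"

instance
proof
  fix x y z :: cliff and r s :: real
  show "x + y + z = x + (y + z)" by transfer (simp add: add.assoc)
  show "x + y = y + x" by transfer (simp add: add.commute)
  show "0 + x = x" by transfer simp
  show "- x + x = 0" by transfer simp
  show "x - y = x + - y" by (rule minus_cliff_def)
  show "r *\<^sub>R (x + y) = r *\<^sub>R x + r *\<^sub>R y" by transfer (simp add: distrib_left)
  show "(r + s) *\<^sub>R x = r *\<^sub>R x + s *\<^sub>R x" by transfer (simp add: distrib_right)
  show "r *\<^sub>R s *\<^sub>R x = (r * s) *\<^sub>R x" by transfer (simp add: mult.assoc)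
  show "1 *\<^sub>R x = x" by transfer simp
qed

end

lemma coef_simps [simp]:
  "coef 0 A = 0" "coef (x + y) A = coef x A + coef y A" "coef (- x) A = - coef x A"
  "coef (x - y) A = coef x A - coef y A" "coef (r *\<^sub>R x) A = r * coef x A"
  unfolding minus_cliff_def
  by (simp_all only: zero_cliff.rep_eq plus_cliff.rep_eq uminus_cliff.rep_eq scaleR_cliff.rep_eq
      diff_conv_add_uminus)

lemma supp_plus: "supp x \<subseteq> S \<Longrightarrow> supp y \<subseteq> S \<Longrightarrow> supp (x + y) \<subseteq> S"
proof
  fix A assume S: "supp x \<subseteq> S" "supp y \<subseteq> S" "A \<in> supp (x + y)"
  then have "coef x A \<noteq> 0 \<or> coef y A \<noteq> 0" by (auto simp: supp_def)
  then show "A \<in> S" using S(1,2) unfolding supp_def by blast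
qed

lemma supp_scaleR: "supp x \<subseteq> S \<Longrightarrow> supp (r *\<^sub>R x) \<subseteq> S"
  unfolding supp_def coef_simps by auto

lemma coef_sum: "coef (\<Sum>i\<in>I. g i) A = (\<Sum>i\<in>I. coef (g i) A)"
  by (induction I rule: infinite_finite_induct) auto

lift_definition blade :: "gen set \<Rightarrow> cliff" is "\<lambda>A B. if finite A \<and> B = A then 1 else 0"
proof -
  fix A :: "gen set"
  show "\<exists>U. finite U \<and> (\<forall>B. (if finite A \<and> B = A then 1 else 0 :: real) \<noteq> 0 \<longrightarrow> B \<subseteq> U)"
    by (rule exI[of _ "if finite A then A else {}"]) auto
qed

lemma coef_blade: "coef (blade A) B = (if finite A \<and> B = A then 1 else 0)"
  by (simp add: blade.rep_eq)

instantiation cliff :: "{one, times}"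
begin

definition one_cliff :: cliff where "1 = blade {}"

text \<open>The coefficient at \<open>C\<close> collects the pairs \<open>(A, B)\<close> with \<open>sdiff A B = C\<close>, i.e.\ \<open>B = sdiff A C\<close>.\<close>

lift_definition times_cliff :: "cliff \<Rightarrow> cliff \<Rightarrow> cliff" is
  "\<lambda>x y C. \<Sum>A | x A \<noteq> 0. bsgn A (sdiff A C) * x A * y (sdiff A C)"
proof -
  fix x y :: "gen set \<Rightarrow> real"
  assume x: "\<exists>U. finite U \<and> (\<forall>A. x A \<noteq> 0 \<longrightarrow> A \<subseteq> U)"
    and y: "\<exists>U. finite U \<and> (\<forall>A. y A \<noteq> 0 \<longrightarrow> A \<subseteq> U)"
  obtain U where U: "finite U" "\<forall>A. x A \<noteq> 0 \<longrightarrow> A \<subseteq> U" using x by (elim exE conjE)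
  obtain V where V: "finite V" "\<forall>A. y A \<noteq> 0 \<longrightarrow> A \<subseteq> V" using y by (elim exE conjE)
  show "\<exists>U. finite U \<and> (\<forall>C. (\<Sum>A | x A \<noteq> 0. bsgn A (sdiff A C) * x A * y (sdiff A C)) \<noteq> 0 \<longrightarrow> C \<subseteq> U)"
  proof (intro exI[of _ "U \<union> V"] conjI allI impI)
    fix C
    assume "(\<Sum>A | x A \<noteq> 0. bsgn A (sdiff A C) * x A * y (sdiff A C)) \<noteq> 0"
    then obtain A where "A \<in> {A. x A \<noteq> 0}" "bsgn A (sdiff A C) * x A * y (sdiff A C) \<noteq> 0"
      by (rule sum.not_neutral_contains_not_neutral)
    then have "A \<subseteq> U" "sdiff A C \<subseteq> V" using U V by auto
    then show "C \<subseteq> U \<union> V" by blast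
  qed (use U V in simp)
qed

instance ..

end

lemma coef_mult:
  assumes "finite U" "supp x \<subseteq> Pow U"
  shows "coef (x * y) C = (\<Sum>A\<in>Pow U. bsgn A (sdiff A C) * coef x A * coef y (sdiff A C))"
proof -
  have "coef (x * y) C = (\<Sum>A\<in>supp x. bsgn A (sdiff A C) * coef x A * coef y (sdiff A C))"
    unfolding times_cliff.rep_eq supp_def by simp
  also have "\<dots> = (\<Sum>A\<in>Pow U. bsgn A (sdiff A C) * coef x A * coef y (sdiff A C))"
    by (rule sum_supp) (use assms in auto)
  finally show ?thesis .
qed

lemma coef_one: "coef 1 A = (if A = {} then 1 else 0)"
  by (simp add: one_cliff_def coef_blade)

lemma supp_mult:
  assumes "finite U" "supp x \<subseteq> Pow U" "supp y \<subseteq> Pow U"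
  shows "supp (x * y) \<subseteq> Pow U"
proof
  fix C assume "C \<in> supp (x * y)"
  then have "(\<Sum>A\<in>Pow U. bsgn A (sdiff A C) * coef x A * coef y (sdiff A C)) \<noteq> 0"
    by (simp add: supp_def coef_mult[OF assms(1,2)])
  then obtain A where A: "A \<in> Pow U" "bsgn A (sdiff A C) * coef x A * coef y (sdiff A C) \<noteq> 0"
    by (rule sum.not_neutral_contains_not_neutral)
  then have "sdiff A C \<subseteq> U" using assms(3) by (auto simp: supp_def)
  then show "C \<in> Pow U" using A by blast
qed

lemma sdiff_cancel [simp]: "sdiff A (sdiff A B) = B"
  by blast

lemma sum_Pow_sdiff:
  fixes h :: "gen set \<Rightarrow> real"
  assumes "A \<subseteq> U"
  shows "(\<Sum>B\<in>Pow U. h (sdiff A B)) = (\<Sum>B\<in>Pow U. h B)"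
  by (rule sum.reindex_bij_witness[of _ "sdiff A" "sdiff A"]) (use assms in auto)

lemma cliff_mult_assoc: "(x * y) * z = x * (y * (z :: cliff))"
proof (rule cliff_eqI)
  fix D
  obtain U where U: "finite U" "supp x \<subseteq> Pow U" "supp y \<subseteq> Pow U" "supp z \<subseteq> Pow U"
    by (rule supp_bound3)
  note xy = supp_mult[OF U(1,2,3)] and yz = supp_mult[OF U(1,3,4)]
  show "coef ((x * y) * z) D = coef (x * (y * z)) D"
  proof (cases "D \<subseteq> U")
    case False
    then show ?thesis
      using coef_outside supp_mult[OF U(1) xy U(4)] supp_mult[OF U(1,2) yz] by metis
  next
    case True
    have "coef ((x * y) * z) D = (\<Sum>C\<in>Pow U. \<Sum>A\<in>Pow U.
        bsgn C (sdiff C D) * (bsgn A (sdiff A C) * coef x A * coef y (sdiff A C)) * coef z (sdiff C D))"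
      by (simp add: coef_mult[OF U(1) xy] coef_mult[OF U(1,2)] sum_distrib_left sum_distrib_right)
    also have "\<dots> = (\<Sum>A\<in>Pow U. \<Sum>C\<in>Pow U.
        bsgn C (sdiff C D) * (bsgn A (sdiff A C) * coef x A * coef y (sdiff A C)) * coef z (sdiff C D))"
      by (rule sum.swap)
    also have "\<dots> = (\<Sum>A\<in>Pow U. \<Sum>B\<in>Pow U.
        bsgn (sdiff A B) (sdiff (sdiff A B) D) * (bsgn A B * coef x A * coef y B)
          * coef z (sdiff (sdiff A B) D))"
    proof (rule sum.cong[OF refl])
      fix A assume "A \<in> Pow U"
      then have "A \<subseteq> U" by simp
      from sum_Pow_sdiff[OF this, of "\<lambda>C. bsgn C (sdiff C D) *
          (bsgn A (sdiff A C) * coef x A * coef y (sdiff A C)) * coef z (sdiff C D)"]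
      show "(\<Sum>C\<in>Pow U. bsgn C (sdiff C D) * (bsgn A (sdiff A C) * coef x A * coef y (sdiff A C))
          * coef z (sdiff C D)) = (\<Sum>B\<in>Pow U. bsgn (sdiff A B) (sdiff (sdiff A B) D)
          * (bsgn A B * coef x A * coef y B) * coef z (sdiff (sdiff A B) D))"
        by simp
    qed
    also have "\<dots> = (\<Sum>A\<in>Pow U. \<Sum>B\<in>Pow U. bsgn A (sdiff A D) * coef x A *
        (bsgn B (sdiff B (sdiff A D)) * coef y B * coef z (sdiff B (sdiff A D))))"
    proof (intro sum.cong refl)
      fix A B assume AB: "A \<in> Pow U" "B \<in> Pow U"
      have fin: "finite A" "finite B" "finite D"
        using AB True U(1) by (auto intro: finite_subset)
      have eq: "sdiff (sdiff A B) D = sdiff B (sdiff A D)" by blast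
      have "bsgn (sdiff A B) (sdiff B (sdiff A D))
          = bsgn A (sdiff B (sdiff A D)) * bsgn B (sdiff B (sdiff A D))"
        by (rule bsgn_sdiff_left) (use fin in auto)
      moreover have "bsgn A (sdiff B (sdiff A D)) = bsgn A B * bsgn A (sdiff A D)"
        by (rule bsgn_sdiff_right) (use fin in auto)
      ultimately have 1: "bsgn (sdiff A B) (sdiff B (sdiff A D)) * bsgn A B
          = bsgn A (sdiff A D) * bsgn B (sdiff B (sdiff A D)) * (bsgn A B * bsgn A B)"
        by algebra
      have 2: "s * (t * p * q) * r = s' * p * (t' * q * r)" if "s * t = s' * t' * 1" for s t s' t' p q r :: real
        using that by algebra
      show "bsgn (sdiff A B) (sdiff (sdiff A B) D) * (bsgn A B * coef x A * coef y B)
          * coef z (sdiff (sdiff A B) D) = bsgn A (sdiff A D) * coef x A *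
          (bsgn B (sdiff B (sdiff A D)) * coef y B * coef z (sdiff B (sdiff A D)))"
        unfolding eq by (rule 2, rule 1[unfolded bsgn_sq])
    qed
    also have "\<dots> = coef (x * (y * z)) D"
      by (simp add: coef_mult[OF U(1,2)] coef_mult[OF U(1,3)] sum_distrib_left sum_distrib_right)
    finally show ?thesis .
  qed
qed

instance cliff :: real_algebra_1
proof
  fix x y z :: cliff and r :: real
  show "x * y * z = x * (y * z)" by (rule cliff_mult_assoc)
  obtain U where U: "finite U" "supp x \<subseteq> Pow U" "supp y \<subseteq> Pow U" "supp z \<subseteq> Pow U"
    by (rule supp_bound3)
  note s = supp_plus[OF U(2,3)] supp_scaleR[OF U(2), of r]
  show "(x + y) * z = x * z + y * z"
    by (rule cliff_eqI)
      (simp add: coef_mult[OF U(1,2)] coef_mult[OF U(1,3)] coef_mult[OF U(1) s(1)]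
        algebra_simps sum.distrib)
  show "x * (y + z) = x * y + x * z"
    by (rule cliff_eqI) (simp add: coef_mult[OF U(1,2)] algebra_simps sum.distrib)
  show "r *\<^sub>R x * y = r *\<^sub>R (x * y)"
    by (rule cliff_eqI)
      (simp add: coef_mult[OF U(1,2)] coef_mult[OF U(1) s(2)] algebra_simps sum_distrib_left)
  show "x * r *\<^sub>R y = r *\<^sub>R (x * y)"
    by (rule cliff_eqI) (simp add: coef_mult[OF U(1,2)] algebra_simps sum_distrib_left)
  have o: "supp 1 \<subseteq> Pow {}" by (auto simp: supp_def coef_one)
  show "1 * x = x"
    by (rule cliff_eqI) (simp add: coef_mult[OF _ o] coef_one)
  show "x * 1 = x"
  proof (rule cliff_eqI)
    fix C
    have eq: "bsgn A (sdiff A C) * coef x A * coef 1 (sdiff A C) = (if A = C then coef x A else 0)"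
      for A
    proof (cases "A = C")
      case False
      then have "sdiff A C \<noteq> {}" by blast
      then show ?thesis using False by (auto simp: coef_one)
    qed (simp add: coef_one)
    show "coef (x * 1) C = coef x C"
      unfolding coef_mult[OF U(1,2)] eq using U(1) coef_outside[OF U(2)] by simp
  qed
  have "coef (0::cliff) {} \<noteq> coef 1 {}" by (simp add: coef_one)
  then show "(0::cliff) \<noteq> 1" by metis
qed

text \<open>
  The \<open>\<ell>\<^sup>1\<close>-norm of the coefficients; on the finite-dimensional subspaces \<open>Cl(m,n)\<close> it induces the
  usual topology.
\<close>

instantiation cliff :: real_normed_algebra_1
begin

definition norm_cliff :: "cliff \<Rightarrow> real" where "norm_cliff x = (\<Sum>A\<in>supp x. \<bar>coef x A\<bar>)"
definition dist_cliff :: "cliff \<Rightarrow> cliff \<Rightarrow> real" where "dist_cliff x y = norm (x - y)"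
definition sgn_cliff :: "cliff \<Rightarrow> cliff" where "sgn_cliff x = inverse (norm x) *\<^sub>R x"
definition uniformity_cliff :: "(cliff \<times> cliff) filter" where
  "uniformity_cliff = (INF e\<in>{0<..}. principal {(x, y). dist x (y::cliff) < e})"
definition open_cliff :: "cliff set \<Rightarrow> bool" where
  "open_cliff U = (\<forall>x\<in>U. eventually (\<lambda>(x', y). x' = x \<longrightarrow> y \<in> U) uniformity)"

instance
proof
  fix x y :: cliff and r :: real
  obtain U where U: "finite U" "supp x \<subseteq> Pow U" "supp y \<subseteq> Pow U" by (rule supp_bound2)
  note s = supp_plus[OF U(2,3)] supp_scaleR[OF U(2), of r] supp_mult[OF U]
  have nrm: "norm z = (\<Sum>A\<in>Pow U. \<bar>coef z A\<bar>)" if "supp z \<subseteq> Pow U" for z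
    unfolding norm_cliff_def by (rule sum_supp) (use U that in auto)
  show "dist x y = norm (x - y)" by (rule dist_cliff_def)
  show "sgn x = x /\<^sub>R norm x" by (rule sgn_cliff_def)
  show "(uniformity :: (cliff \<times> cliff) filter) = (INF e\<in>{0<..}. principal {(x, y). dist x y < e})"
    by (rule uniformity_cliff_def)
  show "open V = (\<forall>x\<in>V. \<forall>\<^sub>F (x', y) in uniformity. x' = x \<longrightarrow> y \<in> V)" for V :: "cliff set"
    by (rule open_cliff_def)
  show "norm x = 0 \<longleftrightarrow> x = 0"
  proof
    assume "norm x = 0"
    then have "\<forall>A\<in>supp x. coef x A = 0"
      unfolding norm_cliff_def by (subst (asm) sum_nonneg_eq_0_iff) auto
    then show "x = 0" by (intro cliff_eqI) (auto simp: supp_def)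
  qed (simp add: norm_cliff_def)
  show "norm (x + y) \<le> norm x + norm y"
    unfolding nrm[OF U(2)] nrm[OF U(3)] nrm[OF s(1)] sum.distrib[symmetric]
    by (rule sum_mono) simp
  show "norm (r *\<^sub>R x) = \<bar>r\<bar> * norm x"
    unfolding nrm[OF U(2)] nrm[OF s(2)] by (simp add: sum_distrib_left abs_mult)
  have "norm (x * y) = (\<Sum>C\<in>Pow U. \<bar>\<Sum>A\<in>Pow U. bsgn A (sdiff A C) * coef x A * coef y (sdiff A C)\<bar>)"
    unfolding nrm[OF s(3)] coef_mult[OF U(1,2)] ..
  also have "\<dots> \<le> (\<Sum>C\<in>Pow U. \<Sum>A\<in>Pow U. \<bar>coef x A\<bar> * \<bar>coef y (sdiff A C)\<bar>)"
    by (rule sum_mono, rule order_trans[OF sum_abs]) (simp add: abs_mult)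
  also have "\<dots> = (\<Sum>A\<in>Pow U. \<Sum>C\<in>Pow U. \<bar>coef x A\<bar> * \<bar>coef y (sdiff A C)\<bar>)"
    by (rule sum.swap)
  also have "\<dots> = (\<Sum>A\<in>Pow U. \<bar>coef x A\<bar> * norm y)"
  proof (rule sum.cong[OF refl])
    fix A assume "A \<in> Pow U"
    then have "(\<Sum>C\<in>Pow U. \<bar>coef y (sdiff A C)\<bar>) = (\<Sum>C\<in>Pow U. \<bar>coef y C\<bar>)"
      using sum_Pow_sdiff[of A U "\<lambda>C. \<bar>coef y C\<bar>"] by simp
    then show "(\<Sum>C\<in>Pow U. \<bar>coef x A\<bar> * \<bar>coef y (sdiff A C)\<bar>) = \<bar>coef x A\<bar> * norm y"
      unfolding nrm[OF U(3)] by (simp flip: sum_distrib_left)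
  qed
  also have "\<dots> = norm x * norm y"
    unfolding nrm[OF U(2)] by (simp add: sum_distrib_right)
  finally show "norm (x * y) \<le> norm x * norm y" .
  have "supp 1 = {{}}" by (auto simp: supp_def coef_one)
  then show "norm (1::cliff) = 1" by (simp add: norm_cliff_def coef_one)
qed

end

definition fb :: "nat \<Rightarrow> cliff" where "fb i = blade {F i}"
definition eb :: "nat \<Rightarrow> cliff" where "eb j = blade {E j}"

text \<open>Both are indexed from \<open>1\<close> in \<open>\<real>\<^sup>m\<^sup>,\<^sup>n\<close>.\<close>

definition Vsp :: "nat \<Rightarrow> nat \<Rightarrow> cliff set" where
  "Vsp m n = span (fb ` {1..m} \<union> eb ` {1..n})"

definition alg_span :: "cliff set \<Rightarrow> cliff set" where
  "alg_span S = (\<lambda>A. subspace A \<and> 1 \<in> A \<and> (\<forall>x\<in>A. \<forall>y\<in>A. x * y \<in> A)) hull S"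

definition Cl :: "nat \<Rightarrow> nat \<Rightarrow> cliff set" where
  "Cl m n = alg_span (Vsp m n)"

definition Cl_even :: "nat \<Rightarrow> nat \<Rightarrow> cliff set" where
  "Cl_even m n = alg_span {v * w | v w. v \<in> Vsp m n \<and> w \<in> Vsp m n}"

text \<open>
  The algebra involution induced by \<open>v \<mapsto> -v\<close>, and the anti-involution that is the identity
  on \<open>V\<close>: reversing a product of \<open>k\<close> anticommuting generators gives the sign \<open>(-1)\<^sup>k\<^sup>(\<^sup>k\<^sup>-\<^sup>1\<^sup>)\<^sup>/\<^sup>2\<close>.
\<close>

lift_definition twist :: "(gen set \<Rightarrow> real) \<Rightarrow> cliff \<Rightarrow> cliff" is "\<lambda>c x A. c A * x A"
  by auto

definition alpha :: "cliff \<Rightarrow> cliff" where "alpha = twist (\<lambda>A. (-1) ^ card A)"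
definition transp :: "cliff \<Rightarrow> cliff" where "transp = twist (\<lambda>A. (-1) ^ (card A choose 2))"

definition anti_involution_on :: "cliff set \<Rightarrow> (cliff \<Rightarrow> cliff) \<Rightarrow> bool" where
  "anti_involution_on A s \<longleftrightarrow>
     (\<forall>x\<in>A. s x \<in> A \<and> s (s x) = x) \<and>
     (\<forall>x\<in>A. \<forall>y\<in>A. s (x + y) = s x + s y) \<and>
     (\<forall>r. \<forall>x\<in>A. s (r *\<^sub>R x) = r *\<^sub>R s x) \<and>
     (\<forall>x\<in>A. \<forall>y\<in>A. s (x * y) = s y * s x)"


subsection \<open>Consistency of the model\<close>

lemma blade_mult:
  assumes "finite A" "finite B"
  shows "blade A * blade B = bsgn A B *\<^sub>R blade (sdiff A B)"
proof (rule cliff_eqI)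
  fix C
  have s: "supp (blade A) \<subseteq> Pow A" using assms by (auto simp: supp_def coef_blade split: if_splits)
  have "coef (blade A * blade B) C
      = (\<Sum>A'\<in>Pow A. if A' = A then bsgn A (sdiff A C) * coef (blade B) (sdiff A C) else 0)"
    unfolding coef_mult[OF assms(1) s] by (rule sum.cong) (use assms in \<open>auto simp: coef_blade\<close>)
  also have "\<dots> = bsgn A (sdiff A C) * coef (blade B) (sdiff A C)"
    using assms by simp
  also have "\<dots> = bsgn A B * coef (blade (sdiff A B)) C"
  proof (cases "sdiff A C = B")
    case True
    then have "sdiff A B = C" by blast
    then show ?thesis using True assms by (metis coef_blade finite_Diff finite_Un)
  next
    case False
    then have "C \<noteq> sdiff A B" by blast
    then show ?thesis using False by (simp add: coef_blade)
  qed
  finally show "coef (blade A * blade B) C = coef (bsgn A B *\<^sub>R blade (sdiff A B)) C" by simp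
qed

definition gsq :: "gen \<Rightarrow> real" where "gsq a = gsgn a a"

lemma gsq_simps [simp]: "gsq (F i) = -1" "gsq (E j) = 1"
  by (simp_all add: gsq_def)

lemma gen_sq: "blade {a} * blade {a} = of_real (gsq a)"
  by (simp add: blade_mult bsgn_def gsq_def of_real_def one_cliff_def)

lemma gen_anticommute:
  assumes "a \<noteq> b" shows "blade {a} * blade {b} = - (blade {b} * blade {a})"
proof -
  have "gsgn a b = - gsgn b a"
    using assms by (cases "(a, b)" rule: gsgn.cases) auto
  moreover have "sdiff {a} {b} = {a, b}" "sdiff {b} {a} = {a, b}" using assms by auto
  ultimately show ?thesis by (simp add: blade_mult bsgn_def)
qed

definition gens :: "nat \<Rightarrow> nat \<Rightarrow> gen set" where
  "gens m n = F ` {1..m} \<union> E ` {1..n}"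

lemma finite_gens [simp]: "finite (gens m n)"
  by (simp add: gens_def)

lemma Vsp_gens: "Vsp m n = span ((\<lambda>a. blade {a}) ` gens m n)"
  unfolding Vsp_def gens_def fb_def eb_def by (simp add: image_Un image_image)

lemma cliff_expand:
  assumes "finite S" "supp x \<subseteq> S" "\<And>A. A \<in> S \<Longrightarrow> finite A"
  shows "x = (\<Sum>A\<in>S. coef x A *\<^sub>R blade A)"
proof (rule cliff_eqI)
  fix B
  have "coef (\<Sum>A\<in>S. coef x A *\<^sub>R blade A) B = (\<Sum>A\<in>S. if A = B then coef x B else 0)"
    unfolding coef_sum by (rule sum.cong) (use assms in \<open>auto simp: coef_blade\<close>)
  also have "\<dots> = coef x B"
    using assms by (auto simp: supp_def)
  finally show "coef x B = coef (\<Sum>A\<in>S. coef x A *\<^sub>R blade A) B" by simp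
qed

lemma supp_V: "v \<in> Vsp m n \<Longrightarrow> supp v \<subseteq> (\<lambda>a. {a}) ` gens m n"
  unfolding Vsp_gens
proof (induction rule: span_induct_alt)
  case base
  then show ?case by (auto simp: supp_def)
next
  case (step c x y)
  then have "supp x \<subseteq> (\<lambda>a. {a}) ` gens m n"
    by (auto simp: supp_def coef_blade split: if_splits)
  then show ?case using step by (intro supp_plus supp_scaleR)
qed

text \<open>The relation \<open>v\<^sup>2 = b(v,v)\<close>.\<close>

lemma clifford_relation:
  assumes "v \<in> Vsp m n"
  shows "v * v = of_real ((\<Sum>j=1..n. (coef v {E j})\<^sup>2) - (\<Sum>i=1..m. (coef v {F i})\<^sup>2))"
proof -
  define c where "c a = coef v {a}" for a
  let ?G = "gens m n"
  have "v = (\<Sum>A\<in>(\<lambda>a. {a}) ` ?G. coef v A *\<^sub>R blade A)"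
    by (rule cliff_expand) (use supp_V[OF assms] in auto)
  also have "\<dots> = (\<Sum>a\<in>?G. c a *\<^sub>R blade {a})"
    by (simp add: sum.reindex c_def)
  finally have v: "v = (\<Sum>a\<in>?G. c a *\<^sub>R blade {a})" .
  have vv: "v * v = (\<Sum>a\<in>?G. \<Sum>b\<in>?G. (c a * c b) *\<^sub>R (blade {a} * blade {b}))"
    using arg_cong2[OF v v, of times]
    by (simp add: sum_product mult.commute)
  also have "\<dots> = (\<Sum>a\<in>?G. \<Sum>b\<in>?G. (c b * c a) *\<^sub>R (blade {b} * blade {a}))"
    by (rule sum.swap)
  finally have vv': "v * v = (\<Sum>a\<in>?G. \<Sum>b\<in>?G. (c a * c b) *\<^sub>R (blade {b} * blade {a}))"
    by (simp add: mult.commute)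
  have "v * v + v * v = (\<Sum>a\<in>?G. \<Sum>b\<in>?G. (c a * c b) *\<^sub>R (blade {a} * blade {b} + blade {b} * blade {a}))"
    by (subst vv, subst vv') (simp add: sum.distrib scaleR_add_right)
  also have "\<dots> = (\<Sum>a\<in>?G. \<Sum>b\<in>?G. if a = b then of_real (2 * (c a)\<^sup>2 * gsq a) else 0)"
  proof (intro sum.cong refl)
    fix a b
    show "(c a * c b) *\<^sub>R (blade {a} * blade {b} + blade {b} * blade {a})
        = (if a = b then of_real (2 * (c a)\<^sup>2 * gsq a) else 0)"
    proof (cases "a = b")
      case True
      then show ?thesis
        by (simp add: gen_sq scaleR_conv_of_real power2_eq_square mult.assoc
            flip: of_real_add of_real_mult)
    next
      case False
      then show ?thesis by (subst gen_anticommute) simp_all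
    qed
  qed
  also have "\<dots> = of_real (2 * (\<Sum>a\<in>?G. (c a)\<^sup>2 * gsq a))"
    by (simp add: sum_distrib_left mult.assoc)
  also have "(\<Sum>a\<in>?G. (c a)\<^sup>2 * gsq a) = (\<Sum>j=1..n. (c (E j))\<^sup>2) - (\<Sum>i=1..m. (c (F i))\<^sup>2)"
  proof -
    have "(\<Sum>a\<in>?G. (c a)\<^sup>2 * gsq a) = (\<Sum>a\<in>F ` {1..m}. (c a)\<^sup>2 * gsq a) + (\<Sum>a\<in>E ` {1..n}. (c a)\<^sup>2 * gsq a)"
      unfolding gens_def by (rule sum.union_disjoint) auto
    then show ?thesis by (simp add: sum.reindex inj_on_def sum_negf)
  qed
  finally have "v * v + v * v = of_real (2 * ((\<Sum>j=1..n. (c (E j))\<^sup>2) - (\<Sum>i=1..m. (c (F i))\<^sup>2)))"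
    (is "_ = of_real (2 * ?s)") .
  also have "\<dots> = 2 *\<^sub>R of_real ?s" by (simp add: scaleR_conv_of_real)
  finally have "2 *\<^sub>R (v * v) = 2 *\<^sub>R of_real ?s" by (simp only: scaleR_2)
  then have "v * v = of_real ?s" by (simp only: real_vector.scale_cancel_left) simp
  then show ?thesis by (simp only: c_def)
qed

text \<open>The blades of sets of generators of \<open>\<real>\<^sup>m\<^sup>,\<^sup>n\<close> form a basis, so \<open>dim Cl(m,n) = 2\<^sup>m\<^sup>+\<^sup>n\<close>.\<close>

lemma alg_span_superset: "S \<subseteq> alg_span S"
  unfolding alg_span_def by (rule hull_subset)

lemma alg_span_closed:
  "subspace (alg_span S)" "1 \<in> alg_span S"
  "x \<in> alg_span S \<Longrightarrow> y \<in> alg_span S \<Longrightarrow> x * y \<in> alg_span S"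
proof -
  have "subspace (alg_span S) \<and> 1 \<in> alg_span S \<and> (\<forall>x\<in>alg_span S. \<forall>y\<in>alg_span S. x * y \<in> alg_span S)"
    unfolding alg_span_def by (rule hull_in) (auto intro: subspace_Inter)
  then show "subspace (alg_span S)" "1 \<in> alg_span S"
    "x \<in> alg_span S \<Longrightarrow> y \<in> alg_span S \<Longrightarrow> x * y \<in> alg_span S" by auto
qed

lemma alg_span_minimal:
  assumes "S \<subseteq> A" "subspace A" "1 \<in> A" "\<And>x y. x \<in> A \<Longrightarrow> y \<in> A \<Longrightarrow> x * y \<in> A"
  shows "alg_span S \<subseteq> A"
  unfolding alg_span_def by (rule hull_minimal) (use assms in auto)

lemma Cl_eq: "Cl m n = {x. supp x \<subseteq> Pow (gens m n)}"
proof
  have "Vsp m n \<subseteq> {x. supp x \<subseteq> Pow (gens m n)}"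
  proof
    fix v assume "v \<in> Vsp m n"
    from supp_V[OF this] show "v \<in> {x. supp x \<subseteq> Pow (gens m n)}" by auto
  qed
  moreover have "subspace {x. supp x \<subseteq> Pow (gens m n)}"
    by (rule subspaceI) (use supp_plus supp_scaleR in \<open>simp_all add: supp_def\<close>)
  ultimately show "Cl m n \<subseteq> {x. supp x \<subseteq> Pow (gens m n)}"
    unfolding Cl_def
    by (intro alg_span_minimal) (use supp_mult[OF finite_gens] in
        \<open>auto simp: supp_def coef_one split: if_splits\<close>)
next
  have bl: "A \<subseteq> gens m n \<Longrightarrow> blade A \<in> Cl m n" if "finite A" for A
    using that
  proof (induction A)
    case empty
    then show ?case using alg_span_closed(2) by (simp add: Cl_def flip: one_cliff_def)
  next
    case (insert a A)
    have "blade {a} * blade A = bsgn {a} A *\<^sub>R blade (sdiff {a} A)"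
      using insert by (intro blade_mult) auto
    also have "sdiff {a} A = insert a A" using insert by auto
    finally have "bsgn {a} A *\<^sub>R (blade {a} * blade A) = (bsgn {a} A * bsgn {a} A) *\<^sub>R blade (insert a A)"
      by simp
    then have "blade (insert a A) = bsgn {a} A *\<^sub>R (blade {a} * blade A)" by simp
    moreover have "blade {a} \<in> Vsp m n" unfolding Vsp_gens using insert by (intro span_base) auto
    then have "blade {a} \<in> Cl m n" unfolding Cl_def using alg_span_superset by blast
    ultimately show ?case
      using insert alg_span_closed unfolding Cl_def by (simp add: subspace_scale)
  qed
  show "{x. supp x \<subseteq> Pow (gens m n)} \<subseteq> Cl m n"
  proof
    fix x assume "x \<in> {x. supp x \<subseteq> Pow (gens m n)}"
    then have "x = (\<Sum>A\<in>Pow (gens m n). coef x A *\<^sub>R blade A)"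
      by (intro cliff_expand) (auto intro: finite_subset)
    also have "\<dots> \<in> Cl m n"
      using alg_span_closed(1) unfolding Cl_def
      by (intro subspace_sum subspace_scale) (auto intro!: bl[unfolded Cl_def] intro: finite_subset)
    finally show "x \<in> Cl m n" .
  qed
qed

lemma coef_twist [simp]: "coef (twist c x) A = c A * coef x A"
  by (simp add: twist.rep_eq)

lemma supp_twist: "supp x \<subseteq> S \<Longrightarrow> supp (twist c x) \<subseteq> S"
  unfolding supp_def by auto

lemma twist_linear: "twist c (x + y) = twist c x + twist c y" "twist c (r *\<^sub>R x) = r *\<^sub>R twist c x"
  by (rule cliff_eqI, simp add: algebra_simps)+

lemma twist_hom:
  assumes c: "\<And>A B. finite A \<Longrightarrow> finite B \<Longrightarrow> c (sdiff A B) = c A * c B"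
  shows "twist c (x * y) = twist c x * twist c y"
proof (rule cliff_eqI)
  fix C
  obtain U where U: "finite U" "supp x \<subseteq> Pow U" "supp y \<subseteq> Pow U" by (rule supp_bound2)
  show "coef (twist c (x * y)) C = coef (twist c x * twist c y) C"
  proof (cases "C \<subseteq> U")
    case False
    then show ?thesis
      using coef_outside[OF supp_mult[OF U]]
        coef_outside[OF supp_mult[OF U(1) supp_twist[OF U(2)] supp_twist[OF U(3)]]] by simp
  next
    case True
    have "c C = c A * c (sdiff A C)" if "A \<in> Pow U" for A
      using c[of A "sdiff A C"] that True U(1) by (simp add: finite_subset)
    then show ?thesis
      unfolding coef_twist coef_mult[OF U(1,2)] coef_mult[OF U(1) supp_twist[OF U(2)]] sum_distrib_left
      by (intro sum.cong refl) (simp add: mult.assoc mult.left_commute)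
  qed
qed

lemma twist_anti_hom:
  assumes c: "\<And>A B. finite A \<Longrightarrow> finite B \<Longrightarrow> c (sdiff A B) * bsgn A B = c A * c B * bsgn B A"
  shows "twist c (x * y) = twist c y * twist c x"
proof (rule cliff_eqI)
  fix C
  obtain U where U: "finite U" "supp x \<subseteq> Pow U" "supp y \<subseteq> Pow U" by (rule supp_bound2)
  show "coef (twist c (x * y)) C = coef (twist c y * twist c x) C"
  proof (cases "C \<subseteq> U")
    case False
    then show ?thesis
      using coef_outside[OF supp_mult[OF U]]
        coef_outside[OF supp_mult[OF U(1) supp_twist[OF U(3)] supp_twist[OF U(2)]]] by simp
  next
    case True
    have "coef (twist c y * twist c x) C
        = (\<Sum>B\<in>Pow U. bsgn B (sdiff B C) * (c B * coef y B) * (c (sdiff B C) * coef x (sdiff B C)))"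
      unfolding coef_mult[OF U(1) supp_twist[OF U(3)]] coef_twist ..
    also have "\<dots> = (\<Sum>A\<in>Pow U. bsgn (sdiff C A) (sdiff (sdiff C A) C)
        * (c (sdiff C A) * coef y (sdiff C A)) * (c (sdiff (sdiff C A) C) * coef x (sdiff (sdiff C A) C)))"
      by (rule sum_Pow_sdiff[OF True, symmetric])
    also have "\<dots> = (\<Sum>A\<in>Pow U. c C * (bsgn A (sdiff A C) * coef x A * coef y (sdiff A C)))"
    proof (rule sum.cong[OF refl])
      fix A assume "A \<in> Pow U"
      then have "c C * bsgn A (sdiff A C) = c A * c (sdiff A C) * bsgn (sdiff A C) A"
        using c[of A "sdiff A C"] True U(1) by (simp add: finite_subset)
      moreover have "sdiff C A = sdiff A C" "sdiff (sdiff C A) C = A" by blast+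
      moreover have "s * (t * p) * (r * u) = w * (z * u * p)" if "w * z = r * t * s"
        for s t p r u w z :: real using that by algebra
      ultimately show "bsgn (sdiff C A) (sdiff (sdiff C A) C)
        * (c (sdiff C A) * coef y (sdiff C A)) * (c (sdiff (sdiff C A) C) * coef x (sdiff (sdiff C A) C))
        = c C * (bsgn A (sdiff A C) * coef x A * coef y (sdiff A C))"
        by simp
    qed
    also have "\<dots> = coef (twist c (x * y)) C"
      unfolding coef_twist coef_mult[OF U(1,2)] sum_distrib_left ..
    finally show ?thesis ..
  qed
qed

lemma prod_sgn_sdiff:
  assumes "finite A" "finite B" "\<And>a. g a = (1::real) \<or> g a = -1"
  shows "(\<Prod>a\<in>sdiff A B. g a) = (\<Prod>a\<in>A. g a) * (\<Prod>a\<in>B. g a)"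
proof (rule prod_sdiff[OF assms(1,2)])
  show "g a * g a = 1" for a using assms(3)[of a] by auto
qed

lemma alpha_mult: "alpha (x * y) = alpha x * alpha y"
  unfolding alpha_def
proof (rule twist_hom)
  fix A B :: "gen set"
  assume "finite A" "finite B"
  from prod_sgn_sdiff[OF this, of "\<lambda>_. -1"]
  show "(-1::real) ^ card (sdiff A B) = (-1) ^ card A * (-1) ^ card B" by simp
qed

lemma bsgn_swap:
  assumes "finite A" "finite B"
  shows "bsgn A B * bsgn B A = (-1) ^ (card A * card B + card (A \<inter> B))"
proof -
  have s: "gsgn a b * gsgn b a = (if a = b then -1 else 1) * - 1" for a b
    by (cases "(a, b)" rule: gsgn.cases) auto
  have "bsgn B A = (\<Prod>a\<in>A. \<Prod>b\<in>B. gsgn b a)"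
    unfolding bsgn_def by (rule prod.swap)
  then have "bsgn A B * bsgn B A = (\<Prod>a\<in>A. \<Prod>b\<in>B. (if a = b then -1 else 1) * - 1)"
    unfolding bsgn_def by (simp add: s flip: prod.distrib)
  also have "\<dots> = (\<Prod>a\<in>A. (if a \<in> B then -1 else 1) * (-1) ^ card B)"
    unfolding prod.distrib using assms by simp
  also have "\<dots> = (\<Prod>a\<in>A. if a \<in> B then -1 else 1) * (-1) ^ (card A * card B)"
    unfolding prod.distrib by (simp add: mult.commute flip: power_mult)
  also have "(\<Prod>a\<in>A. if a \<in> B then -1 else 1) = (-1 :: real) ^ card (A \<inter> B)"
    using assms by (simp add: prod.If_cases Int_def)
  finally show ?thesis by (simp add: power_add mult.commute)
qed

lemma choose_two_add: "(a + b) choose 2 = (a choose 2) + (b choose 2) + a * (b :: nat)"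
  by (induction a) (simp_all add: numeral_2_eq_2)

lemma transp_sign:
  fixes A B :: "gen set"
  assumes "finite A" "finite B"
  shows "(-1) ^ (card (sdiff A B) choose 2) * bsgn A B
    = (-1) ^ (card A choose 2) * (-1) ^ (card B choose 2) * bsgn B A"
proof -
  define p q r where "p = card (A - B)" and "q = card (B - A)" and "r = card (A \<inter> B)"
  have A: "card A = p + r" and B: "card B = q + r"
    unfolding p_def q_def r_def
    using card_Un_disjoint[of "A - B" "A \<inter> B"] card_Un_disjoint[of "B - A" "B \<inter> A"] assms
    by (auto simp: Un_Diff_Int Un_Diff_Int[of B A, unfolded Int_commute[of B A]] Int_commute[of B A])
  have D: "card (sdiff A B) = p + q"
    unfolding p_def q_def using assms by (intro card_Un_disjoint) auto
  have "even (((p + q) choose 2) + ((p + r) choose 2) + ((q + r) choose 2) + (p + r) * (q + r) + r)"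
  proof -
    have eq: "((p + q) choose 2) + ((p + r) choose 2) + ((q + r) choose 2) + (p + r) * (q + r) + r =
        2 * ((p choose 2) + (q choose 2) + (r choose 2) + p * q + p * r + q * r) + r * (r + 1)"
      unfolding choose_two_add by (simp add: distrib_left distrib_right)
    show ?thesis unfolding eq by simp
  qed
  then have "(-1::real) ^ ((p + q) choose 2) * (-1) ^ ((p + r) choose 2) * (-1) ^ ((q + r) choose 2)
      * (-1) ^ ((p + r) * (q + r) + r) = 1"
    by (simp flip: power_add add: add.assoc)
  then have *: "(-1::real) ^ (card (sdiff A B) choose 2) * (-1) ^ (card A choose 2)
      * (-1) ^ (card B choose 2) * (bsgn A B * bsgn B A) = 1"
    unfolding bsgn_swap[OF assms] A B D r_def[symmetric] .
  have sq: "(-1::real) ^ k * (-1) ^ k = 1" for k :: nat by (simp flip: power_mult_distrib)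
  have "d * s = a * b * t" if "d * a * b * (s * t) = 1" "a * a = 1" "b * b = 1" "t * t = 1"
    for a b d s t :: real
    using that by algebra
  from this[OF * sq sq bsgn_sq] show ?thesis .
qed

lemma transp_mult: "transp (x * y) = transp y * transp x"
  unfolding transp_def by (rule twist_anti_hom) (rule transp_sign)

lemma alpha_V: assumes "v \<in> Vsp m n" shows "alpha v = - v"
proof (rule cliff_eqI)
  fix A
  show "coef (alpha v) A = coef (- v) A"
  proof (cases "coef v A = 0")
    case False
    then obtain a where "A = {a}"
      using supp_V[OF assms] by (auto simp: supp_def)
    then show ?thesis by (simp add: alpha_def)
  qed (simp add: alpha_def)
qed

lemma transp_V: assumes "v \<in> Vsp m n" shows "transp v = v"
proof (rule cliff_eqI)
  fix A
  show "coef (transp v) A = coef v A"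
  proof (cases "coef v A = 0")
    case False
    then obtain a where "A = {a}"
      using supp_V[OF assms] by (auto simp: supp_def)
    then show ?thesis by (simp add: transp_def numeral_2_eq_2)
  qed (simp add: transp_def)
qed

lemma anti_involution_exists:
  "\<exists>s. anti_involution_on (Cl m n) s \<and> s (fb m) = - fb m \<and>
     (\<forall>i\<in>{1..<m}. s (fb i) = fb i) \<and> (\<forall>j\<in>{1..n}. s (eb j) = eb j)"
proof -
  define g where "g a = (if a = F m then -1 else 1 :: real)" for a
  define c where "c A = (-1) ^ (card A choose 2) * (\<Prod>a\<in>A. g a)" for A
  have gg: "(\<Prod>a\<in>A. g a) * (\<Prod>a\<in>A. g a) = 1" for A
  proof -
    have "g a * g a = 1" for a by (simp add: g_def)
    then show ?thesis by (simp flip: prod.distrib)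
  qed
  have cc: "c A * c A = 1" for A
  proof -
    have "c A * c A = ((-1) ^ (card A choose 2) * (-1) ^ (card A choose 2)) * ((\<Prod>a\<in>A. g a) * (\<Prod>a\<in>A. g a))"
      unfolding c_def by (simp only: ac_simps)
    then show ?thesis by (simp add: gg flip: power_mult_distrib)
  qed
  have "twist c (x * y) = twist c y * twist c x" for x y
  proof (rule twist_anti_hom)
    fix A B :: "gen set"
    assume fin: "finite A" "finite B"
    have "(\<Prod>a\<in>sdiff A B. g a) = (\<Prod>a\<in>A. g a) * (\<Prod>a\<in>B. g a)"
      by (rule prod_sgn_sdiff[OF fin]) (auto simp: g_def)
    then have "c (sdiff A B) * bsgn A B
        = ((-1) ^ (card (sdiff A B) choose 2) * bsgn A B) * ((\<Prod>a\<in>A. g a) * (\<Prod>a\<in>B. g a))"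
      unfolding c_def by simp
    also have "\<dots> = c A * c B * bsgn B A"
      unfolding transp_sign[OF fin] c_def by simp
    finally show "c (sdiff A B) * bsgn A B = c A * c B * bsgn B A" .
  qed
  moreover have "twist c (twist c x) = x" for x
    by (rule cliff_eqI) (simp add: cc flip: mult.assoc)
  moreover have "twist c x \<in> Cl m n" if "x \<in> Cl m n" for x
    using that supp_twist unfolding Cl_eq by blast
  ultimately have "anti_involution_on (Cl m n) (twist c)"
    by (simp add: anti_involution_on_def twist_linear)
  moreover have gen: "twist c (blade {a}) = g a *\<^sub>R blade {a}" for a
    by (rule cliff_eqI) (auto simp: c_def coef_blade numeral_2_eq_2)
  ultimately show ?thesis
    by (intro exI[of _ "twist c"]) (auto simp: fb_def eb_def gen g_def)
qed


section \<open>Clifford and spin groups\<close>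

definition unit_elems :: "cliff set \<Rightarrow> cliff set" where
  "unit_elems A = {x\<in>A. \<exists>y\<in>A. x * y = 1 \<and> y * x = 1}"

definition cinv :: "cliff \<Rightarrow> cliff" where
  "cinv x = (THE y. x * y = 1 \<and> y * x = 1)"

definition ClGr :: "nat \<Rightarrow> nat \<Rightarrow> cliff set" where
  "ClGr m n = {x \<in> unit_elems (Cl_even m n). \<forall>v\<in>Vsp m n. alpha x * v * cinv x \<in> Vsp m n}"

definition ClGr0 :: "nat \<Rightarrow> nat \<Rightarrow> cliff set" where
  "ClGr0 m n = connected_component_set (ClGr m n) 1"

text \<open>For \<open>x \<in> ClGr m n\<close> this is a real multiple of \<open>1\<close>.\<close>

definition Nsp :: "cliff \<Rightarrow> cliff" where
  "Nsp x = transp x * x"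

definition Spin :: "nat \<Rightarrow> nat \<Rightarrow> cliff set" where
  "Spin m n = {x \<in> ClGr m n. \<exists>r::real. \<bar>r\<bar> = 1 \<and> Nsp x = of_real r}"

definition Spin0 :: "nat \<Rightarrow> nat \<Rightarrow> cliff set" where
  "Spin0 m n = {x \<in> ClGr0 m n. Nsp x = 1}"

definition Spin0_group :: "nat \<Rightarrow> nat \<Rightarrow> cliff monoid" where
  "Spin0_group m n = \<lparr>carrier = Spin0 m n, monoid.mult = (*), one = 1\<rparr>"

text \<open>\<open>\<iota>\<close> is an inclusion of subsets of \<open>cliff\<close>.\<close>

definition iota0 :: "nat \<Rightarrow> nat \<Rightarrow> cliff \<Rightarrow> cliff" where
  "iota0 m n x = (if Nsp x = 1 then x else x * fb (m + 1) * eb (n + 1))"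

definition Bsp :: "nat \<Rightarrow> nat \<Rightarrow> cliff set" where
  "Bsp m n = span {v * w | v w. v \<in> Vsp m n \<and> w \<in> Vsp m n}"

definition Bplus :: "nat \<Rightarrow> nat \<Rightarrow> (cliff \<Rightarrow> cliff) \<Rightarrow> cliff set" where
  "Bplus m n \<sigma> = {x \<in> Bsp m n. \<sigma> x = x}"

definition Bminus :: "nat \<Rightarrow> nat \<Rightarrow> (cliff \<Rightarrow> cliff) \<Rightarrow> cliff set" where
  "Bminus m n \<sigma> = {x \<in> Bsp m n. \<sigma> x = - x}"

definition spin :: "nat \<Rightarrow> nat \<Rightarrow> cliff set" where
  "spin m n = span (
     {eb i * eb j | i j. i \<in> {1..n} \<and> j \<in> {1..n} \<and> i \<noteq> j} \<union>
     {fb k * eb i | k i. k \<in> {1..m} \<and> i \<in> {1..n}} \<union>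
     {fb k * fb l | k l. k \<in> {1..m} \<and> l \<in> {1..m} \<and> k \<noteq> l})"

definition Vfix :: "nat \<Rightarrow> nat \<Rightarrow> (cliff \<Rightarrow> cliff) \<Rightarrow> cliff set" where
  "Vfix m n \<sigma> = {v \<in> Vsp m n. \<sigma> v = v}"


section \<open>The symplectic groups\<close>

type_synonym mat2 = "cliff^2^2"

definition mk2 :: "cliff \<Rightarrow> cliff \<Rightarrow> cliff \<Rightarrow> cliff \<Rightarrow> mat2" where
  "mk2 a b c d = vector [vector [a, b], vector [c, d]]"

abbreviation diag2 :: "cliff \<Rightarrow> cliff \<Rightarrow> mat2" where "diag2 a d \<equiv> mk2 a 0 0 d"
abbreviation Rm :: "cliff \<Rightarrow> mat2" where "Rm x \<equiv> mk2 1 x 0 1"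
abbreviation Lm :: "cliff \<Rightarrow> mat2" where "Lm x \<equiv> mk2 1 0 x 1"
abbreviation Sm :: "cliff \<Rightarrow> mat2" where "Sm x \<equiv> mk2 0 x x 0"
abbreviation Am :: "cliff \<Rightarrow> mat2" where "Am x \<equiv> mk2 0 (- x) x 0"

definition Omega :: mat2 where "Omega = mk2 0 1 (-1) 0"

definition M2 :: "nat \<Rightarrow> nat \<Rightarrow> mat2 set" where
  "M2 m n = {M. \<forall>i j. M $ i $ j \<in> Cl m n}"

definition GL2 :: "nat \<Rightarrow> nat \<Rightarrow> mat2 set" where
  "GL2 m n = {M \<in> M2 m n. \<exists>M'\<in>M2 m n. M ** M' = mat 1 \<and> M' ** M = mat 1}"

definition entrywise :: "(cliff \<Rightarrow> cliff) \<Rightarrow> mat2 \<Rightarrow> mat2" where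
  "entrywise \<sigma> M = (\<chi> i j. \<sigma> (M $ i $ j))"

definition Sp2_Cl :: "nat \<Rightarrow> nat \<Rightarrow> (cliff \<Rightarrow> cliff) \<Rightarrow> mat2 set" where
  "Sp2_Cl m n \<sigma> = {M \<in> GL2 m n. transpose (entrywise \<sigma> M) ** Omega ** M = Omega}"

definition Sp2_ClGr :: "nat \<Rightarrow> nat \<Rightarrow> (cliff \<Rightarrow> cliff) \<Rightarrow> mat2 set" where
  "Sp2_ClGr m n \<sigma> = top_of_set (Sp2_Cl m n \<sigma>) closure_of
     {Lm y ** diag2 x (cinv (\<sigma> x)) ** Rm z | x y z.
        x \<in> ClGr m n \<and> y \<in> Bplus m n \<sigma> \<and> z \<in> Bplus m n \<sigma>}"

definition Sp2_group :: "nat \<Rightarrow> nat \<Rightarrow> (cliff \<Rightarrow> cliff) \<Rightarrow> mat2 monoid" where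
  "Sp2_group m n \<sigma> = \<lparr>carrier = Sp2_ClGr m n \<sigma>, monoid.mult = (**), one = mat 1\<rparr>"

definition sp2 :: "nat \<Rightarrow> nat \<Rightarrow> (cliff \<Rightarrow> cliff) \<Rightarrow> mat2 set" where
  "sp2 m n \<sigma> = {mk2 x z y (- \<sigma> x) | x y z. x \<in> Bsp m n \<and> y \<in> Bplus m n \<sigma> \<and> z \<in> Bplus m n \<sigma>}"


section \<open>Lie groups and differentials\<close>

text \<open>
  The Lie groups considered here are closed subgroups of the unit group of a finite-dimensional
  algebra inside \<open>cliff\<close> or \<open>mat2\<close>, hence embedded submanifolds. A map between
  embedded submanifolds is smooth iff locally it extends to a smooth map of the ambient spaces.
  Smoothness on open sets is expressed by iterated directional derivatives.
\<close>

primrec higher_differentiable_on ::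
    "nat \<Rightarrow> 'a::real_normed_vector set \<Rightarrow> ('a \<Rightarrow> 'b::real_normed_vector) \<Rightarrow> bool" where
  "higher_differentiable_on 0 U h \<longleftrightarrow> continuous_on U h"
| "higher_differentiable_on (Suc k) U h \<longleftrightarrow> (\<forall>x\<in>U. h differentiable (at x)) \<and>
     (\<forall>v. higher_differentiable_on k U (\<lambda>x. frechet_derivative h (at x) v))"

definition smooth_on_open :: "'a::real_normed_vector set \<Rightarrow> ('a \<Rightarrow> 'b::real_normed_vector) \<Rightarrow> bool" where
  "smooth_on_open U h \<longleftrightarrow> open U \<and> (\<forall>k. higher_differentiable_on k U h)"

definition smooth_map_on :: "'a::real_normed_vector set \<Rightarrow> ('a \<Rightarrow> 'b::real_normed_vector) \<Rightarrow> bool" where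
  "smooth_map_on S h \<longleftrightarrow>
     (\<forall>p\<in>S. \<exists>U g. p \<in> U \<and> smooth_on_open U g \<and> (\<forall>x\<in>S \<inter> U. g x = h x))"

definition lie_group_iso ::
    "'a::real_normed_vector monoid \<Rightarrow> 'b::real_normed_vector monoid \<Rightarrow> ('a \<Rightarrow> 'b) \<Rightarrow> bool" where
  "lie_group_iso G H \<Phi> \<longleftrightarrow> group G \<and> group H \<and> \<Phi> \<in> iso G H \<and>
     smooth_map_on (carrier G) \<Phi> \<and> smooth_map_on (carrier H) (inv_into (carrier G) \<Phi>)"

definition smooth_curve_at ::
    "'a::real_normed_vector set \<Rightarrow> 'a \<Rightarrow> 'a \<Rightarrow> (real \<Rightarrow> 'a) \<Rightarrow> bool" where
  "smooth_curve_at S p X \<gamma> \<longleftrightarrow>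
     (\<exists>\<epsilon>>0. smooth_on_open {-\<epsilon><..<\<epsilon>} \<gamma> \<and> \<gamma> ` {-\<epsilon><..<\<epsilon>} \<subseteq> S) \<and>
     \<gamma> 0 = p \<and> (\<gamma> has_vector_derivative X) (at 0)"

definition tangent_space :: "'a::real_normed_vector set \<Rightarrow> 'a \<Rightarrow> 'a set" where
  "tangent_space S p = {X. \<exists>\<gamma>. smooth_curve_at S p X \<gamma>}"

definition has_differential_at ::
    "('a \<Rightarrow> 'b) \<Rightarrow> 'a::real_normed_vector set \<Rightarrow> 'b::real_normed_vector set \<Rightarrow> 'a \<Rightarrow> ('a \<Rightarrow> 'b) \<Rightarrow> bool" where
  "has_differential_at \<Phi> S S' p \<phi> \<longleftrightarrow>
     (\<forall>X\<in>tangent_space S p. \<phi> X \<in> tangent_space S' (\<Phi> p)) \<and>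
     (\<forall>\<gamma> X. smooth_curve_at S p X \<gamma> \<longrightarrow> ((\<lambda>t. \<Phi> (\<gamma> t)) has_vector_derivative \<phi> X) (at 0))"

definition linear_map_on :: "'a::real_vector set \<Rightarrow> ('a \<Rightarrow> 'b::real_vector) \<Rightarrow> bool" where
  "linear_map_on T \<phi> \<longleftrightarrow> (\<forall>X\<in>T. \<forall>Y\<in>T. \<phi> (X + Y) = \<phi> X + \<phi> Y) \<and> (\<forall>r. \<forall>X\<in>T. \<phi> (r *\<^sub>R X) = r *\<^sub>R \<phi> X)"

text \<open>Lie subalgebras of associative algebras, with the commutator as bracket.\<close>

definition lie_subalgebra :: "('a \<Rightarrow> 'a \<Rightarrow> 'a::real_vector) \<Rightarrow> 'a set \<Rightarrow> bool" where
  "lie_subalgebra mul T \<longleftrightarrow> subspace T \<and> (\<forall>X\<in>T. \<forall>Y\<in>T. mul X Y - mul Y X \<in> T)"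

definition lie_algebra_iso :: "('a \<Rightarrow> 'a \<Rightarrow> 'a::real_vector) \<Rightarrow> ('b \<Rightarrow> 'b \<Rightarrow> 'b::real_vector) \<Rightarrow>
    'a set \<Rightarrow> 'b set \<Rightarrow> ('a \<Rightarrow> 'b) \<Rightarrow> bool" where
  "lie_algebra_iso mul mul' T T' \<phi> \<longleftrightarrow> lie_subalgebra mul T \<and> lie_subalgebra mul' T' \<and>
     linear_map_on T \<phi> \<and> bij_betw \<phi> T T' \<and>
     (\<forall>X\<in>T. \<forall>Y\<in>T. \<phi> (mul X Y - mul Y X) = mul' (\<phi> X) (\<phi> Y) - mul' (\<phi> Y) (\<phi> X))"


section \<open>The two lists of assignments\<close>

definition Phi_assignments :: "nat \<Rightarrow> nat \<Rightarrow> (cliff \<Rightarrow> cliff) \<Rightarrow> (mat2 \<Rightarrow> cliff) \<Rightarrow> bool" where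
  "Phi_assignments m n \<sigma> \<Phi> \<longleftrightarrow>
     (\<forall>y\<in>Spin m n. \<Phi> (diag2 y (cinv (\<sigma> y))) = iota0 m n y) \<and>
     (\<forall>l::real. l > 0 \<longrightarrow> \<Phi> (diag2 (of_real l) (of_real (inverse l))) =
        of_real ((l + inverse l) / 2) + fb (m + 1) * eb (n + 1) * of_real ((l - inverse l) / 2)) \<and>
     (\<forall>v\<in>Vfix m n \<sigma>. \<Phi> (Rm (fb m * v)) = 1 + ((fb (m + 1) + eb (n + 1)) /\<^sub>R 2) * v) \<and>
     (\<forall>v\<in>Vfix m n \<sigma>. \<Phi> (Lm (fb m * v)) = 1 + ((fb (m + 1) - eb (n + 1)) /\<^sub>R 2) * v) \<and>
     \<Phi> (Rm 1) = 1 + ((fb (m + 1) + eb (n + 1)) /\<^sub>R 2) * fb m \<and>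
     \<Phi> (Lm 1) = 1 - ((fb (m + 1) - eb (n + 1)) /\<^sub>R 2) * fb m"

definition phi_assignments :: "nat \<Rightarrow> nat \<Rightarrow> (cliff \<Rightarrow> cliff) \<Rightarrow> (mat2 \<Rightarrow> cliff) \<Rightarrow> bool" where
  "phi_assignments m n \<sigma> \<phi> \<longleftrightarrow>
     (\<forall>a\<in>Bminus m n \<sigma>. \<phi> (diag2 a a) = a) \<and>
     (\<forall>i\<in>{1..n}. \<phi> (diag2 (fb m * eb i) (- (fb m * eb i))) = fb m * eb i) \<and>
     (\<forall>i\<in>{1..<m}. \<phi> (diag2 (fb m * fb i) (- (fb m * fb i))) = fb m * fb i) \<and>
     \<phi> (diag2 1 (-1)) = fb (m + 1) * eb (n + 1) \<and>
     (\<forall>v\<in>Vfix m n \<sigma>. \<phi> (Sm (fb m * v)) = fb (m + 1) * v) \<and>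
     (\<forall>v\<in>Vfix m n \<sigma>. \<phi> (Am (fb m * v)) = v * eb (n + 1)) \<and>
     \<phi> (Sm 1) = - (fb m * eb (n + 1)) \<and>
     \<phi> (Am 1) = fb m * fb (m + 1)"

end

theory Submission
  imports Defs
begin

text \<open>
  Write \<open>f = f\<^sub>m\<^sub>+\<^sub>1\<close>, \<open>e = e\<^sub>n\<^sub>+\<^sub>1\<close>, \<open>A = Cl(m,n)\<close>, \<open>V\<close> for the vectors of \<open>A\<close> and \<open>W\<close> for those of
  \<open>Cl(m+1,n+1)\<close>. The isotropic vectors \<open>p = (f+e)/2\<close> and \<open>q = (f-e)/2\<close>, together with the idempotents
  \<open>-pq\<close> and \<open>-qp\<close>, are up to signs a system of matrix units, and they commute with \<open>A\<close> up to the parity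
  involution. So \<open>Cl(m+1,n+1)\<close> is a twisted matrix algebra over \<open>A\<close>: its elements are
  \<open>Th a b c d\<close> with entries in \<open>A\<close>, and the even ones are those with \<open>a\<close>, \<open>d\<close> even and \<open>b\<close>, \<open>c\<close> odd. Conjugation by
  \<open>diag(1, f\<^sub>m)\<close> makes all entries even. This defines a linear isomorphism \<open>Phi\<close> of algebras from the
  matrices with even entries onto the even part of \<open>Cl(m+1,n+1)\<close>. Both the map of groups and the map
  of Lie algebras in the theorem are restrictions of \<open>Phi\<close>; hence smoothness, the differential
  and the prescribed values are computations, and the content lies in identifying images.

  \<^item> On even elements \<open>\<sigma>(x) = f\<^sub>m x\<^sup>t f\<^sub>m\<^sup>-\<^sup>1\<close>, so that the symplectic condition on a matrix becomes
    \<open>X\<^sup>tX = 1\<close> for its image \<open>X\<close>. Let \<open>S\<close> be the set of even \<open>X\<close> with \<open>X\<^sup>tX = 1\<close> and \<open>XWX\<^sup>t \<subseteq> W\<close>.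

  \<^item> For \<open>X = Th a b c d\<close> in \<open>S\<close> the vector \<open>XpX\<^sup>t\<close> has the coordinates \<open>aa\<^sup>t\<close>, \<open>ac\<^sup>t\<close> and \<open>cc\<^sup>t\<close>. If the
    scalar \<open>aa\<^sup>t\<close> is not zero, then \<open>X\<close> factors as lower triangular, diagonal, upper triangular, with
    off-diagonal entries in \<open>V\<close> and with \<open>a\<close> in the Clifford group (\<open>big_cell\<close>). Multiplication by an
    upper triangular element close to \<open>1\<close> makes \<open>aa\<^sup>t\<close> non-zero (\<open>generic_first_entry\<close>), so these products are
    dense in the closed set \<open>S\<close>. Therefore \<open>Phi\<close> maps \<open>Sp\<^sub>2\<close>, which is defined as a closure, onto
    \<open>S\<close> (\<open>Sp2_eq\<close>).

  \<^item> By the argument of Cartan and Dieudonne the elements of the Clifford group are products of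
    vectors and scalars (\<open>ClGr_vector_product\<close>). It follows that \<open>S\<close> is
    generated by the elementary matrices with off-diagonal entry in \<open>V\<close> (\<open>S_eq_Elem\<close>). These are joined to \<open>1\<close> by segments, so \<open>S\<close> is
    connected and equals \<open>Spin\<^sub>0(m+1,n+1)\<close> (\<open>Spin0_eq\<close>). Generation also shows that the prescribed
    values determine the homomorphism.

  \<^item> The derivative \<open>X\<close> of a curve in \<open>S\<close> at \<open>1\<close> satisfies \<open>X\<^sup>t = -X\<close> and \<open>[X,W] \<subseteq> W\<close>, which leaves only
    components of degree two; conversely products of rotations and boosts realise every such \<open>X\<close>
    (\<open>tangent_Spin1\<close>). The tangent space of the matrix group is transported along \<open>Phi\<close>.
\<close>


section \<open>Coefficients\<close>

lemma bounded_linear_coef: "bounded_linear (\<lambda>x. coef x A)"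
proof (rule bounded_linear_intro[where K = 1])
  fix x
  show "norm (coef x A) \<le> norm x * 1"
  proof (cases "A \<in> supp x")
    case True
    then have "\<bar>coef x A\<bar> \<le> (\<Sum>A\<in>supp x. \<bar>coef x A\<bar>)" by (intro member_le_sum) auto
    then show ?thesis by (simp add: norm_cliff_def)
  qed (auto simp: supp_def)
qed auto

lemma bounded_linear_twist:
  assumes "\<And>A. \<bar>c A\<bar> \<le> 1" shows "bounded_linear (twist c)"
proof (rule bounded_linear_intro[where K = 1])
  fix x
  have "norm (twist c x) = (\<Sum>A\<in>supp x. \<bar>c A * coef x A\<bar>)"
    unfolding norm_cliff_def coef_twist
    by (rule sum.mono_neutral_left) (use finite_supp[of x] in \<open>auto simp: supp_def\<close>)
  also have "\<dots> \<le> norm x"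
    unfolding norm_cliff_def
    by (rule sum_mono) (use assms in \<open>simp add: abs_mult mult_left_le_one_le\<close>)
  finally show "norm (twist c x) \<le> norm x * 1" by simp
qed (simp_all add: twist_linear)

lemma bounded_linear_alpha: "bounded_linear alpha"
  unfolding alpha_def by (rule bounded_linear_twist) (simp add: power_abs)

lemma bounded_linear_transp: "bounded_linear transp"
  unfolding transp_def by (rule bounded_linear_twist) (simp add: power_abs)

lemmas alpha_linear = bounded_linear.linear[OF bounded_linear_alpha]
lemmas transp_linear = bounded_linear.linear[OF bounded_linear_transp]

lemmas alpha_simps [simp] =
  linear_add[OF alpha_linear] linear_diff[OF alpha_linear] linear_neg[OF alpha_linear]
  linear_0[OF alpha_linear] linear_scale[OF alpha_linear] alpha_mult

lemmas transp_simps [simp] =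
  linear_add[OF transp_linear] linear_diff[OF transp_linear] linear_neg[OF transp_linear]
  linear_0[OF transp_linear] linear_scale[OF transp_linear] transp_mult

lemma alpha_of_real [simp]: "alpha (of_real r) = of_real r"
proof -
  have "alpha 1 = 1" by (rule cliff_eqI) (simp add: alpha_def coef_one)
  then show ?thesis by (simp add: of_real_def)
qed

lemma transp_of_real [simp]: "transp (of_real r) = of_real r"
proof -
  have "transp 1 = 1" by (rule cliff_eqI) (simp add: transp_def coef_one numeral_2_eq_2)
  then show ?thesis by (simp add: of_real_def)
qed

lemmas alpha_1 [simp] = alpha_of_real[of 1, simplified]
lemmas transp_1 [simp] = transp_of_real[of 1, simplified]

lemma alpha_alpha [simp]: "alpha (alpha x) = x"
  by (rule cliff_eqI) (simp add: alpha_def flip: mult.assoc power_add)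

lemma transp_transp [simp]: "transp (transp x) = x"
  by (rule cliff_eqI) (simp add: transp_def flip: mult.assoc power_add)

lemma alpha_transp: "alpha (transp x) = transp (alpha x)"
  by (rule cliff_eqI) (simp add: alpha_def transp_def)

lemma coef_of_real: "coef (of_real r) A = (if A = {} then r else 0)"
  by (simp add: of_real_def coef_one)

lemma finite_supp_member: "coef x A \<noteq> 0 \<Longrightarrow> finite A"
  using coef_bound[of x] finite_subset by blast

lemma coef_gen_mult:
  "coef (blade {a} * x) C = bsgn {a} (sdiff {a} C) * coef x (sdiff {a} C)"
proof -
  have "supp (blade {a}) \<subseteq> Pow {a}" by (auto simp: supp_def coef_blade split: if_splits)
  from coef_mult[OF _ this] show ?thesis by (simp add: coef_blade Pow_insert)
qed

lemma coef_mult_gen: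
  "coef (x * blade {a}) C = bsgn (sdiff {a} C) {a} * coef x (sdiff {a} C)"
proof -
  obtain U where U: "finite U" "supp x \<subseteq> Pow U" by (rule supp_bound)
  have "coef (x * blade {a}) C
    = (\<Sum>A\<in>Pow U. if A = sdiff {a} C then bsgn (sdiff {a} C) {a} * coef x (sdiff {a} C) else 0)"
    unfolding coef_mult[OF U]
  proof (intro sum.cong refl)
    fix A
    have "sdiff A C = {a} \<longleftrightarrow> A = sdiff {a} C" by blast
    then show "bsgn A (sdiff A C) * coef x A * coef (blade {a}) (sdiff A C)
      = (if A = sdiff {a} C then bsgn (sdiff {a} C) {a} * coef x (sdiff {a} C) else 0)"
      by (auto simp: coef_blade)
  qed
  then show ?thesis using U coef_outside[OF U(2), of "sdiff {a} C"] by auto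
qed

text \<open>
  On the blade \<open>e\<^sub>A\<close> the operator \<open>x \<mapsto> \<alpha>(x)a - ax\<close> vanishes when the generator \<open>a\<close> is not in \<open>A\<close>, and
  doubles \<open>e\<^sub>A a\<close> up to sign when it is. So it detects exactly the blades that contain \<open>a\<close>, and
  different blades never interfere.
\<close>

lemma twisted_commutator_coef:
  assumes "a \<in> A" "coef (alpha x * blade {a} - blade {a} * x) (A - {a}) = 0"
  shows "coef x A = 0"
proof (cases "finite A")
  case True
  have s: "sdiff {a} (A - {a}) = A" using assms(1) by blast
  have "(-1) ^ card A * bsgn A {a} = - bsgn {a} A"
  proof -
    have "bsgn A {a} * bsgn {a} A = - ((-1) ^ card A)"
      using bsgn_swap[OF True, of "{a}"] assms(1) by simp
    then have "bsgn A {a} * (bsgn A {a} * bsgn {a} A) = - ((-1) ^ card A * bsgn A {a})"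
      by (simp only: mult_minus_right mult.commute)
    then show ?thesis by (simp flip: mult.assoc)
  qed
  then have "((-1) ^ card A * bsgn A {a}) * coef x A = - (bsgn {a} A * coef x A)" by simp
  moreover have "bsgn A {a} * ((-1) ^ card A * coef x A) = bsgn {a} A * coef x A"
    using assms(2) by (simp add: coef_gen_mult coef_mult_gen insert_absorb[OF assms(1)] alpha_def)
  ultimately have "bsgn {a} A * coef x A = 0" by (simp add: mult.assoc mult.left_commute)
  then show ?thesis by (metis bsgn_sq mult_eq_0_iff zero_neq_one)
next
  case False
  then show ?thesis using finite_supp_member by blast
qed

lemma twisted_center_scalar:
  assumes x: "x \<in> Cl m n"
    and com: "\<And>a. a \<in> gens m n \<Longrightarrow> alpha x * blade {a} = blade {a} * x"
  shows "x = of_real (coef x {})"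
proof (rule cliff_eqI)
  fix A
  show "coef x A = coef (of_real (coef x {})) A"
  proof (cases "A \<subseteq> gens m n \<and> A \<noteq> {}")
    case True
    then obtain a where "a \<in> A" "a \<in> gens m n" by blast
    with com show ?thesis using True twisted_commutator_coef[of a A x] by (simp add: coef_of_real)
  next
    case False
    then show ?thesis using x by (auto simp: Cl_eq supp_def coef_of_real)
  qed
qed

lemma closed_supp: "closed {x. supp x \<subseteq> Z}"
proof -
  have "{x. supp x \<subseteq> Z} = (\<Inter>A\<in>- Z. {x. coef x A = 0})" by (auto simp: supp_def)
  moreover have "closed {x. coef x A = 0}" for A
    by (intro closed_Collect_eq continuous_intros
        bounded_linear.continuous_on[OF bounded_linear_coef])
  ultimately show ?thesis by auto
qed

section \<open>Vectors\<close>

lemma subspace_V [simp]: "subspace (Vsp m n)"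
  by (simp add: Vsp_def)

lemma gen_V: "a \<in> gens m n \<Longrightarrow> blade {a} \<in> Vsp m n"
  unfolding Vsp_gens by (intro span_base) auto

lemma Vsp_eq: "Vsp m n = {x. supp x \<subseteq> (\<lambda>a. {a}) ` gens m n}"
proof
  show "{x. supp x \<subseteq> (\<lambda>a. {a}) ` gens m n} \<subseteq> Vsp m n"
  proof
    fix x assume "x \<in> {x. supp x \<subseteq> (\<lambda>a. {a}) ` gens m n}"
    then have "x = (\<Sum>A\<in>(\<lambda>a. {a}) ` gens m n. coef x A *\<^sub>R blade A)"
      by (intro cliff_expand) auto
    also have "\<dots> \<in> Vsp m n"
      by (intro subspace_sum subspace_scale) (auto simp: gen_V)
    finally show "x \<in> Vsp m n" .
  qed
qed (simp add: subsetI supp_V)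

lemma closed_V: "closed (Vsp m n)"
  unfolding Vsp_eq by (rule closed_supp)

lemma Vsp_Cl: "v \<in> Vsp m n \<Longrightarrow> v \<in> Cl m n"
  unfolding Cl_def using alg_span_superset by blast

lemma subspace_Cl: "subspace (Cl m n)"
  unfolding Cl_def by (rule alg_span_closed)

lemma Cl_mult: "x \<in> Cl m n \<Longrightarrow> y \<in> Cl m n \<Longrightarrow> x * y \<in> Cl m n"
  unfolding Cl_def by (rule alg_span_closed)

lemma Cl_of_real: "of_real r \<in> Cl m n"
  unfolding of_real_def Cl_def using alg_span_closed by (intro subspace_scale) auto

lemma Cl_alpha: "x \<in> Cl m n \<Longrightarrow> alpha x \<in> Cl m n"
  unfolding Cl_eq alpha_def using supp_twist by auto

lemma Cl_transp: "x \<in> Cl m n \<Longrightarrow> transp x \<in> Cl m n"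
  unfolding Cl_eq transp_def using supp_twist by auto

lemmas Cl_intros [simp, intro] =
  Vsp_Cl Cl_mult Cl_of_real Cl_alpha Cl_transp
  subspace_add[OF subspace_Cl] subspace_diff[OF subspace_Cl] subspace_neg[OF subspace_Cl]
  subspace_scale[OF subspace_Cl] subspace_0[OF subspace_Cl] Cl_of_real[of 1, simplified]

lemmas V_intros [simp, intro] =
  subspace_add[OF subspace_V] subspace_diff[OF subspace_V] subspace_neg[OF subspace_V]
  subspace_scale[OF subspace_V] subspace_0[OF subspace_V]

lemma of_real_mult_V [simp, intro]:
  "v \<in> Vsp m n \<Longrightarrow> of_real r * v \<in> Vsp m n" "v \<in> Vsp m n \<Longrightarrow> v * of_real r \<in> Vsp m n"
  by (simp_all add: of_real_def)

lemma V_square: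
  assumes "v \<in> Vsp m n" obtains r where "v * v = of_real r"
  using clifford_relation[OF assms] by blast

lemma V_polar:
  assumes "v \<in> Vsp m n" "w \<in> Vsp m n" obtains r where "v * w + w * v = of_real r"
proof -
  obtain a where a: "(v + w) * (v + w) = of_real a" using V_square[of "v + w" m n] assms by auto
  obtain b where b: "v * v = of_real b" using V_square assms by blast
  obtain c where c: "w * w = of_real c" using V_square assms by blast
  have "v * w + w * v = (v + w) * (v + w) - v * v - w * w" by (simp add: algebra_simps)
  also have "\<dots> = of_real (a - b - c)" by (simp only: a b c of_real_diff)
  finally show ?thesis using that by blast
qed

lemma V_sandwich:
  assumes "v \<in> Vsp m n" "w \<in> Vsp m n" shows "v * w * v \<in> Vsp m n"
proof -
  obtain r where r: "v * w + w * v = of_real r" using V_polar assms by blast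
  obtain s where s: "v * v = of_real s" using V_square assms by blast
  have "v * w * v = (v * w + w * v) * v - w * (v * v)" by (simp add: algebra_simps)
  also have "\<dots> \<in> Vsp m n" unfolding r s using assms by auto
  finally show ?thesis .
qed

lemma V_sandwich_polar:
  assumes "u \<in> Vsp m n" "v \<in> Vsp m n" "w \<in> Vsp m n" shows "u * w * v + v * w * u \<in> Vsp m n"
proof -
  have "u * w * v + v * w * u = (u + v) * w * (u + v) - u * w * u - v * w * v"
    by (simp add: algebra_simps)
  then show ?thesis using assms by (simp add: V_sandwich)
qed

lemma V_commutator:
  assumes "u \<in> Vsp m n" "v \<in> Vsp m n" "w \<in> Vsp m n"
  shows "u * v * w - w * (u * v) \<in> Vsp m n"
proof -
  obtain r where r: "v * w + w * v = of_real r" using V_polar assms by blast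
  obtain s where s: "u * w + w * u = of_real s" using V_polar assms by blast
  have "u * v * w - w * (u * v) = u * (v * w + w * v) - (u * w + w * u) * v"
    by (simp add: algebra_simps)
  then show ?thesis unfolding r s using assms by auto
qed

lemma V_nondegenerate:
  assumes "v \<in> Vsp m n" "v \<noteq> 0"
  obtains w r where "w \<in> Vsp m n" "r \<noteq> 0" "w * v + v * w = of_real r"
proof -
  obtain a where a: "a \<in> gens m n" "coef v {a} \<noteq> 0"
  proof (rule ccontr)
    assume "\<not> thesis"
    then have "\<forall>a\<in>gens m n. coef v {a} = 0" using that by blast
    then have "\<forall>A. coef v A = 0" using supp_V[OF assms(1)] by (auto simp: supp_def)
    then show False using assms(2) by (simp add: cliff_eqI)
  qed
  obtain r where r: "blade {a} * v + v * blade {a} = of_real r"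
    using V_polar[OF gen_V[OF a(1)] assms(1)] .
  have "gsgn a a \<noteq> 0" by (cases a) auto
  then have "coef (blade {a} * v + v * blade {a}) {} \<noteq> 0"
    using a(2) by (simp add: coef_gen_mult coef_mult_gen bsgn_def)
  then show ?thesis using that[OF gen_V[OF a(1)] _ r] unfolding r by (auto simp: coef_of_real)
qed

lemma V_linear_surj:
  assumes "linear g" "\<And>v. v \<in> Vsp m n \<Longrightarrow> g v \<in> Vsp m n" "inj_on g (Vsp m n)"
  shows "g ` Vsp m n = Vsp m n"
proof -
  let ?B = "(\<lambda>a. blade {a}) ` gens m n"
  obtain B where B: "B \<subseteq> ?B" "independent B" "span B = Vsp m n"
  proof -
    obtain B where "B \<subseteq> ?B" "independent B" "?B \<subseteq> span B"
      using maximal_independent_subset[of ?B] by blast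
    then show ?thesis unfolding Vsp_gens
      using that[of B] span_mono[of B ?B] span_minimal[of ?B "span B"] by (simp add: Vsp_gens subset_antisym)
  qed
  have fin: "finite B" using B(1) by (rule finite_subset) simp
  have BV: "B \<subseteq> Vsp m n" using B(3) span_superset by blast
  have ind: "independent (g ` B)"
    using linear_independent_injective_image[OF assms(1) B(2)] assms(3) B(3) by simp
  have gB: "g ` B \<subseteq> span B" unfolding B(3) using BV assms(2) by auto
  have "b \<in> span (g ` B)" if "b \<in> B" for b
  proof (rule ccontr)
    assume b: "b \<notin> span (g ` B)"
    then have "independent (insert b (g ` B))" by (rule independent_insertI[OF _ ind])
    moreover have "insert b (g ` B) \<subseteq> span B" using gB that by (simp add: span_base)
    ultimately have "card (insert b (g ` B)) \<le> card B" using independent_span_bound[OF fin] by simp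
    moreover have "b \<notin> g ` B" using b span_base[of b "g ` B"] by argo
    moreover have "card (g ` B) = card B" by (rule card_image[OF inj_on_subset[OF assms(3) BV]])
    ultimately show False using fin by simp
  qed
  then have "Vsp m n \<subseteq> span (g ` B)" unfolding B(3)[symmetric] by (intro span_minimal) auto
  also have "\<dots> = g ` Vsp m n" using linear_span_image[OF assms(1)] B(3) by simp
  finally show ?thesis using assms(2) by auto
qed

section \<open>The even subalgebra and the Lipschitz group\<close>

lemma Cl_even_eq: "Cl_even m n = {x \<in> Cl m n. alpha x = x}"
proof
  show "Cl_even m n \<subseteq> {x \<in> Cl m n. alpha x = x}"
    unfolding Cl_even_def
    by (rule alg_span_minimal) (auto simp: alpha_V intro!: subspaceI)
next
  let ?E = "Cl_even m n"
  have E: "subspace ?E" "1 \<in> ?E" "\<And>x y. x \<in> ?E \<Longrightarrow> y \<in> ?E \<Longrightarrow> x * y \<in> ?E"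
    unfolding Cl_even_def by (rule alg_span_closed; assumption?)+
  have gg: "blade {a} * blade {b} \<in> ?E" if "a \<in> gens m n" "b \<in> gens m n" for a b
    unfolding Cl_even_def using gen_V[OF that(1)] gen_V[OF that(2)]
    by (intro subsetD[OF alg_span_superset] CollectI exI[of _ "blade {a}"] exI[of _ "blade {b}"]) simp
  have blades: "(even (card A) \<longrightarrow> blade A \<in> ?E) \<and>
      (odd (card A) \<longrightarrow> (\<forall>b\<in>gens m n. blade {b} * blade A \<in> ?E))"
    if "finite A" "A \<subseteq> gens m n" for A
    using that
  proof (induction A)
    case empty
    then show ?case using E(2) by (simp flip: one_cliff_def)
  next
    case (insert a A)
    have "blade {a} * blade A = bsgn {a} A *\<^sub>R blade (sdiff {a} A)"
      using insert by (intro blade_mult) auto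
    also have "sdiff {a} A = insert a A" using insert by auto
    finally have "bsgn {a} A *\<^sub>R (blade {a} * blade A) = (bsgn {a} A * bsgn {a} A) *\<^sub>R blade (insert a A)"
      by simp
    then have split: "blade (insert a A) = bsgn {a} A *\<^sub>R (blade {a} * blade A)" by simp
    show ?case
    proof (cases "even (card A)")
      case True
      then have "blade {b} * blade (insert a A) \<in> ?E" if "b \<in> gens m n" for b
        using E(3)[OF gg[of b a] , of "blade A"] insert that
        by (simp add: split subspace_scale[OF E(1)] mult.assoc)
      then show ?thesis using True insert by simp
    next
      case False
      then show ?thesis using insert by (simp add: split subspace_scale[OF E(1)])
    qed
  qed
  show "{x \<in> Cl m n. alpha x = x} \<subseteq> ?E"
  proof
    fix x assume x: "x \<in> {x \<in> Cl m n. alpha x = x}"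
    have even: "even (card A)" if "coef x A \<noteq> 0" for A
    proof (rule ccontr)
      assume "odd (card A)"
      then have "coef (alpha x) A = - coef x A" by (simp add: alpha_def)
      then show False using x that by simp
    qed
    have "x = (\<Sum>A\<in>{A \<in> Pow (gens m n). even (card A)}. coef x A *\<^sub>R blade A)"
      using x even by (intro cliff_expand) (auto simp: Cl_eq supp_def intro: finite_subset)
    also have "\<dots> \<in> ?E"
      using blades by (intro subspace_sum[OF E(1)] subspace_scale[OF E(1)])
        (auto dest: finite_subset[OF _ finite_gens])
    finally show "x \<in> ?E" .
  qed
qed

lemma cinv_eq: "x * y = 1 \<Longrightarrow> y * x = 1 \<Longrightarrow> cinv x = y"
  unfolding cinv_def by (rule the_equality) (auto, metis mult.assoc mult_1 mult_1_right)

text \<open>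
  The Lipschitz group consists of the units \<open>x\<close> of \<open>Cl(m,n)\<close>, of either parity, whose twisted
  conjugation maps \<open>V\<close> to \<open>V\<close>; here \<open>x'\<close> is the inverse of \<open>x\<close>. Odd elements have to be admitted
  because the factorisation into reflections below passes through them.
\<close>

definition lipschitz :: "nat \<Rightarrow> nat \<Rightarrow> cliff \<Rightarrow> cliff \<Rightarrow> bool" where
  "lipschitz m n x x' \<longleftrightarrow> x \<in> Cl m n \<and> x' \<in> Cl m n \<and> x * x' = 1 \<and> x' * x = 1 \<and>
     (\<forall>v\<in>Vsp m n. alpha x * v * x' \<in> Vsp m n)"

lemma lipschitzD:
  assumes "lipschitz m n x x'"
  shows "x \<in> Cl m n" "x' \<in> Cl m n" "x * x' = 1" "x' * x = 1"
    "\<And>v. v \<in> Vsp m n \<Longrightarrow> alpha x * v * x' \<in> Vsp m n"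
    "alpha x * alpha x' = 1" "alpha x' * alpha x = 1"
  using assms unfolding lipschitz_def by (auto simp flip: alpha_mult)

lemma even_inverse:
  assumes "x * x' = 1" "x' * x = 1" "alpha x = x" shows "alpha x' = x'"
proof -
  have "alpha x' * x = 1" using assms by (metis alpha_1 alpha_mult)
  then show ?thesis using assms by (metis mult.assoc mult_1 mult_1_right)
qed

lemma ClGr_iff: "x \<in> ClGr m n \<longleftrightarrow> alpha x = x \<and> (\<exists>x'. lipschitz m n x x')"
proof
  assume x: "x \<in> ClGr m n"
  then obtain y where y: "y \<in> Cl_even m n" "x * y = 1" "y * x = 1"
    by (auto simp: ClGr_def unit_elems_def)
  moreover from this have "cinv x = y" by (intro cinv_eq)
  ultimately show "alpha x = x \<and> (\<exists>x'. lipschitz m n x x')"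
    using x by (auto simp: ClGr_def unit_elems_def lipschitz_def Cl_even_eq)
next
  assume x: "alpha x = x \<and> (\<exists>x'. lipschitz m n x x')"
  then obtain x' where x': "lipschitz m n x x'" by blast
  note l = lipschitzD[OF x']
  have "x' \<in> Cl_even m n" using l x even_inverse[of x x'] by (simp add: Cl_even_eq)
  then show "x \<in> ClGr m n"
    using x l cinv_eq[OF l(3,4)] by (auto simp: ClGr_def unit_elems_def Cl_even_eq)
qed

lemma lipschitz_mult:
  assumes "lipschitz m n x x'" "lipschitz m n y y'"
  shows "lipschitz m n (x * y) (y' * x')"
proof -
  note x = lipschitzD[OF assms(1)] and y = lipschitzD[OF assms(2)]
  have "x * y * (y' * x') = x * (y * y') * x'" "y' * x' * (x * y) = y' * (x' * x) * y"
    by (simp_all add: mult.assoc)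
  moreover have "alpha (x * y) * v * (y' * x') = alpha x * (alpha y * v * y') * x'" for v
    by (simp add: mult.assoc)
  ultimately show ?thesis using x y unfolding lipschitz_def by simp
qed

lemma lipschitz_vector:
  assumes "u \<in> Vsp m n" "u * u = of_real s" "s \<noteq> 0"
  shows "lipschitz m n u (inverse s *\<^sub>R u)"
proof -
  have "alpha u * v * inverse s *\<^sub>R u \<in> Vsp m n" if "v \<in> Vsp m n" for v
    using V_sandwich[OF assms(1) that] alpha_V[OF assms(1)] by simp
  moreover have "u * inverse s *\<^sub>R u = 1" "inverse s *\<^sub>R u * u = 1"
    using assms(2,3) by (simp_all add: of_real_def)
  ultimately show ?thesis using assms(1) unfolding lipschitz_def by simp
qed

text \<open>
  The twisted conjugation is injective on the finite-dimensional space \<open>V\<close>, hence onto, so that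
  inverses of Lipschitz elements are again such.
\<close>

lemma lipschitz_inverse:
  assumes "lipschitz m n x x'" shows "lipschitz m n x' x"
proof -
  note x = lipschitzD[OF assms]
  define g where "g v = alpha x * v * x'" for v
  have undo: "alpha x' * g v * x = v" for v
  proof -
    have "alpha x' * g v * x = (alpha x' * alpha x) * v * (x' * x)" by (simp add: g_def mult.assoc)
    then show ?thesis using x by simp
  qed
  have "linear g" by (rule linearI) (simp_all add: g_def algebra_simps)
  moreover have "inj_on g (Vsp m n)" by (rule inj_on_inverseI[where g = "\<lambda>w. alpha x' * w * x"]) (rule undo)
  ultimately have "g ` Vsp m n = Vsp m n" using x(5) by (intro V_linear_surj) (auto simp: g_def)
  then have "alpha x' * w * x \<in> Vsp m n" if "w \<in> Vsp m n" for w
    using that undo by (metis imageE)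
  then show ?thesis using x unfolding lipschitz_def by blast
qed

text \<open>
  Transposing \<open>xvx\<^sup>-\<^sup>1 \<in> V\<close> gives the same vector, so \<open>x\<^sup>tx\<close> commutes with \<open>V\<close>; being even, it is a
  scalar.
\<close>

lemma ClGr_norm:
  assumes "x \<in> ClGr m n"
  obtains r where "r \<noteq> 0" "transp x * x = of_real r" "x * transp x = of_real r"
    "lipschitz m n x (inverse r *\<^sub>R transp x)"
proof -
  obtain x' where l: "lipschitz m n x x'" and ev: "alpha x = x"
    using assms by (auto simp: ClGr_iff)
  note x = lipschitzD[OF l]
  have tx: "transp x' * transp x = 1" "transp x * transp x' = 1"
    using x by (metis transp_1 transp_mult)+
  have "alpha (transp x * x) * blade {a} = blade {a} * (transp x * x)" if "a \<in> gens m n" for a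
  proof -
    have V: "x * blade {a} * x' \<in> Vsp m n" using x(5)[OF gen_V[OF that]] ev by simp
    have "x * blade {a} * x' = transp x' * blade {a} * transp x"
      using transp_V[OF V] transp_V[OF gen_V[OF that]] by (simp add: mult.assoc)
    then have "transp x * (x * blade {a} * x') * x = transp x * (transp x' * blade {a} * transp x) * x"
      by simp
    also have "\<dots> = (transp x * transp x') * blade {a} * (transp x * x)" by (simp only: mult.assoc)
    also have "\<dots> = blade {a} * (transp x * x)" using tx by simp
    also have "transp x * (x * blade {a} * x') * x = transp x * x * blade {a} * (x' * x)"
      by (simp only: mult.assoc)
    finally show ?thesis using x ev by (simp add: alpha_transp)
  qed
  from twisted_center_scalar[OF _ this, of m n] obtain r where r: "transp x * x = of_real r"
    using x by auto
  have "transp x = (transp x * x) * x'" using x by (simp add: mult.assoc)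
  then have tr: "transp x = of_real r * x'" by (simp add: r)
  have "r \<noteq> 0"
  proof
    assume "r = 0"
    then have "transp (transp x) = 0" unfolding tr by simp
    then show False using x(3) by simp
  qed
  moreover have "x * transp x = of_real r"
    using x(3) by (simp add: tr of_real_def)
  moreover have "inverse r *\<^sub>R transp x = x'"
    using \<open>r \<noteq> 0\<close> by (simp add: tr scaleR_conv_of_real flip: of_real_mult mult.assoc)
  ultimately show ?thesis using that r l by simp
qed

section \<open>Factorisation into vectors\<close>

text \<open>The flag tells whether the number of vectors in the product is even.\<close>

inductive vector_product :: "nat \<Rightarrow> nat \<Rightarrow> bool \<Rightarrow> cliff \<Rightarrow> bool" for m n where
  scalar: "r \<noteq> 0 \<Longrightarrow> vector_product m n True (of_real r)"
| vector: "vector_product m n e x \<Longrightarrow> v \<in> Vsp m n \<Longrightarrow> v * v = of_real s \<Longrightarrow> s \<noteq> 0 \<Longrightarrow>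
    vector_product m n (\<not> e) (x * v)"

lemma vector_product_parity:
  assumes "vector_product m n e x"
  shows "x \<in> Cl m n \<and> alpha x = (if e then x else - x)"
  using assms by (induction) (auto simp: alpha_V)

lemma vector_product_cancel:
  assumes "vector_product m n e (transp (u * x))" "u \<in> Vsp m n" "u * u = of_real s" "s \<noteq> 0"
  shows "vector_product m n (\<not> e) (transp x)"
proof -
  have "transp (u * x) * (inverse s *\<^sub>R u) = inverse s *\<^sub>R (transp x * (u * u))"
    using assms by (simp add: transp_V mult.assoc)
  also have "\<dots> = transp x" using assms by (simp add: of_real_def)
  finally have "transp x = transp (u * x) * (inverse s *\<^sub>R u)" ..
  moreover have "inverse s *\<^sub>R u * inverse s *\<^sub>R u = of_real (inverse s)"
    using assms(3,4) by (simp add: of_real_def)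
  ultimately show ?thesis
    using vector_product.vector[OF assms(1), of "inverse s *\<^sub>R u" "inverse s"] assms(2,4) by simp
qed

text \<open>
  The argument of Cartan and Dieudonne: \<open>U\<close> is the set of basis vectors that \<open>x\<close> may still move.
  If \<open>x\<close> sends \<open>a\<close> to \<open>b\<close>, then \<open>a\<^sup>2 = b\<^sup>2 \<noteq> 0\<close>, so that one of \<open>a \<plusminus> b\<close> is not isotropic, and
  reflections in these vectors and in \<open>a\<close> bring \<open>b\<close> back to \<open>a\<close> without moving the basis vectors
  already fixed. Factors are collected on the left of \<open>x\<close>, which puts them on the right of \<open>x\<^sup>t\<close>.
\<close>

lemma lipschitz_factorisation:
  assumes "finite U" "U \<subseteq> gens m n" "lipschitz m n x x'"
    "\<And>a. a \<in> gens m n - U \<Longrightarrow> alpha x * blade {a} = blade {a} * x"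
  shows "\<exists>e. vector_product m n e (transp x)"
  using assms
proof (induction U arbitrary: x x')
  case empty
  note x = lipschitzD[OF empty.prems(2)]
  have "x = of_real (coef x {})"
    using twisted_center_scalar[OF x(1)] empty.prems(3) by simp
  then obtain r where r: "x = of_real r" by blast
  then have "r \<noteq> 0" using x(3) by auto
  then show ?case using vector_product.scalar[of r m n] r by auto
next
  case (insert a0 U)
  note x = lipschitzD[OF insert.prems(2)]
  define a where "a = blade {a0}"
  define b where "b = alpha x * a * x'"
  have aV: "a \<in> Vsp m n" unfolding a_def using insert by (intro gen_V) auto
  have bV: "b \<in> Vsp m n" unfolding b_def using x(5)[OF aV] .
  have bx: "alpha x * a = b * x" using x by (simp add: b_def mult.assoc)
  \<comment> \<open>Applying \<open>\<alpha>\<close> to the vector \<open>\<alpha>(x)vx'\<close> gives the second expression \<open>xv\<alpha>(x')\<close> for it.\<close>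
  have isometry: "(alpha x * v * x') * (alpha x * v * x') = v * v" if v: "v \<in> Vsp m n" for v
  proof -
    have "alpha (alpha x * v * x') = - (alpha x * v * x')" by (rule alpha_V[OF x(5)[OF v]])
    then have "alpha x * v * x' = x * v * alpha x'" using alpha_V[OF v] by simp
    then have "(alpha x * v * x') * (alpha x * v * x') = (alpha x * v * x') * (x * v * alpha x')" by simp
    also have "\<dots> = alpha x * v * (x' * x) * v * alpha x'" by (simp only: mult.assoc)
    also have "\<dots> = alpha x * (v * v) * alpha x'" using x by (simp add: mult.assoc)
    also have "\<dots> = v * v"
    proof -
      obtain r where "v * v = of_real r" using V_square v by blast
      then show ?thesis using x by (simp add: of_real_def)
    qed
    finally show ?thesis .
  qed
  obtain s where s: "a * a = of_real s" "s \<noteq> 0"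
  proof
    show "a * a = of_real (gsq a0)" unfolding a_def by (rule gen_sq)
    show "gsq a0 \<noteq> 0" by (cases a0) auto
  qed
  have bb: "b * b = of_real s" using isometry[OF aV] s b_def by simp
  have orth: "c * a = - (a * c)" "c * b = - (b * c)" "alpha x * c = c * x"
    if "c0 \<in> gens m n - insert a0 U" "c = blade {c0}" for c c0
  proof -
    have cV: "c \<in> Vsp m n" using that gen_V by auto
    show ac: "c * a = - (a * c)" unfolding a_def that(2) using that(1) by (intro gen_anticommute) auto
    show cx: "alpha x * c = c * x" using insert.prems(3) that by blast
    have "alpha x * (a + c) * x' = b + c"
      using x by (simp add: b_def algebra_simps cx mult.assoc)
    then have "(b + c) * (b + c) = (a + c) * (a + c)" using isometry[of "a + c"] aV cV by auto
    then show "c * b = - (b * c)" using ac bb s by (simp add: algebra_simps eq_neg_iff_add_eq_0)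
  qed
  obtain k where k: "(a - b) * (a - b) = of_real k" using V_square[of "a - b" m n] aV bV by auto
  obtain l where l: "(a + b) * (a + b) = of_real l" using V_square[of "a + b" m n] aV bV by auto
  have "of_real (k + l) = (of_real (4 * s) :: cliff)"
  proof -
    have "of_real (k + l) = (a - b) * (a - b) + (a + b) * (a + b)" unfolding k l by simp
    also have "\<dots> = 2 *\<^sub>R (a * a) + 2 *\<^sub>R (b * b)" by (simp add: algebra_simps scaleR_2)
    also have "\<dots> = of_real (4 * s)" unfolding s(1) bb by (simp add: of_real_def flip: scaleR_left_distrib)
    finally show ?thesis .
  qed
  then have "k + l = 4 * s" by (simp only: of_real_eq_iff)
  then have kl: "k \<noteq> 0 \<or> l \<noteq> 0" using s(2) by auto
  show ?case
  proof (cases "k = 0")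
    case False
    let ?u = "a - b"
    have uV: "?u \<in> Vsp m n" using aV bV by auto
    have "\<exists>e. vector_product m n e (transp (?u * x))"
    proof (rule insert.IH)
      show "U \<subseteq> gens m n" using insert by simp
      show "lipschitz m n (?u * x) (x' * (inverse k *\<^sub>R ?u))"
        by (rule lipschitz_mult[OF lipschitz_vector[OF uV k False] insert.prems(2)])
      fix c0 assume c0: "c0 \<in> gens m n - U"
      have eq: "alpha (?u * x) * c = - (?u * (alpha x * c))" for c
        by (simp only: alpha_mult alpha_V[OF uV] mult_minus_left mult.assoc)
      show "alpha (?u * x) * blade {c0} = blade {c0} * (?u * x)"
      proof (cases "c0 = a0")
        case True
        have "- (?u * (b * x)) = a * (?u * x)"
        proof -
          have "- (?u * (b * x)) = (b * b - a * b) * x" by (simp add: algebra_simps)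
          also have "\<dots> = (a * a - a * b) * x" by (simp only: bb s(1))
          finally show ?thesis by (simp add: algebra_simps)
        qed
        then show ?thesis unfolding eq True by (simp add: bx flip: a_def)
      next
        case False
        then have o: "c0 \<in> gens m n - insert a0 U" using c0 by auto
        have "blade {c0} * ?u = - (?u * blade {c0})"
          using orth(1,2)[OF o refl] by (simp add: algebra_simps)
        then show ?thesis unfolding eq orth(3)[OF o refl] by (metis minus_mult_left mult.assoc)
      qed
    qed
    then show ?thesis using vector_product_cancel[OF _ uV k False] by blast
  next
    case True
    let ?u = "a + b"
    have l0: "l \<noteq> 0" using kl True by simp
    have uV: "?u \<in> Vsp m n" using aV bV by auto
    have "\<exists>e. vector_product m n e (transp (a * (?u * x)))"
    proof (rule insert.IH)
      show "U \<subseteq> gens m n" using insert by simp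
      show "lipschitz m n (a * (?u * x)) ((x' * (inverse l *\<^sub>R ?u)) * (inverse s *\<^sub>R a))"
        by (rule lipschitz_mult[OF lipschitz_vector[OF aV s]
              lipschitz_mult[OF lipschitz_vector[OF uV l l0] insert.prems(2)]])
      fix c0 assume c0: "c0 \<in> gens m n - U"
      have eq: "alpha (a * (?u * x)) * c = a * (?u * (alpha x * c))" for c
        by (simp only: alpha_mult alpha_V[OF uV] alpha_V[OF aV] mult_minus_left mult_minus_right
            minus_minus mult.assoc)
      show "alpha (a * (?u * x)) * blade {c0} = blade {c0} * (a * (?u * x))"
      proof (cases "c0 = a0")
        case True
        have "?u * (b * x) = a * (?u * x)"
        proof -
          have "?u * (b * x) = (b * b + a * b) * x" by (simp add: algebra_simps)
          also have "\<dots> = (a * a + a * b) * x" by (simp only: bb s(1))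
          finally show ?thesis by (simp add: algebra_simps)
        qed
        then show ?thesis unfolding eq True by (simp add: bx flip: a_def)
      next
        case False
        then have o: "c0 \<in> gens m n - insert a0 U" using c0 by auto
        have "blade {c0} * (a * ?u) = (a * ?u) * blade {c0}"
        proof -
          have "blade {c0} * (a * ?u) = (blade {c0} * a) * a + (blade {c0} * a) * b"
            by (simp add: algebra_simps)
          also have "\<dots> = - (a * (blade {c0} * a)) - (a * (blade {c0} * b))"
            by (simp add: orth(1)[OF o refl] mult.assoc)
          also have "\<dots> = (a * ?u) * blade {c0}"
            by (simp add: orth(1,2)[OF o refl] algebra_simps)
          finally show ?thesis .
        qed
        then show ?thesis unfolding eq orth(3)[OF o refl] by (metis mult.assoc)
      qed
    qed
    then obtain e where "vector_product m n e (transp (a * (?u * x)))" ..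
    from vector_product_cancel[OF vector_product_cancel[OF this aV s] uV l l0]
    show ?thesis by blast
  qed
qed

text \<open>
  The factorisation is applied to the inverse of \<open>x\<close>, whose transpose is a multiple of \<open>x\<close>. The
  number of vectors is even because \<open>x\<close> is even.
\<close>

lemma ClGr_vector_product:
  assumes "x \<in> ClGr m n" shows "vector_product m n True x"
proof -
  obtain r where r: "r \<noteq> 0" "transp x * x = of_real r" "lipschitz m n x (inverse r *\<^sub>R transp x)"
    using ClGr_norm[OF assms] by metis
  have "lipschitz m n (inverse r *\<^sub>R transp x) x" by (rule lipschitz_inverse[OF r(3)])
  from lipschitz_factorisation[OF finite_gens subset_refl this]
  obtain e where e: "vector_product m n e (inverse r *\<^sub>R x)" by auto
  have ev: "alpha x = x" using assms by (simp add: ClGr_iff)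
  have scale: "vector_product m n e (t *\<^sub>R y)" if "vector_product m n e y" "t \<noteq> 0" for e t y
    using that
  proof (induction)
    case (scalar q)
    then show ?case using vector_product.scalar[of "t * q" m n] by (simp add: scaleR_conv_of_real)
  next
    case (vector e x v s)
    then show ?case using vector_product.vector[of m n e "t *\<^sub>R x" v s] by simp
  qed
  have "vector_product m n e x" using scale[OF e r(1)] r(1) by simp
  moreover have e
  proof (rule ccontr)
    assume "\<not> e"
    then have "x = - x" using vector_product_parity[OF calculation] ev by simp
    then have "x = 0" by (metis add.right_inverse scaleR_2 scaleR_eq_0_iff zero_neq_numeral)
    then show False using r by simp
  qed
  ultimately show ?thesis by simp
qed

section \<open>Elements of norm one\<close>

definition Spin1 :: "nat \<Rightarrow> nat \<Rightarrow> cliff set" where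
  "Spin1 m n = {x \<in> ClGr m n. Nsp x = 1}"

lemma Spin1_iff:
  "x \<in> Spin1 m n \<longleftrightarrow> x \<in> Cl m n \<and> alpha x = x \<and> transp x * x = 1 \<and> x * transp x = 1 \<and>
     (\<forall>v\<in>Vsp m n. x * v * transp x \<in> Vsp m n)"
proof
  assume "x \<in> Spin1 m n"
  then have x: "x \<in> ClGr m n" "transp x * x = 1" by (auto simp: Spin1_def Nsp_def)
  obtain r where r: "transp x * x = of_real r" "lipschitz m n x (inverse r *\<^sub>R transp x)"
    using ClGr_norm[OF x(1)] by metis
  then have "of_real r = (of_real 1 :: cliff)" using x(2) by simp
  then have "r = 1" by (simp only: of_real_eq_iff)
  then show "x \<in> Cl m n \<and> alpha x = x \<and> transp x * x = 1 \<and> x * transp x = 1 \<and>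
     (\<forall>v\<in>Vsp m n. x * v * transp x \<in> Vsp m n)"
    using lipschitzD[OF r(2)] x by (auto simp: ClGr_iff)
next
  assume x: "x \<in> Cl m n \<and> alpha x = x \<and> transp x * x = 1 \<and> x * transp x = 1 \<and>
     (\<forall>v\<in>Vsp m n. x * v * transp x \<in> Vsp m n)"
  then have "lipschitz m n x (transp x)" by (auto simp: lipschitz_def)
  then show "x \<in> Spin1 m n" using x by (auto simp: Spin1_def Nsp_def ClGr_iff)
qed

lemma Spin1D:
  assumes "x \<in> Spin1 m n"
  shows "x \<in> Cl m n" "alpha x = x" "transp x * x = 1" "x * transp x = 1"
    "\<And>v. v \<in> Vsp m n \<Longrightarrow> x * v * transp x \<in> Vsp m n"
  using assms unfolding Spin1_iff by auto

lemma Spin1_one: "1 \<in> Spin1 m n"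
  by (simp add: Spin1_iff)

lemma Spin1_mult:
  assumes "x \<in> Spin1 m n" "y \<in> Spin1 m n" shows "x * y \<in> Spin1 m n"
proof -
  note x = Spin1D[OF assms(1)] and y = Spin1D[OF assms(2)]
  have "transp y * transp x * (x * y) = transp y * (transp x * x) * y"
    "x * y * (transp y * transp x) = x * (y * transp y) * transp x"
    "x * y * v * (transp y * transp x) = x * (y * v * transp y) * transp x" for v
    by (simp_all add: mult.assoc)
  then show ?thesis unfolding Spin1_iff using x y by simp
qed

lemma Spin1_transp:
  assumes "x \<in> Spin1 m n" shows "transp x \<in> Spin1 m n"
proof -
  note x = Spin1D[OF assms]
  have "lipschitz m n x (transp x)" using x by (simp add: lipschitz_def)
  from lipschitzD[OF lipschitz_inverse[OF this]] x show ?thesis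
    by (simp add: Spin1_iff alpha_transp)
qed

lemma closed_Spin1: "closed (Spin1 m n)"
proof -
  have cont: "continuous_on UNIV alpha" "continuous_on UNIV transp"
    using bounded_linear_alpha bounded_linear_transp
    by (auto intro: bounded_linear.continuous_on continuous_on_id)
  have "closed {x. x * v * transp x \<in> Vsp m n}" for v
    using closed_vimage[OF closed_V, of "\<lambda>x. x * v * transp x" m n]
    by (simp add: vimage_def continuous_intros cont)
  moreover have "closed (Cl m n)" unfolding Cl_eq by (rule closed_supp)
  moreover have "closed {x. alpha x = x}" "closed {x. transp x * x = 1}" "closed {x. x * transp x = 1}"
    by (intro closed_Collect_eq continuous_intros cont)+
  moreover have "Spin1 m n = Cl m n \<inter> {x. alpha x = x} \<inter> {x. transp x * x = 1}
      \<inter> {x. x * transp x = 1} \<inter> (\<Inter>v\<in>Vsp m n. {x. x * v * transp x \<in> Vsp m n})"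
    by (auto simp: Spin1_iff)
  ultimately show ?thesis by (auto intro!: closed_Int closed_INT)
qed

lemma Spin1_vector_pair:
  assumes "u \<in> Vsp m n" "v \<in> Vsp m n" "u * u = of_real r" "v * v = of_real s" "r * s = 1"
  shows "u * v \<in> Spin1 m n"
proof -
  have "v * u * (u * v) = v * (u * u) * v" "u * v * (v * u) = u * (v * v) * u"
    by (simp_all add: mult.assoc)
  then have "v * u * (u * v) = 1" "u * v * (v * u) = 1"
    using assms(3-5) by (simp_all add: of_real_def mult.commute)
  moreover have "u * v * w * (v * u) \<in> Vsp m n" if "w \<in> Vsp m n" for w
    using V_sandwich[OF assms(1) V_sandwich[OF assms(2) that]] by (simp add: mult.assoc)
  ultimately show ?thesis
    unfolding Spin1_iff using assms(1,2) by (simp add: transp_V alpha_V)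
qed

text \<open>
  Conjugation by \<open>1 + uw\<close>, with \<open>u\<close> isotropic and orthogonal to \<open>w\<close>, is an Eichler transformation.
  Expanded, it adds to \<open>v\<close> only vectors of the form \<open>xv'x\<close> and polarisations of such expressions.
\<close>

lemma Spin1_eichler:
  assumes "u \<in> Vsp m n" "w \<in> Vsp m n" "u * u = 0" "w * u = - (u * w)"
  shows "1 + u * w \<in> Spin1 m n"
proof -
  have uwuw: "u * w * (u * w) = 0"
  proof -
    have "u * w * (u * w) = - (u * (u * w * w))" using assms(4) by (metis minus_mult_left minus_mult_right mult.assoc)
    then show ?thesis using assms(3) by (simp flip: mult.assoc)
  qed
  have t: "transp (1 + u * w) = 1 - u * w" using assms by (simp add: transp_V)
  have "(1 + u * w) * v * (1 - u * w) \<in> Vsp m n" if v: "v \<in> Vsp m n" for v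
  proof -
    have "(1 + u * w) * v * (1 - u * w) = v + (u * w * v + v * w * u) + u * (w * v * w) * u"
      using assms(4) by (simp add: algebra_simps)
    then show ?thesis
      using V_sandwich_polar[OF assms(1) v assms(2)] V_sandwich[OF assms(1) V_sandwich[OF assms(2) v]] v
      by simp
  qed
  then show ?thesis
    unfolding Spin1_iff t using assms(1,2) uwuw by (simp add: alpha_V algebra_simps)
qed

section \<open>\<open>Cl(m+1,n+1)\<close> as an algebra of two by two matrices\<close>

text \<open>A new generator anticommutes with \<open>V\<close>, hence it commutes with \<open>Cl(m,n)\<close> up to \<open>\<alpha>\<close>.\<close>

lemma Cl_anticommute_gen:
  assumes "x \<in> Cl m n" "g \<notin> gens m n" shows "x * blade {g} = blade {g} * alpha x"
proof -
  let ?Z = "{x. x * blade {g} = blade {g} * alpha x}"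
  have Z: "subspace ?Z" by (rule subspaceI) (auto simp: algebra_simps)
  have "blade {a} \<in> ?Z" if "a \<in> gens m n" for a
    using gen_anticommute[of a g] assms(2) that alpha_V[OF gen_V[OF that]] by auto
  then have "Vsp m n \<subseteq> ?Z" unfolding Vsp_gens by (intro span_minimal Z) auto
  then have "Cl m n \<subseteq> ?Z" unfolding Cl_def
  proof (rule alg_span_minimal[OF _ Z])
    fix x y assume "x \<in> ?Z" "y \<in> ?Z"
    then have x: "x * blade {g} = blade {g} * alpha x" and y: "y * blade {g} = blade {g} * alpha y" by auto
    have "x * y * blade {g} = x * blade {g} * alpha y" by (simp add: y mult.assoc)
    then show "x * y \<in> ?Z" by (simp add: x mult.assoc)
  qed simp
  then show ?thesis using assms(1) by blast
qed

locale hyperbolic_extension =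
  fixes m n :: nat
  assumes m_pos: "m \<ge> 1"
begin

definition f :: cliff where "f = fb (m + 1)"
definition e :: cliff where "e = eb (n + 1)"
definition p :: cliff where "p = (f + e) /\<^sub>R 2"
definition q :: cliff where "q = (f - e) /\<^sub>R 2"
definition ep :: cliff where "ep = - (p * q)"
definition em :: cliff where "em = - (q * p)"

abbreviation "A \<equiv> Cl m n"
abbreviation "V \<equiv> Vsp m n"
definition W :: "cliff set" where "W = Vsp (m + 1) (n + 1)"
definition A2 :: "cliff set" where "A2 = Cl (m + 1) (n + 1)"
definition S :: "cliff set" where "S = Spin1 (m + 1) (n + 1)"

lemmas W_intros [simp] = V_intros[where m = "m + 1" and n = "n + 1", folded W_def]
lemmas A2_intros [simp] = Cl_intros[where m = "m + 1" and n = "n + 1", folded A2_def W_def]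

lemma gens_Suc: "gens (m + 1) (n + 1) = insert (F (m + 1)) (insert (E (n + 1)) (gens m n))"
  by (auto simp: gens_def image_iff le_Suc_eq Bex_def)

lemma new_gens: "F (m + 1) \<notin> gens m n" "E (n + 1) \<notin> gens m n"
  by (auto simp: gens_def)

lemma fe_relations: "f * f = - 1" "e * e = 1" "e * f = - (f * e)"
  using gen_sq[of "F (m + 1)"] gen_sq[of "E (n + 1)"] gen_anticommute[of "E (n + 1)" "F (m + 1)"]
  by (simp_all add: f_def e_def fb_def eb_def)

lemma f_comm: "x \<in> A \<Longrightarrow> x * f = f * alpha x" and e_comm: "x \<in> A \<Longrightarrow> x * e = e * alpha x"
  using Cl_anticommute_gen new_gens by (auto simp: f_def e_def fb_def eb_def)

lemma f_W: "f \<in> W" and e_W: "e \<in> W"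
  unfolding f_def fb_def e_def eb_def W_def
  by (rule gen_V; simp only: gens_Suc insert_iff simp_thms)+

lemma p_W [simp]: "p \<in> W" and q_W [simp]: "q \<in> W"
  by (simp_all add: p_def q_def f_W e_W)

lemma V_W [simp]: "v \<in> V \<Longrightarrow> v \<in> W"
  unfolding W_def Vsp_gens gens_Suc by (erule subsetD[OF span_mono, rotated]) auto

lemma A_A2 [simp]: "x \<in> A \<Longrightarrow> x \<in> A2"
  unfolding A2_def Cl_eq gens_Suc by (auto simp: subset_iff)

lemma pq_relations: "p * p = 0" "q * q = 0" "p * q + q * p = - 1"
proof -
  have "(f + e) * (f + e) = 0" "(f - e) * (f - e) = 0"
    "(f + e) * (f - e) + (f - e) * (f + e) = - (4 *\<^sub>R 1)"
    by (simp_all add: algebra_simps fe_relations scaleR_2[symmetric])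
  then show "p * p = 0" "q * q = 0" "p * q + q * p = - 1"
    by (simp_all add: p_def q_def flip: scaleR_right_distrib)
qed

lemma p_plus_q: "p + q = f" and p_minus_q: "p - q = e"
proof -
  have half: "(x /\<^sub>R 2) + (x /\<^sub>R 2) = (x :: cliff)" for x
    by (simp flip: scaleR_left_distrib)
  show "p + q = f" "p - q = e"
    unfolding p_def q_def scaleR_right_distrib scaleR_right_diff_distrib using half[of f] half[of e]
    by (simp_all add: algebra_simps)
qed

lemma pqp: "p * q * p = - p" and qpq: "q * p * q = - q"
proof -
  have "p * (p * q + q * p) = - p" "q * (p * q + q * p) = - q"
    unfolding pq_relations(3) by simp_all
  then show "p * q * p = - p" "q * p * q = - q"
    by (simp_all add: distrib_left pq_relations(1,2) flip: mult.assoc)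
qed

lemma ep_em: "ep + em = 1"
proof -
  have "ep + em = - (p * q + q * p)" by (simp add: ep_def em_def)
  then show ?thesis by (simp only: pq_relations) simp
qed

lemma unit_relations:
  "ep * ep = ep" "ep * p = p" "ep * q = 0" "ep * em = 0"
  "p * ep = 0" "p * p = 0" "p * q = - ep" "p * em = p"
  "q * ep = q" "q * p = - em" "q * q = 0" "q * em = 0"
  "em * ep = 0" "em * p = 0" "em * q = q" "em * em = em"
proof -
  show ep_p: "ep * p = p" and q_ep: "q * ep = q" and p_em: "p * em = p" and em_q: "em * q = q"
    by (simp_all add: ep_def em_def pqp qpq flip: mult.assoc)
  show ep_q: "ep * q = 0" and p_ep: "p * ep = 0" and em_p: "em * p = 0" and q_em: "q * em = 0"
    by (simp_all add: ep_def em_def mult.assoc pq_relations) (simp_all add: pq_relations flip: mult.assoc)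
  show "p * p = 0" "p * q = - ep" "q * p = - em" "q * q = 0"
    by (simp_all add: pq_relations ep_def em_def)
  show "ep * ep = ep"
  proof -
    have "ep * ep = - (ep * p * q)" by (simp add: ep_def mult.assoc)
    then show ?thesis unfolding ep_p by (simp add: ep_def)
  qed
  show "em * em = em"
  proof -
    have "em * em = - (em * q * p)" by (simp add: em_def mult.assoc)
    then show ?thesis unfolding em_q by (simp add: em_def)
  qed
  show "ep * em = 0"
  proof -
    have "ep * em = - (ep * q * p)" by (simp add: em_def mult.assoc)
    then show ?thesis unfolding ep_q by simp
  qed
  show "em * ep = 0"
  proof -
    have "em * ep = - (em * p * q)" by (simp add: ep_def mult.assoc)
    then show ?thesis unfolding em_p by simp
  qed
qed

lemma f_e: "f * e = ep - em"
  by (simp add: p_plus_q[symmetric] p_minus_q[symmetric] distrib_left distrib_right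
      right_diff_distrib left_diff_distrib unit_relations)

lemma unit_relations_left:
  "ep * (ep * y) = ep * y" "ep * (p * y) = p * y" "ep * (q * y) = 0" "ep * (em * y) = 0"
  "p * (ep * y) = 0" "p * (p * y) = 0" "p * (q * y) = - (ep * y)" "p * (em * y) = p * y"
  "q * (ep * y) = q * y" "q * (p * y) = - (em * y)" "q * (q * y) = 0" "q * (em * y) = 0"
  "em * (ep * y) = 0" "em * (p * y) = 0" "em * (q * y) = q * y" "em * (em * y) = em * y"
  by (simp_all add: unit_relations flip: mult.assoc)

lemma p_comm: "x \<in> A \<Longrightarrow> x * p = p * alpha x" and q_comm: "x \<in> A \<Longrightarrow> x * q = q * alpha x"
  by (simp_all add: p_def q_def algebra_simps f_comm e_comm)

lemma unit_commute:
  assumes "x \<in> A"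
  shows "x * (p * y) = p * (alpha x * y)" "x * (q * y) = q * (alpha x * y)"
    "x * (ep * y) = ep * (x * y)" "x * (em * y) = em * (x * y)"
proof -
  have ax: "alpha x \<in> A" using assms by simp
  show p: "x * (p * y) = p * (alpha x * y)" and q: "x * (q * y) = q * (alpha x * y)"
    by (simp_all only: mult.assoc[symmetric] p_comm[OF assms] q_comm[OF assms])
  have "x * p * q = p * q * x" "x * q * p = q * p * x"
    by (simp_all add: p_comm[OF assms] q_comm[OF assms] mult.assoc p_comm[OF ax] q_comm[OF ax])
  then show "x * (ep * y) = ep * (x * y)" "x * (em * y) = em * (x * y)"
    by (simp_all add: ep_def em_def flip: mult.assoc)
qed

text \<open>
  \<open>ep\<close>, \<open>p\<close>, \<open>q\<close>, \<open>em\<close> multiply like the four matrix units up to signs, and \<open>x \<in> A\<close> commutes with them up to \<open>\<alpha>\<close>.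
  So \<open>Th a b c d\<close> stands for the matrix with rows \<open>(a, b)\<close> and \<open>(c, d)\<close>, with a twisted product.
  The signs cancel, leaving the ordinary matrix product, when \<open>a\<close>, \<open>d\<close> are even and \<open>b\<close>, \<open>c\<close> are odd.
\<close>

definition Th :: "cliff \<Rightarrow> cliff \<Rightarrow> cliff \<Rightarrow> cliff \<Rightarrow> cliff" where
  "Th a b c d = ep * a + p * b + q * c + em * d"

lemma Th_mult:
  assumes "a \<in> A" "b \<in> A" "c \<in> A" "d \<in> A"
  shows "Th a b c d * Th a' b' c' d' =
    Th (a * a' - alpha b * c') (alpha a * b' + b * d') (c * a' + alpha d * c') (d * d' - alpha c * b')"
  unfolding Th_def
  by (simp add: distrib_left distrib_right right_diff_distrib left_diff_distrib mult.assoc unit_commute[OF assms(1)] unit_commute[OF assms(2)]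
      unit_commute[OF assms(3)] unit_commute[OF assms(4)] unit_relations_left)

lemma Th_add: "Th a b c d + Th a' b' c' d' = Th (a + a') (b + b') (c + c') (d + d')"
  and Th_scale: "r *\<^sub>R Th a b c d = Th (r *\<^sub>R a) (r *\<^sub>R b) (r *\<^sub>R c) (r *\<^sub>R d)"
  by (simp_all add: Th_def algebra_simps)

lemma Th_diagonal: "Th a 0 0 a = a"
  using ep_em by (simp add: Th_def flip: distrib_right)

lemma Th_vector: "Th v (of_real r) (of_real s) v = v + r *\<^sub>R p + s *\<^sub>R q"
  using Th_diagonal[of v] by (simp add: Th_def of_real_def algebra_simps)

lemma Th_alpha: "alpha (Th a b c d) = Th (alpha a) (- alpha b) (- alpha c) (alpha d)"
proof -
  have "alpha p = - p" "alpha q = - q" using alpha_V p_W q_W unfolding W_def by blast+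
  moreover from this have "alpha ep = ep" "alpha em = em" by (simp_all add: ep_def em_def)
  ultimately show ?thesis by (simp add: Th_def)
qed

lemma Th_transp:
  assumes "a \<in> A" "b \<in> A" "c \<in> A" "d \<in> A"
  shows "transp (Th a b c d)
    = Th (transp d) (alpha (transp b)) (alpha (transp c)) (transp a)"
proof -
  have pq: "transp p = p" "transp q = q" using transp_V p_W q_W unfolding W_def by blast+
  moreover from this have "transp ep = em" "transp em = ep" by (simp_all add: ep_def em_def)
  moreover have "x * p = p * alpha x" "x * q = q * alpha x" "x * ep = ep * x" "x * em = em * x" if "x \<in> A" for x
    using unit_commute[OF that, of 1] by simp_all
  ultimately show ?thesis using assms by (simp add: Th_def)
qed

lemma Th_Cl: "a \<in> A \<Longrightarrow> b \<in> A \<Longrightarrow> c \<in> A \<Longrightarrow> d \<in> A \<Longrightarrow> Th a b c d \<in> A2"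
  by (simp add: Th_def ep_def em_def)

text \<open>
  The coordinates of \<open>Th a b c d\<close> are read off by projecting \<open>x\<close>, \<open>fex\<close>, \<open>fx\<close> and \<open>ex\<close> to \<open>A\<close>,
  which gives bounded linear functions on the whole algebra.
\<close>

definition proj :: "cliff \<Rightarrow> cliff" where
  "proj = twist (\<lambda>B. if B \<subseteq> gens m n then 1 else 0)"

lemma bounded_linear_proj: "bounded_linear proj"
  unfolding proj_def by (rule bounded_linear_twist) simp

lemma proj_A: "x \<in> A \<Longrightarrow> proj x = x"
  by (rule cliff_eqI) (auto simp: proj_def Cl_eq supp_def)

lemma proj_gen_mult:
  assumes "g \<notin> gens m n" "\<And>B. g \<in> B \<Longrightarrow> coef x B = 0" shows "proj (blade {g} * x) = 0"
proof (rule cliff_eqI)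
  fix C
  show "coef (proj (blade {g} * x)) C = coef 0 C"
    using assms(1) assms(2)[of "insert g C"] by (cases "g \<in> C") (auto simp: proj_def coef_gen_mult)
qed

lemma proj_new:
  assumes "y \<in> A" shows "proj (f * y) = 0" "proj (e * y) = 0" "proj (f * (e * y)) = 0"
proof -
  have y: "coef y B = 0" if "g \<in> B" "g \<notin> gens m n" for g B
    using assms that by (auto simp: Cl_eq supp_def)
  have "coef (e * y) B = 0" if "F (m + 1) \<in> B" for B
    using y[of "F (m + 1)"] that new_gens by (simp add: e_def eb_def coef_gen_mult)
  then show "proj (f * (e * y)) = 0" unfolding f_def fb_def by (intro proj_gen_mult new_gens)
  show "proj (f * y) = 0" "proj (e * y) = 0"
    unfolding f_def fb_def e_def eb_def using y new_gens by (intro proj_gen_mult; blast)+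
qed

definition cA :: "cliff \<Rightarrow> cliff" where "cA x = proj x + proj (f * (e * x))"
definition cB :: "cliff \<Rightarrow> cliff" where "cB x = proj (e * x) - proj (f * x)"
definition cC :: "cliff \<Rightarrow> cliff" where "cC x = - proj (e * x) - proj (f * x)"
definition cD :: "cliff \<Rightarrow> cliff" where "cD x = proj x - proj (f * (e * x))"

lemma Th_coordinates:
  assumes "a \<in> A" "b \<in> A" "c \<in> A" "d \<in> A"
  shows "cA (Th a b c d) = a" "cB (Th a b c d) = b" "cC (Th a b c d) = c" "cD (Th a b c d) = d"
proof -
  define y0 y1 y2 y3 where y: "y0 = (a + d) /\<^sub>R 2" "y1 = (a - d) /\<^sub>R 2" "y2 = (b + c) /\<^sub>R 2" "y3 = (b - c) /\<^sub>R 2"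
  have yA: "y0 \<in> A" "y1 \<in> A" "y2 \<in> A" "y3 \<in> A" using assms by (auto simp: y)
  have half: "(x /\<^sub>R 2) + (x /\<^sub>R 2) = (x :: cliff)" for x
    by (simp flip: scaleR_left_distrib)
  have abcd: "a = y0 + y1" "d = y0 - y1" "b = y2 + y3" "c = y2 - y3"
    unfolding y scaleR_right_distrib scaleR_right_diff_distrib using half[of a] half[of b] half[of c] half[of d]
    by (simp_all add: algebra_simps)
  have X: "Th a b c d = y0 + f * (e * y1) + f * y2 + e * y3"
  proof -
    have "Th a b c d = (ep + em) * y0 + (ep - em) * y1 + (p + q) * y2 + (p - q) * y3"
      unfolding Th_def abcd by (simp add: algebra_simps)
    then show ?thesis unfolding ep_em p_plus_q p_minus_q f_e[symmetric] by (simp add: mult.assoc)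
  qed
  have rel: "f * (f * x) = - x" "e * (e * x) = x" "e * (f * x) = - (f * (e * x))" for x
    using fe_relations by (simp_all flip: mult.assoc)
  note pl = linear_add[OF bounded_linear.linear[OF bounded_linear_proj]]
    linear_neg[OF bounded_linear.linear[OF bounded_linear_proj]]
    linear_diff[OF bounded_linear.linear[OF bounded_linear_proj]]
  show "cA (Th a b c d) = a" "cB (Th a b c d) = b" "cC (Th a b c d) = c" "cD (Th a b c d) = d"
    unfolding X cA_def cB_def cC_def cD_def
    using yA by (simp_all add: distrib_left right_diff_distrib rel pl proj_A proj_new abcd)
qed

lemma Th_inj:
  assumes "a \<in> A" "b \<in> A" "c \<in> A" "d \<in> A" "a' \<in> A" "b' \<in> A" "c' \<in> A" "d' \<in> A"
  shows "Th a b c d = Th a' b' c' d' \<longleftrightarrow> a = a' \<and> b = b' \<and> c = c' \<and> d = d'"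
  using Th_coordinates[OF assms(1-4)] Th_coordinates[OF assms(5-8)] by metis

lemma W_eq: "W = {Th v (of_real r) (of_real s) v | v r s. v \<in> V}"
proof
  have "subspace {Th v (of_real r) (of_real s) v | v r s. v \<in> V}" (is "subspace ?Z")
  proof (rule subspaceI)
    show "0 \<in> ?Z" by (auto simp: Th_def intro!: exI[of _ 0])
  next
    fix x y assume "x \<in> ?Z" "y \<in> ?Z"
    then obtain v r s v' r' s' where
      "x = Th v (of_real r) (of_real s) v" "v \<in> V" "y = Th v' (of_real r') (of_real s') v'" "v' \<in> V"
      by blast
    then show "x + y \<in> ?Z"
      by (intro CollectI exI[of _ "v + v'"] exI[of _ "r + r'"] exI[of _ "s + s'"]) (simp add: Th_add)
  next
    fix c x assume "x \<in> ?Z"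
    then obtain v r s where "x = Th v (of_real r) (of_real s) v" "v \<in> V" by blast
    moreover have "c *\<^sub>R Th v (of_real r) (of_real s) v = Th (c *\<^sub>R v) (of_real (c * r)) (of_real (c * s)) (c *\<^sub>R v)"
      by (simp add: Th_scale of_real_def)
    ultimately show "c *\<^sub>R x \<in> ?Z" by blast
  qed
  moreover have "blade {F (m + 1)} \<in> ?Z"
  proof -
    have "blade {F (m + 1)} = Th 0 (of_real 1) (of_real 1) 0"
      unfolding Th_vector using p_plus_q by (simp add: f_def fb_def)
    then show ?thesis by blast
  qed
  moreover have "blade {E (n + 1)} \<in> ?Z"
  proof -
    have "blade {E (n + 1)} = Th 0 (of_real 1) (of_real (-1)) 0"
      unfolding Th_vector using p_minus_q by (simp add: e_def eb_def)
    then show ?thesis by blast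
  qed
  moreover have "blade {a} \<in> ?Z" if "a \<in> gens m n" for a
  proof -
    have "blade {a} = Th (blade {a}) (of_real 0) (of_real 0) (blade {a})" by (simp add: Th_diagonal)
    then show ?thesis using gen_V[OF that] by blast
  qed
  ultimately show "W \<subseteq> ?Z" unfolding W_def Vsp_gens[of "m + 1"] gens_Suc by (intro span_minimal) auto
  show "?Z \<subseteq> W" by (auto simp: Th_vector)
qed

lemma Th_W_iff:
  assumes "a \<in> A" "b \<in> A" "c \<in> A" "d \<in> A"
  shows "Th a b c d \<in> W \<longleftrightarrow> a \<in> V \<and> d = a \<and> (\<exists>r. b = of_real r) \<and> (\<exists>s. c = of_real s)"
proof
  assume "Th a b c d \<in> W"
  then obtain v r s where v: "v \<in> V" "Th a b c d = Th v (of_real r) (of_real s) v"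
    unfolding W_eq by blast
  then show "a \<in> V \<and> d = a \<and> (\<exists>r. b = of_real r) \<and> (\<exists>s. c = of_real s)"
    using assms by (subst (asm) Th_inj) auto
next
  assume "a \<in> V \<and> d = a \<and> (\<exists>r. b = of_real r) \<and> (\<exists>s. c = of_real s)"
  then show "Th a b c d \<in> W" unfolding W_eq by blast
qed

lemma A2_Th: "A2 = {Th a b c d | a b c d. a \<in> A \<and> b \<in> A \<and> c \<in> A \<and> d \<in> A}" (is "_ = ?Z")
proof
  show "?Z \<subseteq> A2" using Th_Cl by blast
  have Z: "Th a b c d \<in> ?Z" if "a \<in> A" "b \<in> A" "c \<in> A" "d \<in> A" for a b c d using that by blast
  show "A2 \<subseteq> ?Z"
    unfolding A2_def Cl_def[of "m + 1"] W_def[symmetric]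
  proof (rule alg_span_minimal)
    show "W \<subseteq> ?Z" unfolding W_eq using Z by auto
    show "subspace ?Z"
    proof (rule subspaceI)
      show "0 \<in> ?Z" using Z[of 0 0 0 0] by (simp add: Th_def)
      show "x + y \<in> ?Z" if "x \<in> ?Z" "y \<in> ?Z" for x y
        using that by (elim CollectE exE conjE) (simp only: Th_add, rule Z, simp_all)
      show "c *\<^sub>R x \<in> ?Z" if "x \<in> ?Z" for c x
        using that by (elim CollectE exE conjE) (simp only: Th_scale, rule Z, simp_all)
    qed
    show "1 \<in> ?Z" using Z[of 1 0 0 1] by (simp add: Th_diagonal)
    show "x * y \<in> ?Z" if "x \<in> ?Z" "y \<in> ?Z" for x y
      using that by (elim CollectE exE conjE) (simp only: Th_mult, rule Z, simp_all)
  qed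
qed

definition even_entries :: "cliff \<Rightarrow> cliff \<Rightarrow> cliff \<Rightarrow> cliff \<Rightarrow> bool" where
  "even_entries a b c d \<longleftrightarrow> a \<in> A \<and> b \<in> A \<and> c \<in> A \<and> d \<in> A \<and>
     alpha a = a \<and> alpha b = - b \<and> alpha c = - c \<and> alpha d = d"

lemma even_Th:
  assumes "x \<in> A2" "alpha x = x"
  obtains a b c d where "x = Th a b c d" "even_entries a b c d"
proof -
  obtain a b c d where x: "x = Th a b c d" and abcd: "a \<in> A" "b \<in> A" "c \<in> A" "d \<in> A"
    using assms(1) unfolding A2_Th by blast
  have "Th (alpha a) (- alpha b) (- alpha c) (alpha d) = Th a b c d"
    using assms(2) unfolding x Th_alpha .
  then have "alpha a = a \<and> - alpha b = b \<and> - alpha c = c \<and> alpha d = d"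
    using abcd by (subst (asm) Th_inj) auto
  then show ?thesis using that[OF x] abcd unfolding even_entries_def by (metis minus_minus)
qed

section \<open>The big cell\<close>

abbreviation fm :: cliff where "fm \<equiv> fb m"

lemma fm_V [simp]: "fm \<in> V" and fm_sq: "fm * fm = - 1"
proof -
  show "fm \<in> V" unfolding fb_def using m_pos by (intro gen_V) (auto simp: gens_def)
  show "fm * fm = - 1" using gen_sq[of "F m"] by (simp add: fb_def)
qed

lemma even_entriesD:
  assumes "even_entries a b c d"
  shows "a \<in> A" "b \<in> A" "c \<in> A" "d \<in> A" "alpha a = a" "alpha b = - b" "alpha c = - c" "alpha d = d"
  using assms by (auto simp: even_entries_def)

lemma even_mult:
  assumes "even_entries a b c d"
  shows "Th a b c d * Th a' b' c' d' = Th (a * a' + b * c') (a * b' + b * d') (c * a' + d * c') (d * d' + c * b')"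
  using even_entriesD[OF assms] by (simp add: Th_mult)

lemma even_transp:
  assumes "even_entries a b c d"
  shows "transp (Th a b c d) = Th (transp d) (- transp b) (- transp c) (transp a)"
  using even_entriesD[OF assms] by (simp add: Th_transp alpha_transp)

lemma even_entries_transp:
  "even_entries a b c d \<Longrightarrow> even_entries (transp d) (- transp b) (- transp c) (transp a)"
  by (auto simp: even_entries_def alpha_transp)

lemma even_entries_simps [simp]:
  "w \<in> V \<Longrightarrow> even_entries 1 w 0 1" "w \<in> V \<Longrightarrow> even_entries 1 0 w 1"
  by (auto simp: even_entries_def alpha_V)

lemma even_entries_diag: "even_entries a 0 0 d \<longleftrightarrow> a \<in> A \<and> d \<in> A \<and> alpha a = a \<and> alpha d = d"
  by (auto simp: even_entries_def)

lemma Th_1: "Th 1 0 0 1 = 1" and Th_p: "Th 0 1 0 0 = p" and Th_q: "Th 0 0 1 0 = q"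
  using ep_em by (simp_all add: Th_def)

lemma S_D:
  assumes "X \<in> S"
  shows "X \<in> A2" "alpha X = X" "transp X * X = 1" "X * transp X = 1"
    "\<And>w. w \<in> W \<Longrightarrow> X * w * transp X \<in> W"
  using Spin1D[OF assms[unfolded S_def]] by (auto simp: A2_def W_def)

lemma S_iff:
  "X \<in> S \<longleftrightarrow> X \<in> A2 \<and> alpha X = X \<and> transp X * X = 1 \<and> X * transp X = 1 \<and> (\<forall>w\<in>W. X * w * transp X \<in> W)"
  unfolding S_def A2_def W_def by (rule Spin1_iff)

lemmas S_mult = Spin1_mult[of _ "m + 1" "n + 1", folded S_def]
lemmas S_transp = Spin1_transp[of _ "m + 1" "n + 1", folded S_def]
lemmas S_one = Spin1_one[of "m + 1" "n + 1", folded S_def]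

lemma S_Th:
  assumes "X \<in> S" obtains a b c d where "X = Th a b c d" "even_entries a b c d"
  using even_Th S_D(1,2)[OF assms] by blast

text \<open>Conjugation by \<open>Th a b c d\<close> sends the isotropic vectors \<open>p\<close>, \<open>q\<close> to vectors of \<open>W\<close>, whose coordinates
  give the quadratic relations between the entries.\<close>

lemma S_first_column:
  assumes "Th a b c d \<in> S" "even_entries a b c d"
  obtains r s v where "a * transp a = of_real r" "c * transp c = of_real s"
    "a * transp c = v" "c * transp a = v" "v \<in> V"
proof -
  note ev = even_entriesD[OF assms(2)]
  have "Th a b c d * Th 0 1 0 0 * transp (Th a b c d)
      = Th (a * transp c) (a * transp a) (c * transp c) (c * transp a)"
    unfolding even_transp[OF assms(2)] even_mult[OF assms(2)]
    using ev by (simp add: Th_mult)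
  moreover have "\<dots> \<in> W \<longleftrightarrow> a * transp c \<in> V \<and> c * transp a = a * transp c
      \<and> (\<exists>r. a * transp a = of_real r) \<and> (\<exists>s. c * transp c = of_real s)"
    by (rule Th_W_iff) (use ev in auto)
  ultimately show ?thesis using S_D(5)[OF assms(1) p_W] that by (auto simp: Th_p)
qed

lemma S_second_column:
  assumes "Th a b c d \<in> S" "even_entries a b c d"
  obtains r v where "d * transp d = of_real r" "d * transp b = v" "v \<in> V"
proof -
  note ev = even_entriesD[OF assms(2)]
  have "Th a b c d * Th 0 0 1 0 * transp (Th a b c d)
      = Th (b * transp d) (b * transp b) (d * transp d) (d * transp b)"
    unfolding even_transp[OF assms(2)] even_mult[OF assms(2)]
    using ev by (simp add: Th_mult)
  moreover have "\<dots> \<in> W \<longleftrightarrow> b * transp d \<in> V \<and> d * transp b = b * transp d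
      \<and> (\<exists>r. b * transp b = of_real r) \<and> (\<exists>s. d * transp d = of_real s)"
    by (rule Th_W_iff) (use ev in auto)
  ultimately show ?thesis using S_D(5)[OF assms(1) q_W] that by (auto simp: Th_q)
qed

lemma Th_upper: "Th 1 w 0 1 = 1 + p * w" and Th_lower: "Th 1 0 w 1 = 1 + q * w"
proof -
  have "Th 1 w 0 1 = (ep + em) + p * w" "Th 1 0 w 1 = (ep + em) + q * w"
    by (simp_all add: Th_def algebra_simps)
  then show "Th 1 w 0 1 = 1 + p * w" "Th 1 0 w 1 = 1 + q * w" by (simp_all only: ep_em)
qed

lemma S_upper: assumes "w \<in> V" shows "Th 1 w 0 1 \<in> S"
proof -
  have "w * p = - (p * w)" using p_comm[of w] assms by (simp add: alpha_V)
  then have "1 + p * w \<in> S"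
    unfolding S_def using assms p_W V_W unfolding W_def by (intro Spin1_eichler) (auto simp: unit_relations)
  then show ?thesis by (simp only: Th_upper)
qed

lemma S_lower: assumes "w \<in> V" shows "Th 1 0 w 1 \<in> S"
proof -
  have "w * q = - (q * w)" using q_comm[of w] assms by (simp add: alpha_V)
  then have "1 + q * w \<in> S"
    unfolding S_def using assms q_W V_W unfolding W_def by (intro Spin1_eichler) (auto simp: unit_relations)
  then show ?thesis by (simp only: Th_lower)
qed

lemma S_diagonal:
  assumes x: "alpha x = x" "lipschitz m n x x'"
  shows "Th x 0 0 (transp x') \<in> S"
proof -
  note l = lipschitzD[OF x(2)]
  have "x \<in> ClGr m n" using x by (auto simp: ClGr_iff)
  then obtain r where r: "r \<noteq> 0" "x * transp x = of_real r" "lipschitz m n x (inverse r *\<^sub>R transp x)"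
    using ClGr_norm by metis
  have "x' = x' * (x * (inverse r *\<^sub>R transp x))" using lipschitzD(3)[OF r(3)] by simp
  also have "\<dots> = inverse r *\<^sub>R transp x" using l by (simp flip: mult.assoc)
  finally have x': "x' = inverse r *\<^sub>R transp x" .
  have ax': "alpha x' = x'" using even_inverse l x by blast
  have ev: "even_entries x 0 0 (transp x')" using l x ax' by (simp add: even_entries_diag alpha_transp)
  have tx: "transp x' * transp x = 1" "transp x * transp x' = 1" using l by (metis transp_1 transp_mult)+
  have "Th x 0 0 (transp x') * w * transp (Th x 0 0 (transp x')) \<in> W" if w0: "w \<in> W" for w
  proof -
    obtain v s t where w: "w = Th v (of_real s) (of_real t) v" and v: "v \<in> V"
      using w0 unfolding W_eq by auto
    have xvx: "x * v * x' \<in> V" using l(5)[OF v] x by simp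
    have eq: "transp x' * v * transp x = x * v * x'"
      using transp_V[OF xvx] transp_V[OF v] by (simp add: mult.assoc)
    have sc: "x * (of_real s * transp x) = of_real (s * r)"
      "transp x' * (of_real t * x') = of_real (t * (inverse r * inverse r * r))"
      using r(2) by (simp_all add: x' of_real_def)
    have "Th x 0 0 (transp x') * w * transp (Th x 0 0 (transp x'))
      = Th (x * v * x') (x * (of_real s * transp x)) (transp x' * (of_real t * x')) (transp x' * v * transp x)"
      unfolding even_transp[OF ev] even_mult[OF ev] w
      using l x v ax' by (simp add: Th_mult alpha_transp mult.assoc)
    also have "\<dots> \<in> W" unfolding eq sc W_eq using xvx by blast
    finally show ?thesis .
  qed
  moreover have "transp (Th x 0 0 (transp x')) * Th x 0 0 (transp x') = 1"
    "Th x 0 0 (transp x') * transp (Th x 0 0 (transp x')) = 1"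
    unfolding even_transp[OF ev] even_mult[OF ev]
    using l tx by (simp_all add: Th_mult Th_1)
  moreover have "Th x 0 0 (transp x') \<in> A2" using l by (intro Th_Cl) auto
  ultimately show ?thesis unfolding S_iff using x ax' by (simp add: Th_alpha alpha_transp)
qed

lemma diagonal_in_S:
  assumes "Th a 0 0 d \<in> S" "even_entries a 0 0 d" shows "lipschitz m n a (transp d)"
proof -
  note ev = even_entriesD[OF assms(2)]
  have "Th (a * transp d) 0 0 (d * transp a) = Th 1 0 0 1"
    "Th (transp d * a) 0 0 (transp a * d) = Th 1 0 0 1"
    using S_D(3,4)[OF assms(1)] ev unfolding even_transp[OF assms(2)] even_mult[OF assms(2)]
    by (simp_all add: Th_mult Th_1 alpha_transp)
  then have inv: "a * transp d = 1" "transp d * a = 1"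
    using ev by (subst (asm) Th_inj; simp)+
  moreover have "a * v * transp d \<in> V" if v: "v \<in> V" for v
  proof -
    have "Th v 0 0 v \<in> W" using V_W[OF v] by (simp add: Th_diagonal)
    from S_D(5)[OF assms(1) this]
    have "Th (a * v * transp d) 0 0 (d * v * transp a) \<in> W"
      unfolding even_transp[OF assms(2)] even_mult[OF assms(2)]
      using v ev by (simp add: Th_mult)
    then show ?thesis using v ev by (subst (asm) Th_W_iff) auto
  qed
  ultimately show ?thesis using ev by (simp add: lipschitz_def)
qed

text \<open>
  The triangular factors have the entries \<open>ca\<^sup>-\<^sup>1\<close> and \<open>a\<^sup>-\<^sup>1b\<close>. These are vectors because \<open>a\<^sup>-\<^sup>1\<close> is a
  multiple of \<open>a\<^sup>t\<close>, and \<open>ca\<^sup>t\<close>, \<open>a\<^sup>tb\<close> are up to sign the components in \<open>V\<close> of \<open>XpX\<^sup>t\<close> and of \<open>X\<^sup>tqX\<close>.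
\<close>

lemma big_cell:
  assumes "Th a b c d \<in> S" "even_entries a b c d" "a * transp a \<noteq> 0"
  obtains y z a' where "y \<in> V" "z \<in> V" "lipschitz m n a a'"
    "Th a b c d = Th 1 0 y 1 * Th a 0 0 (transp a') * Th 1 z 0 1"
proof -
  note ev = even_entriesD[OF assms(2)]
  obtain r s v where r: "a * transp a = of_real r" "c * transp a = v" and v: "v \<in> V"
    using S_first_column[OF assms(1,2)] by metis
  have r0: "r \<noteq> 0" using r assms(3) by auto
  have St: "Th (transp d) (- transp b) (- transp c) (transp a) \<in> S"
    using S_transp[OF assms(1)] even_transp[OF assms(2)] by simp
  obtain r' u where r': "transp a * a = of_real r'" "transp a * b = - u" and u: "u \<in> V"
    using S_second_column[OF St even_entries_transp[OF assms(2)]]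
    by (metis V_intros(3) minus_minus mult_minus_right transp_transp transp_simps(3))
  have a0: "a \<noteq> 0" using assms(3) by auto
  have "of_real r * a = a * (transp a * a)" by (simp add: r(1) flip: mult.assoc)
  then have "r *\<^sub>R a = r' *\<^sub>R a" by (simp add: r' of_real_def)
  then have rr: "r' = r" using a0 by simp
  define y where "y = inverse r *\<^sub>R v"
  define z where "z = - (inverse r *\<^sub>R u)"
  have yz: "y \<in> V" "z \<in> V" using u v by (auto simp: y_def z_def)
  have ya: "y * a = c"
  proof -
    have "y * a = inverse r *\<^sub>R (c * (transp a * a))" by (simp add: y_def r(2)[symmetric] mult.assoc)
    then show ?thesis unfolding r' rr using r0 by (simp add: of_real_def)
  qed
  have az: "a * z = b"
  proof -
    have "a * z = inverse r *\<^sub>R (a * (- u))" by (simp add: z_def)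
    also have "\<dots> = inverse r *\<^sub>R ((a * transp a) * b)" unfolding r'(2)[symmetric] by (simp add: mult.assoc)
    finally show ?thesis unfolding r using r0 by (simp add: of_real_def)
  qed
  have el: "even_entries 1 0 (- y) 1" "even_entries 1 (- z) 0 1" using yz by simp_all
  define d1 where "d1 = d - y * b"
  have step: "Th 1 0 (- y) 1 * Th a b c d * Th 1 (- z) 0 1 = Th a 0 0 d1"
    unfolding even_mult[OF el(1)]
    using ev yz by (simp add: Th_mult ya az alpha_V d1_def)
  have ev1: "even_entries a 0 0 d1" unfolding even_entries_diag d1_def using ev yz by (auto simp: alpha_V)
  have S1: "Th a 0 0 d1 \<in> S"
    unfolding step[symmetric] using yz assms(1) by (intro S_mult S_upper S_lower) auto
  have "Th a b c d = Th 1 0 y 1 * Th a 0 0 d1 * Th 1 z 0 1"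
  proof -
    have inv: "Th 1 0 y 1 * Th 1 0 (- y) 1 = 1" "Th 1 (- z) 0 1 * Th 1 z 0 1 = 1"
      using yz by (simp_all add: even_mult Th_1)
    have "Th 1 0 y 1 * Th a 0 0 d1 * Th 1 z 0 1
      = (Th 1 0 y 1 * Th 1 0 (- y) 1) * Th a b c d * (Th 1 (- z) 0 1 * Th 1 z 0 1)"
      unfolding step[symmetric] by (simp only: mult.assoc)
    then show ?thesis unfolding inv by simp
  qed
  then show ?thesis using that[OF yz diagonal_in_S[OF S1 ev1]] by simp
qed

definition cell :: "cliff set" where
  "cell = {Th 1 0 y 1 * Th a 0 0 (transp a') * Th 1 z 0 1 | y z a a'.
     y \<in> V \<and> z \<in> V \<and> alpha a = a \<and> lipschitz m n a a'}"

lemma translate_in_cell: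
  assumes "Th a b c d \<in> S" "even_entries a b c d" "w \<in> V"
    "(a + w * c) * transp (a + w * c) \<noteq> 0"
  shows "Th 1 w 0 1 * Th a b c d \<in> cell"
proof -
  let ?a = "a + w * c"
  have Y: "Th 1 w 0 1 * Th a b c d = Th ?a (b + w * d) c d"
    unfolding even_mult[OF even_entries_simps(1)[OF assms(3)]] by simp
  have ev: "even_entries ?a (b + w * d) c d"
    using assms(2,3) unfolding even_entries_def by (auto simp: alpha_V)
  have "Th ?a (b + w * d) c d \<in> S"
    unfolding Y[symmetric] using S_mult[OF S_upper[OF assms(3)] assms(1)] .
  then obtain y z a' where yz: "y \<in> V" "z \<in> V" "lipschitz m n ?a a'"
    and Ye: "Th ?a (b + w * d) c d = Th 1 0 y 1 * Th ?a 0 0 (transp a') * Th 1 z 0 1"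
    by (rule big_cell[OF _ ev assms(4)])
  then show ?thesis unfolding Y Ye cell_def using even_entriesD(5)[OF ev] by blast
qed

text \<open>
  The first entry of \<open>Th 1 (tw) 0 1 * X\<close> is \<open>a + twc\<close>, and
  \<open>(a + twc)(a + twc)\<^sup>t = r + t(vw + wv) + t\<^sup>2sw\<^sup>2\<close>, where \<open>v + rp + sq\<close> is the image of \<open>p\<close>. This
  image is not zero, so for a suitable \<open>w\<close> the polynomial in \<open>t\<close> has only finitely many zeros.
\<close>

lemma generic_first_entry:
  assumes "Th a b c d \<in> S" "even_entries a b c d"
  obtains w where "w \<in> V"
    "finite {t::real. (a + t *\<^sub>R (w * c)) * transp (a + t *\<^sub>R (w * c)) = 0}"
proof -
  note ev = even_entriesD[OF assms(2)]
  obtain r s v where r: "a * transp a = of_real r" "c * transp c = of_real s"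
    "a * transp c = v" "c * transp a = v" and v: "v \<in> V"
    using S_first_column[OF assms(1,2)] by metis
  have norm: "(a + t *\<^sub>R (w * c)) * transp (a + t *\<^sub>R (w * c))
      = of_real r + t *\<^sub>R (w * v + v * w) + (t * t) *\<^sub>R (w * (of_real s * w))" if "w \<in> V" for t w
  proof -
    have "(a + t *\<^sub>R (w * c)) * transp (a + t *\<^sub>R (w * c))
      = a * transp a + t *\<^sub>R (w * (c * transp a) + (a * transp c) * w) + (t * t) *\<^sub>R (w * (c * transp c * w))"
      using transp_V[OF that] by (simp add: algebra_simps)
    then show ?thesis by (simp only: r)
  qed
  consider "r \<noteq> 0" | "r = 0" "s \<noteq> 0" | "r = 0" "s = 0" by blast
  then show ?thesis
  proof cases
    case 1
    have "{t::real. (a + t *\<^sub>R (0 * c)) * transp (a + t *\<^sub>R (0 * c)) = 0} = {}"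
      using r 1 by auto
    then show ?thesis using that[of 0] by simp
  next
    case 2
    obtain k where k: "fm * v + v * fm = of_real k" using V_polar[OF fm_V v] .
    have "t = 0 \<or> t = k / s" if "(a + t *\<^sub>R (fm * c)) * transp (a + t *\<^sub>R (fm * c)) = 0" for t
    proof -
      have "fm * (of_real s * fm) = of_real (- s)" using fm_sq by (simp add: of_real_def)
      then have "t *\<^sub>R of_real k + (t * t) *\<^sub>R of_real (- s) = (0 :: cliff)"
        using that unfolding norm[OF fm_V] k 2 by simp
      then have "of_real (t * k - t * t * s) = (of_real 0 :: cliff)"
        by (simp add: of_real_def algebra_simps)
      then have "t * k - t * t * s = 0" by (simp only: of_real_eq_iff)
      then have "t * (k - t * s) = 0" by (simp add: algebra_simps)
      then show ?thesis using 2 by (auto simp: field_simps)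
    qed
    then have "{t::real. (a + t *\<^sub>R (fm * c)) * transp (a + t *\<^sub>R (fm * c)) = 0} \<subseteq> {0, k / s}" by auto
    then show ?thesis using that[OF fm_V] finite_subset by blast
  next
    case 3
    have "v \<noteq> 0"
    proof
      assume "v = 0"
      have "Th a b c d * Th 0 1 0 0 * transp (Th a b c d)
          = Th (a * transp c) (a * transp a) (c * transp c) (c * transp a)"
        unfolding even_transp[OF assms(2)] even_mult[OF assms(2)]
        using ev by (simp add: Th_mult)
      also have "\<dots> = 0" unfolding r \<open>v = 0\<close> 3 by (simp add: Th_def)
      finally have 0: "Th a b c d * Th 0 1 0 0 * transp (Th a b c d) = 0" .
      let ?X = "Th a b c d"
      have "Th 0 1 0 0 = (transp ?X * ?X) * Th 0 1 0 0 * (transp ?X * ?X)"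
        using S_D(3)[OF assms(1)] by simp
      also have "\<dots> = transp ?X * (?X * Th 0 1 0 0 * transp ?X) * ?X" by (simp only: mult.assoc)
      also have "\<dots> = Th 0 0 0 0" unfolding 0 by (simp add: Th_def)
      finally show False by (subst (asm) Th_inj) auto
    qed
    then obtain w k where w: "w \<in> V" "k \<noteq> 0" "w * v + v * w = of_real k"
      using V_nondegenerate[OF v] by metis
    have "{t::real. (a + t *\<^sub>R (w * c)) * transp (a + t *\<^sub>R (w * c)) = 0} \<subseteq> {0}"
      unfolding norm[OF w(1)] w(3) 3 using w(2) by auto
    then show ?thesis using that[OF w(1)] finite_subset by blast
  qed
qed

section \<open>Generation by elementary matrices\<close>

inductive_set Elem :: "cliff set" where
  one: "1 \<in> Elem"
| upper: "X \<in> Elem \<Longrightarrow> w \<in> V \<Longrightarrow> Th 1 w 0 1 * X \<in> Elem"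
| lower: "X \<in> Elem \<Longrightarrow> w \<in> V \<Longrightarrow> Th 1 0 w 1 * X \<in> Elem"

lemma Elem_S: "X \<in> Elem \<Longrightarrow> X \<in> S"
  by (induction rule: Elem.induct) (auto intro: S_one S_mult S_upper S_lower)

lemma Elem_mult: "X \<in> Elem \<Longrightarrow> Y \<in> Elem \<Longrightarrow> X * Y \<in> Elem"
  by (induction rule: Elem.induct) (auto simp: mult.assoc intro: Elem.upper Elem.lower)

lemma Elem_base: "w \<in> V \<Longrightarrow> Th 1 w 0 1 \<in> Elem" "w \<in> V \<Longrightarrow> Th 1 0 w 1 \<in> Elem"
  using Elem.upper[OF Elem.one] Elem.lower[OF Elem.one] by auto

text \<open>The product upper, lower, upper that represents the Weyl element of \<open>SL\<^sub>2\<close>.\<close>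

lemma Elem_antidiagonal:
  assumes "v \<in> V" "v * v = of_real s" "s \<noteq> 0"
  shows "Th 0 v (- (inverse s *\<^sub>R v)) 0 \<in> Elem"
proof -
  define w where "w = - (inverse s *\<^sub>R v)"
  have w: "w \<in> V" "v * w = - 1" "w * v = - 1" using assms by (auto simp: w_def of_real_def)
  have "Th 1 v 0 1 * Th 1 0 w 1 * Th 1 v 0 1 = Th 0 v w 0"
    using assms(1) w by (simp add: even_mult Th_mult algebra_simps alpha_V)
  then show ?thesis
    using Elem_mult[OF Elem_mult[OF Elem_base(1)[OF assms(1)] Elem_base(2)[OF w(1)]] Elem_base(1)[OF assms(1)]]
    by (simp add: w_def)
qed

text \<open>The product of two antidiagonal matrices with entries \<open>u\<close>, \<open>v\<close> is diagonal with first entry \<open>\<plusminus>uv\<^sup>-\<^sup>1\<close>.\<close>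

lemma Elem_vector_product:
  assumes "vector_product m n ev x"
  shows "\<exists>x'\<in>A. if ev then Th x 0 0 x' \<in> Elem else Th 0 x x' 0 \<in> Elem"
  using assms
proof induction
  case (scalar r)
  have v: "- r *\<^sub>R fm \<in> V" "(- r *\<^sub>R fm) * (- r *\<^sub>R fm) = of_real (- (r * r))" "- (r * r) \<noteq> 0"
    using scalar fm_sq by (auto simp: of_real_def)
  have f: "fm * fm = of_real (- 1)" using fm_sq by simp
  let ?w = "- (inverse (- (r * r)) *\<^sub>R (- r *\<^sub>R fm))"
  have "Th 0 (- r *\<^sub>R fm) ?w 0 * Th 0 fm (- (inverse (- 1) *\<^sub>R fm)) 0
    = Th (of_real r) 0 0 (?w * fm)"
    using v(1) fm_V fm_sq alpha_V[OF fm_V] by (simp add: Th_mult of_real_def)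
  moreover have "Th 0 (- r *\<^sub>R fm) ?w 0 * Th 0 fm (- (inverse (- 1) *\<^sub>R fm)) 0 \<in> Elem"
    by (intro Elem_mult Elem_antidiagonal[OF v] Elem_antidiagonal[OF fm_V f]) simp
  ultimately show ?case by (intro bexI[of _ "?w * fm"]) auto
next
  case (vector ev x v s)
  note par = vector_product_parity[OF vector.hyps(1)]
  obtain x' where x': "x' \<in> A" "if ev then Th x 0 0 x' \<in> Elem else Th 0 x x' 0 \<in> Elem"
    using vector.IH by blast
  show ?case
  proof (cases ev)
    case True
    let ?w = "- (inverse s *\<^sub>R v)"
    have "Th x 0 0 x' * Th 0 v ?w 0 = Th 0 (x * v) (alpha x' * ?w) 0"
      using par x' True by (simp add: Th_mult)
    then have "Th 0 (x * v) (alpha x' * ?w) 0 \<in> Elem"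
      using Elem_mult[OF _ Elem_antidiagonal[OF vector.hyps(2,3,4)]] x' True by metis
    moreover have "alpha x' * ?w \<in> A" using x' vector.hyps(2) by simp
    ultimately show ?thesis using True by auto
  next
    case False
    let ?u = "- (inverse s *\<^sub>R v)"
    have u: "?u \<in> V" "?u * ?u = of_real (inverse s)" "inverse s \<noteq> 0" "- (inverse (inverse s) *\<^sub>R ?u) = v"
      using vector.hyps(2-4) by (auto simp: of_real_def)
    have "Th 0 x x' 0 * Th 0 ?u v 0 = Th (x * v) 0 0 (- (alpha x' * ?u))"
      using par x' False by (simp add: Th_mult)
    then have "Th (x * v) 0 0 (- (alpha x' * ?u)) \<in> Elem"
      using Elem_mult[OF _ Elem_antidiagonal[OF u(1-3), unfolded u(4)]] x' False by metis
    moreover have "- (alpha x' * ?u) \<in> A" using x' vector.hyps(2) by simp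
    ultimately show ?thesis using False by auto
  qed
qed

lemma Elem_diagonal:
  assumes "alpha x = x" "lipschitz m n x x'" shows "Th x 0 0 (transp x') \<in> Elem"
proof -
  note l = lipschitzD[OF assms(2)]
  have "x \<in> ClGr m n" using assms by (auto simp: ClGr_iff)
  from Elem_vector_product[OF ClGr_vector_product[OF this]]
  obtain y where y: "y \<in> A" "Th x 0 0 y \<in> Elem" by auto
  have "transp (Th x 0 0 y) * Th x 0 0 y = Th 1 0 0 1"
    using S_D(3)[OF Elem_S[OF y(2)]] by (simp add: Th_1)
  then have "Th (transp y * x) 0 0 (transp x * y) = Th 1 0 0 1"
    using y l by (simp add: Th_transp Th_mult)
  then have "transp y * x = 1" using y l by (subst (asm) Th_inj) auto
  then have "transp y * x * x' = x'" by simp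
  then have "transp y = x'" using l by (simp add: mult.assoc)
  then have "y = transp x'" by auto
  then show ?thesis using y by simp
qed

lemma S_eq_Elem: "S = Elem"
proof
  show "Elem \<subseteq> S" using Elem_S by blast
  show "S \<subseteq> Elem"
  proof
    fix X assume X: "X \<in> S"
    then obtain a b c d where Xe: "X = Th a b c d" and evX: "even_entries a b c d" by (rule S_Th)
    note ev = even_entriesD[OF evX]
    obtain w where w: "w \<in> V"
      "finite {t::real. (a + t *\<^sub>R (w * c)) * transp (a + t *\<^sub>R (w * c)) = 0}"
      by (rule generic_first_entry[OF X[unfolded Xe] evX])
    obtain t where t: "(a + t *\<^sub>R (w * c)) * transp (a + t *\<^sub>R (w * c)) \<noteq> 0"
      using ex_new_if_finite[OF infinite_UNIV_char_0 w(2)] by auto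
    let ?w = "t *\<^sub>R w"
    have wV: "?w \<in> V" "- ?w \<in> V" using w by auto
    have "Th 1 ?w 0 1 * X \<in> cell"
      unfolding Xe using translate_in_cell[OF X[unfolded Xe] evX wV(1)] t by simp
    then obtain y z a0 a' where "y \<in> V" "z \<in> V" "alpha a0 = a0" "lipschitz m n a0 a'"
      and eq: "Th 1 ?w 0 1 * X = Th 1 0 y 1 * Th a0 0 0 (transp a') * Th 1 z 0 1"
      unfolding cell_def by blast
    then have "Th 1 ?w 0 1 * X \<in> Elem"
      unfolding eq by (intro Elem_mult Elem_base Elem_diagonal)
    then have "Th 1 (- ?w) 0 1 * (Th 1 ?w 0 1 * X) \<in> Elem" by (rule Elem.upper[OF _ wV(2)])
    moreover have "Th 1 (- ?w) 0 1 * (Th 1 ?w 0 1 * X) = X"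
      unfolding mult.assoc[symmetric] even_mult[OF even_entries_simps(1)[OF wV(2)]]
      by (simp add: Th_1)
    ultimately show "X \<in> Elem" by simp
  qed
qed

lemma S_induct [consumes 1, case_names one upper lower]:
  assumes "X \<in> S" "P 1"
    "\<And>X w. X \<in> S \<Longrightarrow> w \<in> V \<Longrightarrow> P X \<Longrightarrow> P (Th 1 w 0 1 * X)"
    "\<And>X w. X \<in> S \<Longrightarrow> w \<in> V \<Longrightarrow> P X \<Longrightarrow> P (Th 1 0 w 1 * X)"
  shows "P X"
  using assms(1) unfolding S_eq_Elem
  by (induction rule: Elem.induct) (use assms(2-4) S_eq_Elem in auto)

text \<open>Scaling the parameters of the elementary matrices to \<open>0\<close> gives paths in \<open>S\<close> to the identity.\<close>

lemma S_connected_component: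
  assumes "X \<in> S" shows "connected_component S 1 X"
  using assms
proof (induction rule: S_induct)
  case one
  then show ?case using S_one by simp
next
  case (upper X w)
  let ?g = "\<lambda>t::real. Th 1 (t *\<^sub>R w) 0 1 * X"
  have "connected (?g ` {0..1})"
    unfolding Th_def by (intro connected_continuous_image continuous_intros) auto
  moreover have "?g ` {0..1} \<subseteq> S" using S_mult[OF S_upper upper(1)] upper(2) by auto
  moreover have "?g 0 \<in> ?g ` {0..1}" "?g 1 \<in> ?g ` {0..1}" by (rule imageI; simp)+
  ultimately have "connected_component S (?g 0) (?g 1)" by (rule connected_componentI)
  then show ?case using upper.IH connected_component_trans[of S 1 X] by (simp add: Th_1)
next
  case (lower X w)
  let ?g = "\<lambda>t::real. Th 1 0 (t *\<^sub>R w) 1 * X"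
  have "connected (?g ` {0..1})"
    unfolding Th_def by (intro connected_continuous_image continuous_intros) auto
  moreover have "?g ` {0..1} \<subseteq> S" using S_mult[OF S_lower lower(1)] lower(2) by auto
  moreover have "?g 0 \<in> ?g ` {0..1}" "?g 1 \<in> ?g ` {0..1}" by (rule imageI; simp)+
  ultimately have "connected_component S (?g 0) (?g 1)" by (rule connected_componentI)
  then show ?case using lower.IH connected_component_trans[of S 1 X] by (simp add: Th_1)
qed

text \<open>
  The component of \<open>1\<close> in the definition of \<open>Spin0\<close> is taken in the whole Clifford group. Since \<open>S\<close> is
  connected, the condition \<open>N(x) = 1\<close> alone already puts \<open>x\<close> in that component.
\<close>

lemma Spin0_eq: "Spin0 (m + 1) (n + 1) = S"
proof
  show "Spin0 (m + 1) (n + 1) \<subseteq> S"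
    unfolding Spin0_def ClGr0_def S_def Spin1_def using connected_component_subset by blast
  have SC: "S \<subseteq> ClGr (m + 1) (n + 1)" unfolding S_def Spin1_def by blast
  show "S \<subseteq> Spin0 (m + 1) (n + 1)"
  proof
    fix X assume X: "X \<in> S"
    then have "connected_component (ClGr (m + 1) (n + 1)) 1 X"
      using connected_component_of_subset[OF S_connected_component[OF X] SC] by blast
    then show "X \<in> Spin0 (m + 1) (n + 1)"
      using X unfolding Spin0_def ClGr0_def S_def Spin1_def by simp
  qed
qed

end

section \<open>Bivectors\<close>

lemma subspace_Bsp [simp]: "subspace (Bsp m n)"
  by (simp add: Bsp_def)

lemma Bsp_mult_V: "v \<in> Vsp m n \<Longrightarrow> w \<in> Vsp m n \<Longrightarrow> v * w \<in> Bsp m n"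
  unfolding Bsp_def by (intro span_base) auto

lemma Bsp_induct [consumes 1, case_names zero add]:
  assumes "x \<in> Bsp m n" "P 0"
    "\<And>v w y. v \<in> Vsp m n \<Longrightarrow> w \<in> Vsp m n \<Longrightarrow> P y \<Longrightarrow> P (v * w + y)"
  shows "P x"
  using assms(1) unfolding Bsp_def
proof (induction rule: span_induct_alt)
  case (step c x y)
  then obtain v w where x: "x = v * w" "v \<in> Vsp m n" "w \<in> Vsp m n" by auto
  have "P ((c *\<^sub>R v) * w + y)"
    by (rule assms(3)) (use x step in auto)
  then show ?case by (simp add: x(1))
qed (use assms in simp)

lemma Bsp_even: "x \<in> Bsp m n \<Longrightarrow> x \<in> Cl m n \<and> alpha x = x"
  by (induction rule: Bsp_induct) (auto simp: alpha_V)

lemma Bsp_commutator: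
  assumes "x \<in> Bsp m n" "v \<in> Vsp m n" shows "x * v - v * x \<in> Vsp m n"
  using assms(1)
proof (induction rule: Bsp_induct)
  case (add u w y)
  have "(u * w + y) * v - v * (u * w + y) = (u * w * v - v * (u * w)) + (y * v - v * y)"
    by (simp add: algebra_simps)
  then show ?case using V_commutator[OF add(1,2) assms(2)] add by simp
qed simp

lemma Bsp_transp: assumes "x \<in> Bsp m n" obtains r where "transp x = of_real r - x"
proof -
  have "\<exists>r. transp x + x = of_real r" using assms
  proof (induction rule: Bsp_induct)
    case zero
    show ?case by (intro exI[of _ 0]) simp
  next
    case (add v w y)
    obtain r where r: "transp y + y = of_real r" using add by blast
    obtain s where s: "w * v + v * w = of_real s" using V_polar[OF add(2,1)] .
    have "transp (v * w + y) + (v * w + y) = (w * v + v * w) + (transp y + y)"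
      using add by (simp add: transp_V)
    also have "\<dots> = of_real (s + r)" unfolding r s by simp
    finally show ?case by blast
  qed
  then show ?thesis using that by (metis add_diff_cancel_right')
qed

section \<open>Two by two matrices\<close>

lemma mk2_nth [simp]:
  "mk2 a b c d $ 1 $ 1 = a" "mk2 a b c d $ 1 $ 2 = b" "mk2 a b c d $ 2 $ 1 = c" "mk2 a b c d $ 2 $ 2 = d"
  by (simp_all add: mk2_def)

lemma mat2_eq_iff:
  "M = (N :: mat2) \<longleftrightarrow> M $ 1 $ 1 = N $ 1 $ 1 \<and> M $ 1 $ 2 = N $ 1 $ 2 \<and> M $ 2 $ 1 = N $ 2 $ 1 \<and> M $ 2 $ 2 = N $ 2 $ 2"
  by (auto simp: vec_eq_iff forall_2)

lemma mk2_mult: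
  "mk2 a b c d ** mk2 a' b' c' d' = mk2 (a * a' + b * c') (a * b' + b * d') (c * a' + d * c') (c * b' + d * d')"
  by (simp add: mat2_eq_iff matrix_matrix_mult_def sum_2)

lemma mk2_one: "mk2 1 0 0 1 = mat 1"
  by (simp add: mat2_eq_iff mat_def)

lemma mk2_cases: obtains a b c d where "M = mk2 a b c d"
  using that[of "M $ 1 $ 1" "M $ 1 $ 2" "M $ 2 $ 1" "M $ 2 $ 2"] by (simp add: mat2_eq_iff)

lemma mk2_inject: "mk2 a b c d = mk2 a' b' c' d' \<longleftrightarrow> a = a' \<and> b = b' \<and> c = c' \<and> d = d'"
  by (auto simp: mat2_eq_iff)

lemma mk2_linear:
  "mk2 a b c d + mk2 a' b' c' d' = mk2 (a + a') (b + b') (c + c') (d + d')"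
  "mk2 a b c d - mk2 a' b' c' d' = mk2 (a - a') (b - b') (c - c') (d - d')"
  "r *\<^sub>R mk2 a b c d = mk2 (r *\<^sub>R a) (r *\<^sub>R b) (r *\<^sub>R c) (r *\<^sub>R d)"
  by (simp_all add: mat2_eq_iff)

lemma bounded_linear_mk2:
  assumes "bounded_linear g1" "bounded_linear g2" "bounded_linear g3" "bounded_linear g4"
  shows "bounded_linear (\<lambda>x. mk2 (g1 x) (g2 x) (g3 x) (g4 x))"
proof -
  obtain K1 K2 K3 K4 where K: "norm (g1 x) \<le> norm x * K1" "norm (g2 x) \<le> norm x * K2"
    "norm (g3 x) \<le> norm x * K3" "norm (g4 x) \<le> norm x * K4" for x
    using assms[THEN bounded_linear.bounded] by metis
  show ?thesis
  proof (rule bounded_linear_intro[where K = "K1 + K2 + K3 + K4"])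
    fix x
    have l: "norm (v :: cliff^2) \<le> norm (v $ 1) + norm (v $ 2)" for v
      unfolding norm_vec_def using L2_set_le_sum[of "UNIV :: 2 set" "\<lambda>i. norm (v $ i)"] by (simp add: sum_2)
    have l': "norm (M :: mat2) \<le> norm (M $ 1) + norm (M $ 2)" for M
      unfolding norm_vec_def[of M] using L2_set_le_sum[of "UNIV :: 2 set" "\<lambda>i. norm (M $ i)"] by (simp add: sum_2)
    let ?M = "mk2 (g1 x) (g2 x) (g3 x) (g4 x)"
    have "norm ?M \<le> norm (g1 x) + norm (g2 x) + (norm (g3 x) + norm (g4 x))"
      using l'[of ?M] l[of "?M $ 1"] l[of "?M $ 2"] by simp
    also have "\<dots> \<le> norm x * K1 + norm x * K2 + (norm x * K3 + norm x * K4)"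
      by (intro add_mono K)
    finally show "norm ?M \<le> norm x * (K1 + K2 + K3 + K4)" by (simp add: algebra_simps)
  qed (simp_all add: assms[THEN bounded_linear.linear, THEN linear_add]
      assms[THEN bounded_linear.linear, THEN linear_scale] mk2_linear)
qed

section \<open>The isomorphism\<close>

context hyperbolic_extension
begin

text \<open>
  Conjugation by \<open>diag(1, f\<^sub>m)\<close> turns matrices with even entries into matrices whose off-diagonal
  entries are odd, which are the even elements \<open>Th a b c d\<close> of \<open>Cl(m+1,n+1)\<close>.
\<close>

definition Phi :: "mat2 \<Rightarrow> cliff" where
  "Phi M = Th (M $ 1 $ 1) (M $ 1 $ 2 * fm) (- (fm * M $ 2 $ 1)) (- (fm * M $ 2 $ 2 * fm))"

definition Psi :: "cliff \<Rightarrow> mat2" where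
  "Psi x = mk2 (cA x) (- (cB x * fm)) (fm * cC x) (- (fm * cD x * fm))"

definition even_mat :: "mat2 \<Rightarrow> bool" where
  "even_mat M \<longleftrightarrow> (\<forall>i j. M $ i $ j \<in> A \<and> alpha (M $ i $ j) = M $ i $ j)"

lemma even_mat_mk2: "even_mat (mk2 a b c d) \<longleftrightarrow> a \<in> A \<and> b \<in> A \<and> c \<in> A \<and> d \<in> A \<and>
    alpha a = a \<and> alpha b = b \<and> alpha c = c \<and> alpha d = d"
  by (auto simp: even_mat_def forall_2)

lemma Phi_mk2: "Phi (mk2 a b c d) = Th a (b * fm) (- (fm * c)) (- (fm * d * fm))"
  by (simp add: Phi_def)

lemma fm_cancel: "fm * (fm * x) = - x" "x * fm * fm = - x"
  using fm_sq by (simp_all add: mult.assoc) (simp flip: mult.assoc)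

lemma alpha_fm [simp]: "alpha fm = - fm" and transp_fm [simp]: "transp fm = fm"
  using alpha_V[OF fm_V] transp_V[OF fm_V] by auto

lemma fm_A [simp]: "fm \<in> A" by (rule Vsp_Cl) simp

lemma bounded_linear_Phi: "bounded_linear Phi"
  unfolding Phi_def Th_def
  by (intro bounded_linear_add bounded_linear_const_mult bounded_linear_mult_const bounded_linear_minus
      bounded_linear_compose[OF bounded_linear_vec_nth] bounded_linear_vec_nth)

lemma bounded_linear_coordinates:
  "bounded_linear cA" "bounded_linear cB" "bounded_linear cC" "bounded_linear cD"
  unfolding cA_def cB_def cC_def cD_def
  by (intro bounded_linear_add bounded_linear_sub bounded_linear_minus
      bounded_linear_compose[OF bounded_linear_proj] bounded_linear_proj
      bounded_linear_const_mult bounded_linear_ident)+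

lemma bounded_linear_Psi: "bounded_linear Psi"
  unfolding Psi_def
  by (intro bounded_linear_mk2 bounded_linear_minus bounded_linear_mult_const bounded_linear_const_mult
      bounded_linear_coordinates)

lemma continuous_Phi: "continuous_on U Phi" and continuous_Psi: "continuous_on U' Psi"
  using bounded_linear_Phi bounded_linear_Psi by (auto intro: linear_continuous_on)

lemma Psi_Phi:
  assumes "\<And>i j. M $ i $ j \<in> A" shows "Psi (Phi M) = M"
proof -
  obtain a b c d where M: "M = mk2 a b c d" by (rule mk2_cases)
  have A: "a \<in> A" "b \<in> A" "c \<in> A" "d \<in> A"
    using assms[of 1 1] assms[of 1 2] assms[of 2 1] assms[of 2 2] by (simp_all add: M)
  then show ?thesis
    unfolding M Phi_mk2 Psi_def by (simp add: Th_coordinates fm_cancel mult.assoc fm_sq)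
qed

lemma Psi_Phi_even: "even_mat M \<Longrightarrow> Psi (Phi M) = M"
  by (rule Psi_Phi) (simp add: even_mat_def)

lemma Psi_even:
  assumes "X \<in> A2" "alpha X = X" shows "even_mat (Psi X)" "Phi (Psi X) = X"
proof -
  obtain a b c d where X: "X = Th a b c d" and ev: "even_entries a b c d"
    using even_Th[OF assms] .
  note e = even_entriesD[OF ev]
  have P: "Psi X = mk2 a (- (b * fm)) (fm * c) (- (fm * d * fm))"
    using e by (simp add: X Psi_def Th_coordinates)
  show "even_mat (Psi X)" unfolding P even_mat_mk2 using e by simp
  show "Phi (Psi X) = X"
    unfolding P Phi_mk2 unfolding X by (simp add: fm_cancel mult.assoc fm_sq)
qed

lemma Psi_S:
  assumes "X \<in> S" shows "even_mat (Psi X)" "Phi (Psi X) = X"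
  using Psi_even S_D(1,2)[OF assms] by auto

lemma Phi_mult:
  assumes "even_mat M" shows "Phi (M ** N) = Phi M * Phi N"
proof -
  obtain a b c d where M: "M = mk2 a b c d" by (rule mk2_cases)
  obtain a' b' c' d' where N: "N = mk2 a' b' c' d'" by (rule mk2_cases)
  have "even_entries a (b * fm) (- (fm * c)) (- (fm * d * fm))"
    using assms unfolding M even_mat_mk2 even_entries_def by simp
  then show ?thesis
    unfolding M N mk2_mult Phi_mk2 by (subst even_mult) (simp_all add: fm_cancel mult.assoc distrib_left distrib_right add.commute)
qed

lemma Phi_one: "Phi (mat 1) = 1"
  unfolding mk2_one[symmetric] Phi_mk2 using fm_sq by (simp add: Th_1)

lemma even_mat_mult: "even_mat M \<Longrightarrow> even_mat N \<Longrightarrow> even_mat (M ** N)"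
  by (cases M rule: mk2_cases, cases N rule: mk2_cases) (auto simp: even_mat_mk2 mk2_mult)

lemma even_mat_one: "even_mat (mat 1)"
  unfolding mk2_one[symmetric] even_mat_mk2 by simp

lemma Phi_inj:
  assumes "even_mat M" "even_mat N" "Phi M = Phi N" shows "M = N"
  using Psi_Phi_even assms by metis

text \<open>This will turn out to be \<open>Sp\<^sub>2(ClGr(m,n),\<sigma>)\<close>.\<close>

definition SM :: "mat2 set" where "SM = {M. even_mat M \<and> Phi M \<in> S}"

text \<open>As a set of fixed points with values in \<open>S\<close>, this form makes it evident that \<open>SM\<close> is closed.\<close>

lemma SM_eq: "SM = {M. Psi (Phi M) = M \<and> Phi M \<in> S}"
  unfolding SM_def using Psi_Phi_even Psi_S(1) by (auto, metis)

lemma closed_SM: "closed SM"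
proof -
  have "closed (Phi -` S)"
    by (rule closed_vimage[OF closed_Spin1[of "m + 1" "n + 1", folded S_def] continuous_Phi])
  moreover have "continuous_on UNIV (\<lambda>M. Psi (Phi M))"
    by (rule continuous_on_compose2[OF continuous_Psi[of UNIV] continuous_Phi[of UNIV]]) simp
  then have "closed {M. Psi (Phi M) = M}" by (intro closed_Collect_eq continuous_intros)
  ultimately show ?thesis unfolding SM_eq by (simp add: Collect_conj_eq vimage_def closed_Int)
qed

lemma Psi_SM: "X \<in> S \<Longrightarrow> Psi X \<in> SM"
  unfolding SM_def using Psi_S by simp

lemma SM_inverse:
  assumes "M \<in> SM"
  shows "M ** Psi (transp (Phi M)) = mat 1" "Psi (transp (Phi M)) ** M = mat 1"
    "Psi (transp (Phi M)) \<in> SM"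
proof -
  have M: "even_mat M" "Phi M \<in> S" using assms by (auto simp: SM_def)
  note S = S_D[OF M(2)] and T = Psi_S[OF S_transp[OF M(2)]]
  show "Psi (transp (Phi M)) \<in> SM" by (rule Psi_SM[OF S_transp[OF M(2)]])
  show "M ** Psi (transp (Phi M)) = mat 1" "Psi (transp (Phi M)) ** M = mat 1"
    using M S T by (auto intro!: Phi_inj even_mat_mult even_mat_one simp: Phi_mult Phi_one)
qed

lemma S_closure_cell: assumes "X \<in> S" shows "X \<in> closure cell"
  unfolding closure_approachable
proof (intro allI impI)
  fix \<epsilon> :: real assume \<epsilon>: "\<epsilon> > 0"
  obtain a b c d where Xe: "X = Th a b c d" and evX: "even_entries a b c d"
    using S_Th[OF assms] .
  note ev = even_entriesD[OF evX]
  obtain w where w: "w \<in> V"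
    "finite {t::real. (a + t *\<^sub>R (w * c)) * transp (a + t *\<^sub>R (w * c)) = 0}"
    by (rule generic_first_entry[OF assms[unfolded Xe] evX])
  \<comment> \<open>\<open>Th 1 (tw) 0 1 * X\<close> differs from \<open>X\<close> by \<open>tpwX\<close>, of norm less than \<open>tK\<close>.\<close>
  define K where "K = norm (p * w * X) + 1"
  have K: "K > 0" "norm (p * w * X) < K" unfolding K_def by (smt (verit) norm_ge_zero)+
  have "infinite {0<..<\<epsilon> / K}" using \<epsilon> K(1) by (simp add: infinite_Ioo)
  then have "\<not> {0<..<\<epsilon> / K} \<subseteq> {t::real. (a + t *\<^sub>R (w * c)) * transp (a + t *\<^sub>R (w * c)) = 0}"
    using finite_subset[OF _ w(2)] by blast
  then obtain t where t: "0 < t" "t < \<epsilon> / K" "(a + t *\<^sub>R (w * c)) * transp (a + t *\<^sub>R (w * c)) \<noteq> 0"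
    unfolding subset_iff by (metis (lifting) greaterThanLessThan_iff mem_Collect_eq)
  let ?w = "t *\<^sub>R w"
  have "Th 1 ?w 0 1 * X \<in> cell"
    unfolding Xe using translate_in_cell[OF assms[unfolded Xe] evX, of ?w] t w(1) by simp
  moreover have "Th 1 ?w 0 1 * X = X + t *\<^sub>R (p * w * X)"
    by (simp add: Th_upper distrib_right)
  then have "dist (Th 1 ?w 0 1 * X) X = t * norm (p * w * X)" using t by (simp add: dist_norm)
  then have "dist (Th 1 ?w 0 1 * X) X < \<epsilon>"
    using t K \<epsilon> by (smt (verit) mult_strict_left_mono pos_less_divide_eq)
  ultimately show "\<exists>Y\<in>cell. dist Y X < \<epsilon>" by blast
qed

end

locale symplectic_setting = hyperbolic_extension +
  fixes \<sigma> :: "cliff \<Rightarrow> cliff"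
  assumes anti: "anti_involution_on (Cl m n) \<sigma>"
    and sigma_fm: "\<sigma> (fb m) = - fb m"
    and sigma_fb: "\<forall>i\<in>{1..m - 1}. \<sigma> (fb i) = fb i"
    and sigma_eb: "\<forall>j\<in>{1..n}. \<sigma> (eb j) = eb j"
begin

text \<open>Both sides are anti-homomorphisms that agree on the basis of \<open>V\<close>.\<close>

lemma sigma_eq:
  assumes "x \<in> A" shows "\<sigma> x = - (fm * alpha (transp x) * fm)"
proof -
  have s: "\<And>x. x \<in> A \<Longrightarrow> \<sigma> x \<in> A" "\<And>x. x \<in> A \<Longrightarrow> \<sigma> (\<sigma> x) = x"
    "\<And>x y. x \<in> A \<Longrightarrow> y \<in> A \<Longrightarrow> \<sigma> (x + y) = \<sigma> x + \<sigma> y"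
    "\<And>r x. x \<in> A \<Longrightarrow> \<sigma> (r *\<^sub>R x) = r *\<^sub>R \<sigma> x"
    "\<And>x y. x \<in> A \<Longrightarrow> y \<in> A \<Longrightarrow> \<sigma> (x * y) = \<sigma> y * \<sigma> x"
    using anti unfolding anti_involution_on_def by auto
  have "\<sigma> (\<sigma> 1) = \<sigma> (\<sigma> 1) * \<sigma> 1" using s(5)[of 1 "\<sigma> 1"] s(1)[of 1] by simp
  then have s1: "\<sigma> 1 = 1" using s(2)[of 1] by simp
  have s0: "\<sigma> 0 = 0" using s(4)[of 0 0] by simp
  let ?Z = "{x \<in> A. \<sigma> x = - (fm * alpha (transp x) * fm)}"
  have Z: "subspace ?Z" by (rule subspaceI) (auto simp: s s0 algebra_simps)
  have fm_anti: "g * fm = - (fm * g)" if "g = blade {a}" "a \<noteq> F m" for g a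
    unfolding that(1) fb_def by (rule gen_anticommute[OF that(2)])
  have other: "g \<in> ?Z" if "g = blade {a}" "a \<in> gens m n" "a \<noteq> F m" "\<sigma> g = g" for g a
  proof -
    have "fm * g * fm = g"
      using fm_anti[OF that(1,3)] by (simp add: mult.assoc fm_cancel)
    then show ?thesis using that gen_V[OF that(2)] alpha_V[OF gen_V[OF that(2)]] transp_V[OF gen_V[OF that(2)]] by auto
  qed
  have "fb i \<in> ?Z" if "i \<in> {1..m}" for i
  proof (cases "i = m")
    case True
    then show ?thesis using sigma_fm by (simp add: fm_cancel mult.assoc fm_sq)
  next
    case False
    then show ?thesis using that sigma_fb by (intro other[of _ "F i"]) (auto simp: fb_def gens_def)
  qed
  moreover have "eb j \<in> ?Z" if "j \<in> {1..n}" for j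
    using that sigma_eb by (intro other[of _ "E j"]) (auto simp: eb_def gens_def)
  ultimately have "V \<subseteq> ?Z" unfolding Vsp_def by (intro span_minimal Z) auto
  then have "alg_span V \<subseteq> ?Z"
  proof (rule alg_span_minimal[OF _ Z])
    show "1 \<in> ?Z" using s1 fm_sq by simp
    fix x y assume "x \<in> ?Z" "y \<in> ?Z"
    then show "x * y \<in> ?Z" by (auto simp: s mult.assoc fm_cancel)
  qed
  then show ?thesis using assms by (auto simp: Cl_def)
qed

lemma sigma_even: "x \<in> A \<Longrightarrow> alpha x = x \<Longrightarrow> \<sigma> x = - (fm * transp x * fm)"
  by (simp add: sigma_eq alpha_transp)

lemma sigma_V: "v \<in> V \<Longrightarrow> \<sigma> v = fm * v * fm"
  by (simp add: sigma_eq alpha_transp transp_V alpha_V)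

abbreviation "Bs \<equiv> Bplus m n \<sigma>"

lemma BsD: "y \<in> Bs \<Longrightarrow> y \<in> A" "y \<in> Bs \<Longrightarrow> alpha y = y"
  using Bsp_even by (auto simp: Bplus_def)

lemma V_Bs: assumes "v \<in> V" shows "fm * v \<in> Bs" "v * fm \<in> Bs"
proof -
  have "fm * v \<in> Bsp m n" "v * fm \<in> Bsp m n" using Bsp_mult_V assms by auto
  then show "fm * v \<in> Bs" "v * fm \<in> Bs"
    using Bsp_even[of "fm * v" m n] Bsp_even[of "v * fm" m n] transp_V[OF assms]
    by (auto simp: Bplus_def sigma_even mult.assoc fm_cancel fm_sq)
qed

text \<open>
  For \<open>y \<in> B\<close> the commutator of \<open>f\<^sub>m\<close> and \<open>y\<close> lies in \<open>V\<close>. When \<open>\<sigma>(y) = y\<close>, the anticommutator is a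
  multiple of \<open>f\<^sub>m\<close>. Hence \<open>f\<^sub>my\<close> and \<open>yf\<^sub>m\<close> are vectors.
\<close>

lemma Bs_V: assumes "y \<in> Bs" shows "fm * y \<in> V" "y * fm \<in> V"
proof -
  have y: "y \<in> Bsp m n" "\<sigma> y = y" using assms by (auto simp: Bplus_def)
  obtain r where r: "transp y = of_real r - y" using Bsp_transp[OF y(1)] .
  have "y = - (fm * transp y * fm)" using y sigma_even BsD[OF assms] by simp
  then have "fm * y = transp y * fm" by (metis fm_cancel(1) mult_minus_right minus_minus mult.assoc)
  then have sum: "fm * y + y * fm = r *\<^sub>R fm" by (simp add: r of_real_def algebra_simps)
  have com: "y * fm - fm * y \<in> V" by (rule Bsp_commutator[OF y(1) fm_V])
  have 2: "x = (1/2) *\<^sub>R (x + x)" for x :: cliff by (simp flip: scaleR_2)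
  have "fm * y + fm * y = r *\<^sub>R fm - (y * fm - fm * y)" "y * fm + y * fm = r *\<^sub>R fm + (y * fm - fm * y)"
    by (simp_all flip: sum)
  then have "fm * y + fm * y \<in> V" "y * fm + y * fm \<in> V" using com by (metis V_intros(1,2,4) fm_V)+
  then show "fm * y \<in> V" "y * fm \<in> V" using 2 by (metis V_intros(4))+
qed

lemma cinv_sigma:
  assumes "lipschitz m n x x'" "alpha x = x" shows "cinv (\<sigma> x) = - (fm * transp x' * fm)"
proof (rule cinv_eq)
  note l = lipschitzD[OF assms(1)]
  have t: "transp x * transp x' = 1" "transp x' * transp x = 1" using l by (metis transp_1 transp_mult)+
  have s: "\<sigma> x = - (fm * transp x * fm)" using sigma_even l assms by simp
  have "\<sigma> x * - (fm * transp x' * fm) = - (fm * (transp x * transp x') * fm)"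
    "- (fm * transp x' * fm) * \<sigma> x = - (fm * (transp x' * transp x) * fm)"
    unfolding s by (simp_all add: mult.assoc fm_cancel)
  then show "\<sigma> x * - (fm * transp x' * fm) = 1" "- (fm * transp x' * fm) * \<sigma> x = 1"
    unfolding t using fm_sq by simp_all
qed

lemma Phi_diag:
  assumes "lipschitz m n x x'" "alpha x = x"
  shows "Phi (diag2 x (cinv (\<sigma> x))) = Th x 0 0 (transp x')" "even_mat (diag2 x (cinv (\<sigma> x)))"
proof -
  note l = lipschitzD[OF assms(1)]
  have "alpha x' = x'" using even_inverse l assms by blast
  then show "even_mat (diag2 x (cinv (\<sigma> x)))"
    unfolding cinv_sigma[OF assms] even_mat_mk2 using l assms(2) by (simp add: alpha_transp)
  show "Phi (diag2 x (cinv (\<sigma> x))) = Th x 0 0 (transp x')"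
    unfolding cinv_sigma[OF assms] Phi_mk2 by (simp add: mult.assoc fm_cancel fm_sq)
qed

lemma Phi_Lm: "y \<in> Bs \<Longrightarrow> Phi (Lm y) = Th 1 0 (- (fm * y)) 1 \<and> even_mat (Lm y)"
  and Phi_Rm: "y \<in> Bs \<Longrightarrow> Phi (Rm y) = Th 1 (y * fm) 0 1 \<and> even_mat (Rm y)"
  using fm_sq by (simp_all add: Phi_mk2 even_mat_mk2 BsD)

definition matrix_cell :: "mat2 set" where
  "matrix_cell = {Lm y ** diag2 x (cinv (\<sigma> x)) ** Rm z | x y z. x \<in> ClGr m n \<and> y \<in> Bs \<and> z \<in> Bs}"

lemma matrix_cell_SM: "matrix_cell \<subseteq> SM"
proof
  fix M assume "M \<in> matrix_cell"
  then obtain x y z where M: "M = Lm y ** diag2 x (cinv (\<sigma> x)) ** Rm z"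
    and x: "x \<in> ClGr m n" and yz: "y \<in> Bs" "z \<in> Bs" unfolding matrix_cell_def by blast
  obtain x' where x': "lipschitz m n x x'" "alpha x = x" using x by (auto simp: ClGr_iff)
  have ev: "even_mat (Lm y)" "even_mat (Rm z)" using Phi_Lm Phi_Rm yz by auto
  have "Phi M = Th 1 0 (- (fm * y)) 1 * Th x 0 0 (transp x') * Th 1 (z * fm) 0 1"
    unfolding M using ev Phi_diag[OF x'] Phi_Lm[OF yz(1)] Phi_Rm[OF yz(2)]
    by (simp add: Phi_mult even_mat_mult)
  also have "\<dots> \<in> S" using x' Bs_V yz by (intro S_mult S_lower S_upper S_diagonal) auto
  finally show "M \<in> SM" unfolding SM_def M using ev Phi_diag[OF x'] by (simp add: even_mat_mult)
qed

lemma cell_Phi: "cell \<subseteq> Phi ` matrix_cell"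
proof
  fix X assume "X \<in> cell"
  then obtain y z a a' where X: "X = Th 1 0 y 1 * Th a 0 0 (transp a') * Th 1 z 0 1"
    and yz: "y \<in> V" "z \<in> V" and a: "lipschitz m n a a'" "alpha a = a" unfolding cell_def by blast
  have B: "fm * y \<in> Bs" "- (z * fm) \<in> Bs" using V_Bs(1)[OF yz(1)] V_Bs(2)[of "- z"] yz by auto
  have "Phi (Lm (fm * y) ** diag2 a (cinv (\<sigma> a)) ** Rm (- (z * fm))) = X"
    unfolding X using Phi_diag[OF a] Phi_Lm[OF B(1)] Phi_Rm[OF B(2)]
    by (simp add: Phi_mult even_mat_mult fm_cancel)
  moreover have "a \<in> ClGr m n" using a by (auto simp: ClGr_iff)
  ultimately show "X \<in> Phi ` matrix_cell" unfolding matrix_cell_def using B by blast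
qed

text \<open>\<open>\<Omega>\<^sup>-\<^sup>1\<sigma>(M)\<^sup>t\<Omega>\<close> corresponds to \<open>Phi(M)\<^sup>t\<close>, so the symplectic condition becomes \<open>X\<^sup>tX = 1\<close>.\<close>

lemma SM_Sp2_Cl: "SM \<subseteq> Sp2_Cl m n \<sigma>"
proof
  fix M assume M: "M \<in> SM"
  then have ev: "even_mat M" and PS: "Phi M \<in> S" by (auto simp: SM_def)
  obtain a b c d where Me: "M = mk2 a b c d" by (rule mk2_cases)
  note e = ev[unfolded Me even_mat_mk2]
  define N where "N = mk2 (\<sigma> d) (- \<sigma> b) (- \<sigma> c) (\<sigma> a)"
  have evN: "even_mat N" unfolding N_def even_mat_mk2 using e by (simp add: sigma_even alpha_transp)
  have "Phi N = transp (Phi M)"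
    unfolding N_def Me Phi_mk2 using e
    by (simp add: Th_transp sigma_even alpha_transp mult.assoc fm_cancel fm_sq)
  then have "Phi (N ** M) = Phi (mat 1)" using S_D(3)[OF PS] evN by (simp add: Phi_mult Phi_one)
  then have NM: "N ** M = mat 1" by (intro Phi_inj even_mat_mult evN ev even_mat_one)
  have "transpose (entrywise \<sigma> M) ** Omega = Omega ** N"
    unfolding Me N_def Omega_def
    by (simp add: mat2_eq_iff matrix_matrix_mult_def transpose_def entrywise_def sum_2)
  then have "transpose (entrywise \<sigma> M) ** Omega ** M = Omega"
    using NM by (simp flip: matrix_mul_assoc)
  moreover have "M \<in> GL2 m n"
    using SM_inverse[OF M] ev unfolding GL2_def M2_def SM_def even_mat_def by blast
  ultimately show "M \<in> Sp2_Cl m n \<sigma>" by (simp add: Sp2_Cl_def)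
qed

text \<open>
  \<open>Phi\<close> and \<open>Psi\<close> are continuous and exchange the cell of triangular factorisations among the
  matrices with \<open>cell\<close>, whose closure is \<open>S\<close>.
\<close>

lemma Sp2_eq: "Sp2_ClGr m n \<sigma> = SM"
proof -
  have "Sp2_ClGr m n \<sigma> = Sp2_Cl m n \<sigma> \<inter> closure (Sp2_Cl m n \<sigma> \<inter> matrix_cell)"
    unfolding Sp2_ClGr_def matrix_cell_def[symmetric]
    by (simp add: closure_of_subtopology)
  also have "Sp2_Cl m n \<sigma> \<inter> matrix_cell = matrix_cell" using matrix_cell_SM SM_Sp2_Cl by blast
  also have "Sp2_Cl m n \<sigma> \<inter> closure matrix_cell = SM"
  proof
    show "Sp2_Cl m n \<sigma> \<inter> closure matrix_cell \<subseteq> SM"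
      using closure_minimal[OF matrix_cell_SM closed_SM] by blast
    have "M \<in> closure matrix_cell" if M: "M \<in> SM" for M
    proof -
      have "Phi M \<in> closure (Phi ` matrix_cell)"
        using S_closure_cell closure_mono[OF cell_Phi] M by (auto simp: SM_def)
      then have "Psi (Phi M) \<in> Psi ` closure (Phi ` matrix_cell)" by blast
      also have "\<dots> \<subseteq> closure (Psi ` Phi ` matrix_cell)"
        by (rule image_closure_subset[OF continuous_Psi closed_closure closure_subset])
      also have "Psi ` Phi ` matrix_cell = matrix_cell"
      proof -
        have "Psi (Phi M) = M" if "M \<in> matrix_cell" for M
          using matrix_cell_SM that Psi_Phi_even by (auto simp: SM_def)
        then show ?thesis by (simp add: image_image)
      qed
      finally show ?thesis using M Psi_Phi_even by (simp add: SM_def)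
    qed
    then show "SM \<subseteq> Sp2_Cl m n \<sigma> \<inter> closure matrix_cell" using SM_Sp2_Cl by blast
  qed
  finally show ?thesis .
qed

end

section \<open>Smooth maps and curves\<close>

lemma higher_differentiable_const: "higher_differentiable_on k U (\<lambda>_. c)"
  by (induction k arbitrary: c) (simp_all add: frechet_derivative_const)

lemma smooth_bounded_linear:
  assumes "bounded_linear L" shows "smooth_on_open UNIV L"
proof -
  have "frechet_derivative L (at x) = L" for x
    using frechet_derivative_at[OF bounded_linear_imp_has_derivative[OF assms]] by simp
  moreover have "L differentiable (at x)" for x
    using bounded_linear_imp_has_derivative[OF assms] by (auto simp: differentiable_def)
  ultimately have "higher_differentiable_on k UNIV L" for k
    using assms by (cases k) (simp_all add: linear_continuous_on higher_differentiable_const)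
  then show ?thesis by (simp add: smooth_on_open_def)
qed

lemma higher_differentiable_cong:
  assumes "open U" "\<And>x. x \<in> U \<Longrightarrow> g x = h x" "higher_differentiable_on k U g"
  shows "higher_differentiable_on k U h"
  using assms(2,3)
proof (induction k arbitrary: g h)
  case 0
  then show ?case using continuous_on_cong[of U U g h] by simp
next
  case (Suc k)
  have d: "(h has_derivative D) (at x)" if "(g has_derivative D) (at x)" "x \<in> U" for x D
    by (rule has_derivative_transform_within_open[OF that(1) assms(1) that(2) Suc.prems(1)])
  have dh: "h differentiable (at x)" if "x \<in> U" for x
  proof -
    have "g differentiable (at x)" using Suc.prems(2) that by simp
    then obtain D where "(g has_derivative D) (at x)" unfolding differentiable_def by blast
    from d[OF this that] show ?thesis unfolding differentiable_def by blast
  qed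
  have fd: "frechet_derivative g (at x) = frechet_derivative h (at x)" if "x \<in> U" for x
  proof -
    have "g differentiable (at x)" using Suc.prems(2) that by simp
    then have "(g has_derivative frechet_derivative g (at x)) (at x)"
      by (simp add: frechet_derivative_works)
    from frechet_derivative_at[OF d[OF this that]] show ?thesis .
  qed
  have "higher_differentiable_on k U (\<lambda>x. frechet_derivative h (at x) v)" for v
  proof (rule Suc.IH[of "\<lambda>x. frechet_derivative g (at x) v"])
    show "higher_differentiable_on k U (\<lambda>x. frechet_derivative g (at x) v)" using Suc.prems(2) by simp
    show "frechet_derivative g (at x) v = frechet_derivative h (at x) v" if "x \<in> U" for x
      by (simp only: fd[OF that])
  qed
  with dh show ?case by simp
qed

lemma higher_differentiable_linear_compose:
  assumes "bounded_linear L" "open U" "higher_differentiable_on k U g"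
  shows "higher_differentiable_on k U (\<lambda>x. L (g x))"
  using assms(3)
proof (induction k arbitrary: g)
  case 0
  then show ?case using assms(1) by (simp add: bounded_linear.continuous_on)
next
  case (Suc k)
  have d: "((\<lambda>x. L (g x)) has_derivative (\<lambda>v. L (frechet_derivative g (at x) v))) (at x)" if "x \<in> U" for x
  proof -
    have "g differentiable (at x)" using Suc.prems that by simp
    then show ?thesis
      by (intro bounded_linear.has_derivative[OF assms(1)]) (simp add: frechet_derivative_works)
  qed
  have "higher_differentiable_on k U (\<lambda>x. frechet_derivative (\<lambda>x. L (g x)) (at x) v)" for v
  proof (rule higher_differentiable_cong[OF assms(2)])
    show "higher_differentiable_on k U (\<lambda>x. L (frechet_derivative g (at x) v))"
      using Suc by simp
    show "L (frechet_derivative g (at x) v) = frechet_derivative (\<lambda>x. L (g x)) (at x) v" if "x \<in> U" for x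
      using fun_cong[OF frechet_derivative_at[OF d[OF that]]] .
  qed
  moreover have "(\<lambda>x. L (g x)) differentiable (at x)" if "x \<in> U" for x
    using d[OF that] unfolding differentiable_def by blast
  ultimately show ?case by simp
qed

lemma smooth_curve_linear_image:
  assumes "bounded_linear L" "smooth_curve_at T x X \<gamma>" "L ` T \<subseteq> T'"
  shows "smooth_curve_at T' (L x) (L X) (\<lambda>t. L (\<gamma> t))"
proof -
  obtain \<epsilon> where \<epsilon>: "\<epsilon> > 0" "smooth_on_open {-\<epsilon><..<\<epsilon>} \<gamma>" "\<gamma> ` {-\<epsilon><..<\<epsilon>} \<subseteq> T"
    and \<gamma>: "\<gamma> 0 = x" "(\<gamma> has_vector_derivative X) (at 0)"
    using assms(2) by (auto simp: smooth_curve_at_def)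
  have "smooth_on_open {-\<epsilon><..<\<epsilon>} (\<lambda>t. L (\<gamma> t))"
    using \<epsilon>(2) by (simp add: smooth_on_open_def higher_differentiable_linear_compose[OF assms(1)])
  moreover have "(\<lambda>t. L (\<gamma> t)) ` {-\<epsilon><..<\<epsilon>} \<subseteq> T'" using \<epsilon>(3) assms(3) by auto
  ultimately show ?thesis
    unfolding smooth_curve_at_def
    using \<epsilon>(1) \<gamma> bounded_linear.has_vector_derivative[OF assms(1)] by auto
qed

text \<open>
  A class of curves that is closed under differentiation, so that all its members are smooth. It
  contains one-parameter groups of rotations and boosts and is closed under products.
\<close>

inductive_set trig_curves :: "(real \<Rightarrow> cliff) set" where
  const: "(\<lambda>_. x) \<in> trig_curves"
| cos: "(\<lambda>t. of_real (cos (c * t))) \<in> trig_curves"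
| sin: "(\<lambda>t. of_real (sin (c * t))) \<in> trig_curves"
| cosh: "(\<lambda>t. of_real (cosh (c * t))) \<in> trig_curves"
| sinh: "(\<lambda>t. of_real (sinh (c * t))) \<in> trig_curves"
| add: "g \<in> trig_curves \<Longrightarrow> h \<in> trig_curves \<Longrightarrow> (\<lambda>t. g t + h t) \<in> trig_curves"
| mult: "g \<in> trig_curves \<Longrightarrow> h \<in> trig_curves \<Longrightarrow> (\<lambda>t. g t * h t) \<in> trig_curves"

lemma trig_curves_scale: "g \<in> trig_curves \<Longrightarrow> (\<lambda>t. r *\<^sub>R g t) \<in> trig_curves"
  using trig_curves.mult[OF trig_curves.const[of "of_real r"]] by (simp add: scaleR_conv_of_real)

lemma has_vector_derivative_of_real_curve:
  assumes "(u has_real_derivative u') (at t)"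
  shows "((\<lambda>t. of_real (u t) :: cliff) has_vector_derivative of_real u') (at t)"
proof -
  have "bounded_linear (of_real :: real \<Rightarrow> cliff)" by (rule bounded_linear_of_real)
  from bounded_linear.has_vector_derivative[OF this] assms show ?thesis
    by (simp add: has_real_derivative_iff_has_vector_derivative)
qed

lemma trig_curves_derivative:
  assumes "g \<in> trig_curves"
  shows "\<exists>g'\<in>trig_curves. \<forall>t. (g has_vector_derivative g' t) (at t)"
  using assms
proof induction
  case (const x)
  show ?case by (intro bexI[of _ "\<lambda>_. 0"]) (auto intro: trig_curves.const)
next
  case (cos c)
  have "((\<lambda>t. cos (c * t)) has_real_derivative (- c) * sin (c * t)) (at t)" for t
    by (auto intro!: derivative_eq_intros)
  then show ?case using trig_curves.mult[OF trig_curves.const[of "of_real (- c)"] trig_curves.sin[of c]]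
    by (intro bexI[of _ "\<lambda>t. of_real (- c) * of_real (sin (c * t))"])
      (metis has_vector_derivative_of_real_curve of_real_mult)
next
  case (sin c)
  have "((\<lambda>t. sin (c * t)) has_real_derivative c * cos (c * t)) (at t)" for t
    by (auto intro!: derivative_eq_intros)
  then show ?case using trig_curves.mult[OF trig_curves.const[of "of_real c"] trig_curves.cos[of c]]
    by (intro bexI[of _ "\<lambda>t. of_real c * of_real (cos (c * t))"])
      (metis has_vector_derivative_of_real_curve of_real_mult)
next
  case (cosh c)
  have "((\<lambda>t. cosh (c * t)) has_real_derivative c * sinh (c * t)) (at t)" for t
    by (auto intro!: derivative_eq_intros)
  then show ?case using trig_curves.mult[OF trig_curves.const[of "of_real c"] trig_curves.sinh[of c]]
    by (intro bexI[of _ "\<lambda>t. of_real c * of_real (sinh (c * t))"])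
      (metis has_vector_derivative_of_real_curve of_real_mult)
next
  case (sinh c)
  have "((\<lambda>t. sinh (c * t)) has_real_derivative c * cosh (c * t)) (at t)" for t
    by (auto intro!: derivative_eq_intros)
  then show ?case using trig_curves.mult[OF trig_curves.const[of "of_real c"] trig_curves.cosh[of c]]
    by (intro bexI[of _ "\<lambda>t. of_real c * of_real (cosh (c * t))"])
      (metis has_vector_derivative_of_real_curve of_real_mult)
next
  case (add g h)
  then obtain g' h' where "g' \<in> trig_curves" "h' \<in> trig_curves"
    "\<forall>t. (g has_vector_derivative g' t) (at t)" "\<forall>t. (h has_vector_derivative h' t) (at t)" by blast
  then show ?case
    by (intro bexI[of _ "\<lambda>t. g' t + h' t"]) (auto intro: has_vector_derivative_add trig_curves.add)
next
  case (mult g h)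
  then obtain g' h' where "g' \<in> trig_curves" "h' \<in> trig_curves"
    "\<forall>t. (g has_vector_derivative g' t) (at t)" "\<forall>t. (h has_vector_derivative h' t) (at t)" by blast
  then show ?case using mult
    by (intro bexI[of _ "\<lambda>t. g t * h' t + g' t * h t"])
      (auto intro: has_vector_derivative_mult trig_curves.add trig_curves.mult)
qed

lemma trig_curves_smooth:
  assumes "g \<in> trig_curves" shows "higher_differentiable_on k U g"
  using assms
proof (induction k arbitrary: g)
  case 0
  obtain g' where "\<forall>t. (g has_vector_derivative g' t) (at t)"
    using trig_curves_derivative[OF 0] by blast
  then have "isCont g t" for t using has_vector_derivative_continuous by blast
  then show ?case by (simp add: continuous_at_imp_continuous_on)
next
  case (Suc k)
  obtain g' where g': "g' \<in> trig_curves" "\<And>t. (g has_vector_derivative g' t) (at t)"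
    using trig_curves_derivative[OF Suc.prems] by blast
  have d: "(g has_derivative (\<lambda>v. v *\<^sub>R g' t)) (at t)" for t
    using g'(2) by (simp add: has_vector_derivative_def)
  have "frechet_derivative g (at t) = (\<lambda>v. v *\<^sub>R g' t)" for t
    using frechet_derivative_at[OF d] by simp
  moreover have "g differentiable (at t)" for t using d unfolding differentiable_def by blast
  ultimately show ?case using Suc.IH[OF trig_curves_scale[OF g'(1)]] by simp
qed

lemma trig_curve_at:
  assumes "g \<in> trig_curves" "\<And>t. g t \<in> T" "g 0 = x" "(g has_vector_derivative X) (at 0)"
  shows "smooth_curve_at T x X g"
  unfolding smooth_curve_at_def smooth_on_open_def
  using assms trig_curves_smooth[OF assms(1)] by (auto intro!: exI[of _ 1])

section \<open>The Lie algebra \<open>spin(m,n)\<close>\<close>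

lemma spin_gen_product:
  assumes "a \<in> gens m n" "b \<in> gens m n" "a \<noteq> b" shows "blade {a} * blade {b} \<in> spin m n"
proof -
  have base: "eb i * eb j \<in> spin m n" if "i \<in> {1..n}" "j \<in> {1..n}" "i \<noteq> j" for i j
    unfolding spin_def using that by (intro span_base) blast
  have base': "fb k * eb i \<in> spin m n" if "k \<in> {1..m}" "i \<in> {1..n}" for i k
    unfolding spin_def using that by (intro span_base) blast
  have base'': "fb k * fb l \<in> spin m n" if "k \<in> {1..m}" "l \<in> {1..m}" "k \<noteq> l" for k l
    unfolding spin_def using that by (intro span_base) blast
  have swap: "eb i * fb k = - (fb k * eb i)" for i k
    unfolding fb_def eb_def by (rule gen_anticommute) simp
  have neg: "- x \<in> spin m n" if "x \<in> spin m n" for x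
    using that unfolding spin_def by (rule span_neg)
  show ?thesis
    using assms base base' base'' neg swap
    by (cases a; cases b) (auto simp: gens_def simp flip: fb_def eb_def)
qed

lemma spin_eq_span: "spin m n = span {blade {a} * blade {b} | a b. a \<in> gens m n \<and> b \<in> gens m n \<and> a \<noteq> b}"
  (is "_ = span ?G")
proof
  show "span ?G \<subseteq> spin m n"
    by (rule span_minimal) (auto simp: spin_gen_product, simp add: spin_def)
  show "spin m n \<subseteq> span ?G"
    unfolding spin_def
  proof (intro span_minimal subspace_span)
    have F: "F k \<in> gens m n" if "k \<in> {1..m}" for k using that by (simp add: gens_def)
    have E: "E i \<in> gens m n" if "i \<in> {1..n}" for i using that by (simp add: gens_def)
    have G: "blade {a} * blade {b} \<in> span ?G" if "a \<in> gens m n" "b \<in> gens m n" "a \<noteq> b" for a b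
      using that by (intro span_base) blast
    show "{eb i * eb j |i j. i \<in> {1..n} \<and> j \<in> {1..n} \<and> i \<noteq> j} \<union>
      {fb k * eb i |k i. k \<in> {1..m} \<and> i \<in> {1..n}} \<union>
      {fb k * fb l |k l. k \<in> {1..m} \<and> l \<in> {1..m} \<and> k \<noteq> l} \<subseteq> span ?G"
      unfolding fb_def eb_def using G E F by auto
  qed
qed

lemma subspace_spin: "subspace (spin m n)"
  by (simp add: spin_def)

lemma supp_spin:
  assumes "supp x \<subseteq> {B. B \<subseteq> gens m n \<and> card B = 2}" shows "x \<in> spin m n"
proof -
  have "x = (\<Sum>B\<in>{B. B \<subseteq> gens m n \<and> card B = 2}. coef x B *\<^sub>R blade B)"
  proof (rule cliff_expand[OF _ assms])
    show "finite {B. B \<subseteq> gens m n \<and> card B = 2}"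
      by (rule finite_subset[of _ "Pow (gens m n)"]) auto
    show "finite B" if "B \<in> {B. B \<subseteq> gens m n \<and> card B = 2}" for B
      using that finite_subset[OF _ finite_gens] by auto
  qed
  also have "\<dots> \<in> spin m n"
  proof (intro subspace_sum[OF subspace_spin] subspace_scale[OF subspace_spin])
    fix B assume "B \<in> {B. B \<subseteq> gens m n \<and> card B = 2}"
    then obtain a b where B: "B = {a, b}" "a \<noteq> b" "a \<in> gens m n" "b \<in> gens m n"
      by (auto simp: card_2_iff)
    have "sdiff {a} {b} = {a, b}" using B by auto
    then have "blade {a} * blade {b} = bsgn {a} {b} *\<^sub>R blade B" using B by (simp add: blade_mult)
    then have "blade B = bsgn {a} {b} *\<^sub>R (blade {a} * blade {b})" by simp
    then show "blade B \<in> spin m n"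
      using subspace_scale[OF subspace_spin spin_gen_product[OF B(3,4,2)]] by metis
  qed
  finally show ?thesis .
qed

text \<open>
  If \<open>[x,V] \<subseteq> V\<close> then the even element \<open>x\<close> has no component of degree four or more: for \<open>a \<in> B\<close>
  the coefficient of \<open>x\<close> at \<open>B\<close> shows up in \<open>[x,a]\<close> at \<open>B - {a}\<close>.
\<close>

lemma infinitesimal_in_spin:
  assumes x: "x \<in> Cl m n" "alpha x = x" "transp x = - x"
    and V: "\<And>v. v \<in> Vsp m n \<Longrightarrow> x * v - v * x \<in> Vsp m n"
  shows "x \<in> spin m n"
proof (rule supp_spin, rule subsetI)
  fix B assume "B \<in> supp x"
  then have B: "coef x B \<noteq> 0" by (simp add: supp_def)
  then have Bg: "B \<subseteq> gens m n" using x(1) by (auto simp: Cl_eq supp_def)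
  then have fin: "finite B" using finite_subset[OF _ finite_gens] by blast
  have "coef (alpha x) B = (-1) ^ card B * coef x B" by (simp add: alpha_def)
  then have ev: "even (card B)" using B x(2) by (cases "even (card B)") simp_all
  have "B \<noteq> {}"
  proof
    assume "B = {}"
    then have "coef (transp x) B = coef x B" by (simp add: transp_def numeral_2_eq_2)
    then show False using x(3) B by simp
  qed
  then obtain a where a: "a \<in> B" by blast
  have "card B \<le> 2"
  proof (rule ccontr)
    assume "\<not> card B \<le> 2"
    then have "card (B - {a}) \<noteq> 1" using a fin by simp
    then have "B - {a} \<notin> (\<lambda>a. {a}) ` gens m n" by (metis imageE is_singletonI is_singleton_altdef)
    moreover have "x * blade {a} - blade {a} * x \<in> Vsp m n" using a Bg by (intro V gen_V) auto
    ultimately have "coef (x * blade {a} - blade {a} * x) (B - {a}) = 0"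
      by (simp only: Vsp_eq supp_def mem_Collect_eq subset_iff) (erule contrapos_np, simp)
    then have "coef x B = 0" using twisted_commutator_coef[OF a, of x] x(2) by simp
    then show False using B by simp
  qed
  moreover have "card B > 0" using a fin by (auto simp: card_gt_0_iff)
  ultimately have "card B = 2" using ev by (cases "card B = 1") auto
  then show "B \<in> {B. B \<subseteq> gens m n \<and> card B = 2}" using Bg by simp
qed

text \<open>
  Two descriptions of \<open>spin(m,n)\<close>: inside \<open>B(m,n)\<close>, the condition \<open>x\<^sup>t = -x\<close> removes the scalars; and
  inside the even subalgebra, \<open>spin(m,n)\<close> is cut out by the linearised equations of \<open>Spin1\<close>. The second
  description is visibly closed under commutators.
\<close>

lemma spin_iff_bivector: "x \<in> spin m n \<longleftrightarrow> x \<in> Bsp m n \<and> transp x = - x"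
proof
  assume "x \<in> spin m n"
  moreover have "spin m n \<subseteq> {x \<in> Bsp m n. transp x = - x}"
    unfolding spin_eq_span
  proof (rule span_minimal)
    show "subspace {x \<in> Bsp m n. transp x = - x}"
      by (rule subspaceI) (auto intro: subspace_add[OF subspace_Bsp] subspace_scale[OF subspace_Bsp] subspace_0)
    show "{blade {a} * blade {b} | a b. a \<in> gens m n \<and> b \<in> gens m n \<and> a \<noteq> b} \<subseteq> {x \<in> Bsp m n. transp x = - x}"
    proof clarify
      fix a b assume ab: "a \<in> gens m n" "b \<in> gens m n" "a \<noteq> b"
      then show "blade {a} * blade {b} \<in> Bsp m n \<and> transp (blade {a} * blade {b}) = - (blade {a} * blade {b})"
        using gen_anticommute[of b a] transp_V[OF gen_V] by (auto intro!: Bsp_mult_V gen_V)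
    qed
  qed
  ultimately show "x \<in> Bsp m n \<and> transp x = - x" by blast
next
  assume "x \<in> Bsp m n \<and> transp x = - x"
  then show "x \<in> spin m n" using Bsp_even Bsp_commutator by (intro infinitesimal_in_spin) auto
qed

lemma spin_iff:
  "x \<in> spin m n \<longleftrightarrow> x \<in> Cl m n \<and> alpha x = x \<and> transp x = - x \<and>
     (\<forall>v\<in>Vsp m n. x * v - v * x \<in> Vsp m n)"
  using infinitesimal_in_spin spin_iff_bivector Bsp_even Bsp_commutator by metis

lemma spin_lie: assumes "x \<in> spin m n" "y \<in> spin m n" shows "x * y - y * x \<in> spin m n"
proof -
  have xy: "x * v - v * x \<in> Vsp m n" "y * v - v * y \<in> Vsp m n" if "v \<in> Vsp m n" for v
    using assms that by (auto simp: spin_iff)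
  have "(x * y - y * x) * v - v * (x * y - y * x) \<in> Vsp m n" if v: "v \<in> Vsp m n" for v
  proof -
    have "(x * y - y * x) * v - v * (x * y - y * x)
      = (x * (y * v - v * y) - (y * v - v * y) * x) - (y * (x * v - v * x) - (x * v - v * x) * y)"
      by (simp add: algebra_simps)
    then show ?thesis using xy[OF xy(2)[OF v]] xy[OF xy(1)[OF v]] by simp
  qed
  then show ?thesis using assms by (simp add: spin_iff)
qed

section \<open>Tangent spaces\<close>

text \<open>Subspaces cut out by the vanishing of coefficients contain the derivatives of their curves.\<close>

lemma derivative_supp:
  assumes "(g has_vector_derivative X) (at (0::real))" "\<epsilon> > 0"
    "\<And>t. t \<in> {-\<epsilon><..<\<epsilon>} \<Longrightarrow> supp (g t) \<subseteq> Z"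
  shows "supp X \<subseteq> Z"
proof
  fix B assume B: "B \<in> supp X"
  show "B \<in> Z"
  proof (rule ccontr)
    assume "B \<notin> Z"
    then have 0: "coef (g t) B = 0" if "t \<in> {-\<epsilon><..<\<epsilon>}" for t
      using assms(3)[OF that] by (auto simp: supp_def)
    have "((\<lambda>t. coef (g t) B) has_vector_derivative coef X B) (at 0)"
      by (rule bounded_linear.has_vector_derivative[OF bounded_linear_coef assms(1)])
    then have "((\<lambda>t. 0) has_vector_derivative coef X B) (at (0::real))"
      by (rule has_vector_derivative_transform_within_open[of _ _ _ "{-\<epsilon><..<\<epsilon>}"]) (use assms(2) 0 in auto)
    then have "coef X B = 0" using vector_derivative_unique_at has_vector_derivative_const by blast
    then show False using B by (simp add: supp_def)
  qed
qed

lemma derivative_equal: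
  assumes "(g has_vector_derivative X) (at (0::real))" "(h has_vector_derivative Y) (at 0)" "\<epsilon> > 0"
    "\<And>t. t \<in> {-\<epsilon><..<\<epsilon>} \<Longrightarrow> g t = h t"
  shows "X = Y"
proof -
  have "(h has_vector_derivative X) (at 0)"
    by (rule has_vector_derivative_transform_within_open[OF assms(1), of "{-\<epsilon><..<\<epsilon>}"]) (use assms(3,4) in auto)
  then show ?thesis using vector_derivative_unique_at assms(2) by blast
qed

lemma tangent_Spin1_subset:
  assumes "X \<in> tangent_space (Spin1 m n) 1" shows "X \<in> spin m n"
proof -
  obtain \<gamma> \<epsilon> where \<epsilon>: "\<epsilon> > 0" "\<gamma> ` {-\<epsilon><..<\<epsilon>} \<subseteq> Spin1 m n"
    and \<gamma>: "\<gamma> 0 = 1" "(\<gamma> has_vector_derivative X) (at 0)"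
    using assms by (auto simp: tangent_space_def smooth_curve_at_def)
  have S: "\<gamma> t \<in> Spin1 m n" if "t \<in> {-\<epsilon><..<\<epsilon>}" for t using \<epsilon>(2) that by blast
  note D = Spin1D[OF S]
  note tr = bounded_linear.has_vector_derivative[OF bounded_linear_transp \<gamma>(2)]
  show ?thesis
  proof (rule infinitesimal_in_spin)
    have "supp X \<subseteq> Pow (gens m n)"
      by (rule derivative_supp[OF \<gamma>(2) \<epsilon>(1)]) (use D(1) in \<open>auto simp: Cl_eq\<close>)
    then show "X \<in> Cl m n" by (simp add: Cl_eq)
    show "alpha X = X"
      by (rule derivative_equal[OF bounded_linear.has_vector_derivative[OF bounded_linear_alpha \<gamma>(2)] \<gamma>(2) \<epsilon>(1)])
        (rule D(2))
    have "((\<lambda>t. transp (\<gamma> t) * \<gamma> t) has_vector_derivative (transp (\<gamma> 0) * X + transp X * \<gamma> 0)) (at 0)"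
      by (rule has_vector_derivative_mult[OF tr \<gamma>(2)])
    from derivative_equal[OF this has_vector_derivative_const \<epsilon>(1) D(3)]
    have "X + transp X = 0" by (simp add: \<gamma>(1))
    then show tX: "transp X = - X" by (simp add: eq_neg_iff_add_eq_0 add.commute)
    fix v assume v: "v \<in> Vsp m n"
    have "((\<lambda>t. \<gamma> t * v * transp (\<gamma> t)) has_vector_derivative
        (\<gamma> 0 * v * transp X + (\<gamma> 0 * 0 + X * v) * transp (\<gamma> 0))) (at 0)"
      by (intro has_vector_derivative_mult tr \<gamma>(2) has_vector_derivative_const)
    then have "((\<lambda>t. \<gamma> t * v * transp (\<gamma> t)) has_vector_derivative (X * v - v * X)) (at 0)"
      by (simp add: \<gamma>(1) tX)
    from derivative_supp[OF this \<epsilon>(1)] show "X * v - v * X \<in> Vsp m n"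
      using D(5)[OF _ v] unfolding Vsp_eq by blast
  qed
qed

text \<open>
  The generator \<open>ab\<close> is tangent to the curve \<open>cos t + (sin t)ab\<close> if \<open>(ab)\<^sup>2 = -1\<close> and to
  \<open>cosh t + (sinh t)ab\<close> if \<open>(ab)\<^sup>2 = 1\<close>; both are products of two vectors.
\<close>

lemma rotation_in_Spin1:
  assumes "a \<in> gens m n" "b \<in> gens m n" "a \<noteq> b" "C * C + gsq a * gsq b * (D * D) = 1"
  shows "of_real C + D *\<^sub>R (blade {a} * blade {b}) \<in> Spin1 m n"
proof -
  let ?a = "blade {a}" and ?b = "blade {b}"
  have V: "?a \<in> Vsp m n" "?b \<in> Vsp m n" using assms gen_V by auto
  have sq: "?a * ?a = of_real (gsq a)" "?b * ?b = of_real (gsq b)" by (simp_all add: gen_sq)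
  have aa: "gsq a * gsq a = 1" by (cases a) auto
  define v where "v = (gsq a * C) *\<^sub>R ?a + D *\<^sub>R ?b"
  have "v * v = ((gsq a * C) * (gsq a * C)) *\<^sub>R (?a * ?a) + (D * D) *\<^sub>R (?b * ?b)
      + (gsq a * C * D) *\<^sub>R (?a * ?b + ?b * ?a)"
    by (simp add: v_def algebra_simps)
  also have "?a * ?b + ?b * ?a = 0" using gen_anticommute[OF assms(3)] by simp
  finally have vv: "v * v = of_real (gsq a * C * (gsq a * C) * gsq a + D * D * gsq b)"
    unfolding sq by (simp add: of_real_def scaleR_left_distrib)
  have "gsq a * (gsq a * C * (gsq a * C) * gsq a + D * D * gsq b)
    = (gsq a * gsq a) * (gsq a * gsq a) * (C * C) + gsq a * gsq b * (D * D)"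
    by (simp add: algebra_simps)
  also have "\<dots> = 1" using assms(4) by (simp add: aa)
  finally have "?a * v \<in> Spin1 m n" using V sq vv
    by (intro Spin1_vector_pair[OF _ _ sq(1) vv]) (auto simp: v_def)
  moreover have "?a * v = of_real C + D *\<^sub>R (?a * ?b)"
  proof -
    have "?a * v = (gsq a * C) *\<^sub>R (?a * ?a) + D *\<^sub>R (?a * ?b)" by (simp add: v_def algebra_simps)
    also have "(gsq a * C) *\<^sub>R (?a * ?a) = ((gsq a * gsq a) * C) *\<^sub>R 1" unfolding sq by (simp add: of_real_def mult_ac)
    finally show ?thesis by (simp add: aa of_real_def)
  qed
  ultimately show ?thesis by simp
qed

text \<open>Multiplying curves through \<open>1\<close> adds their derivatives, so sums of generators are reached as well.\<close>

lemma spin_curve: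
  assumes "X \<in> spin m n"
  shows "\<exists>g\<in>trig_curves. (\<forall>t. g t \<in> Spin1 m n) \<and> g 0 = 1 \<and> (g has_vector_derivative X) (at 0)"
  using assms unfolding spin_eq_span
proof (induction rule: span_induct_alt)
  case base
  show ?case by (rule bexI[of _ "\<lambda>_. 1"]) (auto simp: Spin1_one trig_curves.const)
next
  case (step c x y)
  then obtain a b where x: "x = blade {a} * blade {b}" and ab: "a \<in> gens m n" "b \<in> gens m n" "a \<noteq> b" by blast
  obtain h where h: "h \<in> trig_curves" "\<And>t. h t \<in> Spin1 m n" "h 0 = 1" "(h has_vector_derivative y) (at 0)"
    using step by blast
  have "\<exists>g\<in>trig_curves. (\<forall>t. g t \<in> Spin1 m n) \<and> g 0 = 1 \<and> (g has_vector_derivative c *\<^sub>R x) (at 0)"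
  proof (cases "gsq a * gsq b = 1")
    case True
    let ?g = "\<lambda>t. of_real (cos (c * t)) + of_real (sin (c * t)) * x"
    have "cos (c * t) * cos (c * t) + gsq a * gsq b * (sin (c * t) * sin (c * t)) = 1" for t
      using sin_cos_squared_add2[of "c * t"] True by (simp add: power2_eq_square)
    from rotation_in_Spin1[OF ab this] have "\<forall>t. ?g t \<in> Spin1 m n"
      by (simp add: x scaleR_conv_of_real)
    moreover have "?g \<in> trig_curves" by (intro trig_curves.intros)
    moreover have "(?g has_vector_derivative (0 + (of_real (sin (c * 0)) * 0 + of_real c * x))) (at 0)"
    proof (intro has_vector_derivative_add has_vector_derivative_mult has_vector_derivative_const)
      have "((\<lambda>t. cos (c * t)) has_real_derivative 0) (at 0)" by (auto intro!: derivative_eq_intros)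
      from has_vector_derivative_of_real_curve[OF this]
      show "((\<lambda>t. of_real (cos (c * t))) has_vector_derivative (0::cliff)) (at 0)" by simp
      have "((\<lambda>t. sin (c * t)) has_real_derivative c) (at 0)" by (auto intro!: derivative_eq_intros)
      from has_vector_derivative_of_real_curve[OF this]
      show "((\<lambda>t. of_real (sin (c * t))) has_vector_derivative (of_real c::cliff)) (at 0)" .
    qed
    ultimately show ?thesis by (intro bexI[of _ ?g]) (simp_all add: scaleR_conv_of_real)
  next
    case False
    have "gsq a * gsq b = -1" using False by (cases a; cases b) auto
    let ?g = "\<lambda>t. of_real (cosh (c * t)) + of_real (sinh (c * t)) * x"
    have "cosh (c * t) * cosh (c * t) + gsq a * gsq b * (sinh (c * t) * sinh (c * t)) = 1" for t
      using hyperbolic_pythagoras[of "c * t"] \<open>gsq a * gsq b = -1\<close> by (simp add: power2_eq_square)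
    from rotation_in_Spin1[OF ab this] have "\<forall>t. ?g t \<in> Spin1 m n"
      by (simp add: x scaleR_conv_of_real)
    moreover have "?g \<in> trig_curves" by (intro trig_curves.intros)
    moreover have "(?g has_vector_derivative (0 + (of_real (sinh (c * 0)) * 0 + of_real c * x))) (at 0)"
    proof (intro has_vector_derivative_add has_vector_derivative_mult has_vector_derivative_const)
      have "((\<lambda>t. cosh (c * t)) has_real_derivative 0) (at 0)" by (auto intro!: derivative_eq_intros)
      from has_vector_derivative_of_real_curve[OF this]
      show "((\<lambda>t. of_real (cosh (c * t))) has_vector_derivative (0::cliff)) (at 0)" by simp
      have "((\<lambda>t. sinh (c * t)) has_real_derivative c) (at 0)" by (auto intro!: derivative_eq_intros)
      from has_vector_derivative_of_real_curve[OF this]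
      show "((\<lambda>t. of_real (sinh (c * t))) has_vector_derivative (of_real c::cliff)) (at 0)" .
    qed
    ultimately show ?thesis by (intro bexI[of _ ?g]) (simp_all add: scaleR_conv_of_real)
  qed
  then obtain g where g: "g \<in> trig_curves" "\<And>t. g t \<in> Spin1 m n" "g 0 = 1"
    "(g has_vector_derivative c *\<^sub>R x) (at 0)" by blast
  have "((\<lambda>t. g t * h t) has_vector_derivative (g 0 * y + (c *\<^sub>R x) * h 0)) (at 0)"
    by (rule has_vector_derivative_mult[OF g(4) h(4)])
  then show ?case
    using g(1-3) h(1-3) trig_curves.mult[OF g(1) h(1)] Spin1_mult
    by (intro bexI[of _ "\<lambda>t. g t * h t"]) (auto simp: add.commute)
qed

lemma tangent_Spin1: "tangent_space (Spin1 m n) 1 = spin m n"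
proof
  show "spin m n \<subseteq> tangent_space (Spin1 m n) 1"
  proof
    fix X assume "X \<in> spin m n"
    from spin_curve[OF this] obtain g where "g \<in> trig_curves" "\<And>t. g t \<in> Spin1 m n" "g 0 = 1"
      "(g has_vector_derivative X) (at 0)" by blast
    then show "X \<in> tangent_space (Spin1 m n) 1" unfolding tangent_space_def using trig_curve_at by blast
  qed
qed (use tangent_Spin1_subset in blast)

context symplectic_setting
begin

text \<open>Scalars are bivectors because \<open>V\<close> contains the invertible vector \<open>f\<^sub>m\<close>.\<close>

lemma scalar_Bsp: "of_real r \<in> Bsp m n"
proof -
  have "fm * (- r *\<^sub>R fm) \<in> Bsp m n" by (rule Bsp_mult_V) auto
  then show ?thesis using fm_sq by (simp add: of_real_def)
qed

lemma Th_neg: "- Th a b c d = Th (- a) (- b) (- c) (- d)"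
  by (simp add: Th_def)

lemma bivector_Th:
  assumes "X \<in> Bsp (m + 1) (n + 1)"
  shows "\<exists>a b c d. X = Th a b c d \<and> a \<in> Bsp m n \<and> b \<in> V \<and> c \<in> V \<and> d \<in> Bsp m n"
  using assms
proof (induction rule: Bsp_induct)
  case zero
  show ?case by (intro exI[of _ 0]) (auto simp: Th_def subspace_0)
next
  case (add w w' Y)
  obtain v r s where w: "w = Th v (of_real r) (of_real s) v" "v \<in> V"
    using add(1)[folded W_def] unfolding W_eq by auto
  obtain v' r' s' where w': "w' = Th v' (of_real r') (of_real s') v'" "v' \<in> V"
    using add(2)[folded W_def] unfolding W_eq by auto
  obtain a b c d where Y: "Y = Th a b c d" "a \<in> Bsp m n" "b \<in> V" "c \<in> V" "d \<in> Bsp m n"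
    using add by blast
  have "w * w' + Y = Th (v * v' - of_real (r * s') + a) (- (v * of_real r') + of_real r * v' + b)
      (of_real s * v' - v * of_real s' + c) (v * v' - of_real (s * r') + d)"
    unfolding w w' Y using w(2) by (simp add: Th_mult Th_add alpha_V)
  moreover have "v * v' - of_real (r * s') + a \<in> Bsp m n" "v * v' - of_real (s * r') + d \<in> Bsp m n"
    using w w' Y by (intro subspace_add[OF subspace_Bsp] subspace_diff[OF subspace_Bsp] scalar_Bsp Bsp_mult_V; simp)+
  moreover have "- (v * of_real r') + of_real r * v' + b \<in> V" "of_real s * v' - v * of_real s' + c \<in> V"
    using w w' Y by auto
  ultimately show ?case by blast
qed

text \<open>On the Lie algebra, \<open>diag(x, -\<sigma>(x))\<close> corresponds to \<open>Th x 0 0 (-x\<^sup>t)\<close>.\<close>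

lemma Phi_sp2_element:
  assumes "x \<in> Bsp m n" shows "Phi (mk2 x z y (- \<sigma> x)) = Th x (z * fm) (- (fm * y)) (- transp x)"
  using Bsp_even[OF assms] by (simp add: Phi_mk2 sigma_even mult.assoc fm_cancel fm_sq)

lemma sp2_even: "M \<in> sp2 m n \<sigma> \<Longrightarrow> even_mat M"
  unfolding sp2_def using Bsp_even BsD by (auto simp: even_mat_mk2 sigma_even alpha_transp)

lemma Phi_sp2: "Phi ` sp2 m n \<sigma> = spin (m + 1) (n + 1)"
proof
  show "Phi ` sp2 m n \<sigma> \<subseteq> spin (m + 1) (n + 1)"
  proof clarify
    fix M assume "M \<in> sp2 m n \<sigma>"
    then obtain x y z where M: "M = mk2 x z y (- \<sigma> x)" and x: "x \<in> Bsp m n" and yz: "y \<in> Bs" "z \<in> Bs"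
      unfolding sp2_def by blast
    define b c where "b = z * fm" and "c = - (fm * y)"
    have bc: "b \<in> V" "c \<in> V" using Bs_V yz by (auto simp: b_def c_def)
    obtain r where r: "transp x = of_real r - x" using Bsp_transp[OF x] .
    have P: "Phi M = Th x b c (- transp x)" unfolding M Phi_sp2_element[OF x] b_def c_def ..
    have "transp (Phi M) = - Phi M"
      unfolding P Th_neg using bc Bsp_even[OF x] by (simp add: Th_transp transp_V alpha_V alpha_transp)
    moreover have "Phi M \<in> Bsp (m + 1) (n + 1)"
    proof -
      have "Bsp m n \<subseteq> Bsp (m + 1) (n + 1)"
        unfolding Bsp_def using V_W unfolding W_def by (intro span_mono) blast
      then have "x \<in> Bsp (m + 1) (n + 1)" using x by blast
      moreover have "p * b \<in> Bsp (m + 1) (n + 1)" "q * c \<in> Bsp (m + 1) (n + 1)" "q * p \<in> Bsp (m + 1) (n + 1)"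
        using p_W q_W V_W bc unfolding W_def by (auto intro: Bsp_mult_V)
      ultimately have "x + r *\<^sub>R (q * p) + p * b + q * c \<in> Bsp (m + 1) (n + 1)"
        by (intro subspace_add[OF subspace_Bsp] subspace_scale[OF subspace_Bsp])
      moreover have "Phi M = x + r *\<^sub>R (q * p) + p * b + q * c"
      proof -
        have "Phi M = Th x 0 0 x + (p * b + q * c - r *\<^sub>R em)"
          unfolding P r by (simp add: Th_def of_real_def algebra_simps)
        then show ?thesis unfolding Th_diagonal by (simp add: em_def algebra_simps)
      qed
      ultimately show ?thesis by simp
    qed
    ultimately show "Phi M \<in> spin (m + 1) (n + 1)" by (simp only: spin_iff_bivector)
  qed
  show "spin (m + 1) (n + 1) \<subseteq> Phi ` sp2 m n \<sigma>"
  proof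
    fix X assume X: "X \<in> spin (m + 1) (n + 1)"
    then have B: "X \<in> Bsp (m + 1) (n + 1)" and t: "transp X = - X" by (simp_all only: spin_iff_bivector)
    obtain a b c d where Xe: "X = Th a b c d" and abcd: "a \<in> Bsp m n" "b \<in> V" "c \<in> V" "d \<in> Bsp m n"
      using bivector_Th[OF B] by blast
    have "Th (transp d) (- b) (- c) (transp a) = Th (- a) (- b) (- c) (- d)"
      using t abcd Bsp_even[OF abcd(1)] Bsp_even[OF abcd(4)]
      unfolding Xe Th_neg by (simp add: Th_transp transp_V alpha_V)
    then have "transp a = - d"
      using abcd Bsp_even[OF abcd(1)] Bsp_even[OF abcd(4)] by (subst (asm) Th_inj) auto
    then have "d = - transp a" by simp
    then have "X = Phi (mk2 a (- (b * fm)) (fm * c) (- \<sigma> a))"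
      unfolding Phi_sp2_element[OF abcd(1)] Xe by (simp add: fm_cancel)
    moreover have "mk2 a (- (b * fm)) (fm * c) (- \<sigma> a) \<in> sp2 m n \<sigma>"
      unfolding sp2_def using abcd V_Bs(1)[OF abcd(3)] V_Bs(2)[of "- b"] by auto
    ultimately show "X \<in> Phi ` sp2 m n \<sigma>" by blast
  qed
qed

lemma Psi_spin: "Psi ` spin (m + 1) (n + 1) = sp2 m n \<sigma>"
  unfolding Phi_sp2[symmetric] using sp2_even Psi_Phi_even by (force simp: image_image)

lemma tangent_S: "tangent_space S 1 = spin (m + 1) (n + 1)"
  unfolding S_def by (rule tangent_Spin1)

lemma tangent_SM: "tangent_space SM (mat 1) = sp2 m n \<sigma>"
proof
  have Psi1: "Psi 1 = mat 1" using Psi_Phi_even[OF even_mat_one] by (simp add: Phi_one)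
  show "sp2 m n \<sigma> \<subseteq> tangent_space SM (mat 1)"
  proof
    fix X assume "X \<in> sp2 m n \<sigma>"
    then obtain Y where Y: "X = Psi Y" "Y \<in> tangent_space S 1" unfolding Psi_spin[symmetric] tangent_S by blast
    then obtain \<gamma> where "smooth_curve_at S 1 Y \<gamma>" by (auto simp: tangent_space_def)
    from smooth_curve_linear_image[OF bounded_linear_Psi this, of SM]
    show "X \<in> tangent_space SM (mat 1)" unfolding tangent_space_def Y(1) using Psi_SM Psi1 by auto
  qed
  show "tangent_space SM (mat 1) \<subseteq> sp2 m n \<sigma>"
  proof
    fix X assume "X \<in> tangent_space SM (mat 1)"
    then obtain \<gamma> where \<gamma>: "smooth_curve_at SM (mat 1) X \<gamma>" by (auto simp: tangent_space_def)
    have "smooth_curve_at S 1 (Phi X) (\<lambda>t. Phi (\<gamma> t))"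
      using smooth_curve_linear_image[OF bounded_linear_Phi \<gamma>, of S] by (auto simp: Phi_one SM_def)
    then have "Phi X \<in> spin (m + 1) (n + 1)" unfolding tangent_S[symmetric] tangent_space_def by blast
    moreover have "Psi (Phi X) = X"
    proof -
      obtain \<epsilon> where \<epsilon>: "\<epsilon> > 0" "\<gamma> ` {-\<epsilon><..<\<epsilon>} \<subseteq> SM" and d: "(\<gamma> has_vector_derivative X) (at 0)"
        using \<gamma> by (auto simp: smooth_curve_at_def)
      show ?thesis
        by (rule derivative_equal[OF bounded_linear.has_vector_derivative[OF bounded_linear_Psi
            bounded_linear.has_vector_derivative[OF bounded_linear_Phi d]] d \<epsilon>(1)])
          (use \<epsilon>(2) Psi_Phi_even in \<open>auto simp: SM_def image_subset_iff\<close>)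
    qed
    ultimately show "X \<in> sp2 m n \<sigma>" using Psi_spin by (metis imageI)
  qed
qed

section \<open>The isomorphism of Lie groups\<close>

lemma group_Spin0: "group (Spin0_group (m + 1) (n + 1))"
  unfolding Spin0_group_def Spin0_eq
proof (rule groupI)
  fix X assume "X \<in> carrier \<lparr>carrier = S, monoid.mult = (*), one = 1\<rparr>"
  then have "X \<in> S" by simp
  then show "\<exists>Y\<in>carrier \<lparr>carrier = S, monoid.mult = (*), one = 1\<rparr>.
      Y \<otimes>\<^bsub>\<lparr>carrier = S, monoid.mult = (*), one = 1\<rparr>\<^esub> X = \<one>\<^bsub>\<lparr>carrier = S, monoid.mult = (*), one = 1\<rparr>\<^esub>"
    using S_transp S_D(3) by auto
qed (auto simp: S_one S_mult mult.assoc)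

lemma SM_mult: "M \<in> SM \<Longrightarrow> N \<in> SM \<Longrightarrow> M ** N \<in> SM"
  by (auto simp: SM_def Phi_mult even_mat_mult S_mult)

lemma SM_one: "mat 1 \<in> SM"
  by (simp add: SM_def even_mat_one Phi_one S_one)

lemma group_Sp2: "group (Sp2_group m n \<sigma>)"
  unfolding Sp2_group_def Sp2_eq
proof (rule groupI)
  fix X assume "X \<in> carrier \<lparr>carrier = SM, monoid.mult = (**), one = mat 1\<rparr>"
  then have "X \<in> SM" by simp
  then show "\<exists>Y\<in>carrier \<lparr>carrier = SM, monoid.mult = (**), one = mat 1\<rparr>.
      Y \<otimes>\<^bsub>\<lparr>carrier = SM, monoid.mult = (**), one = mat 1\<rparr>\<^esub> X = \<one>\<^bsub>\<lparr>carrier = SM, monoid.mult = (**), one = mat 1\<rparr>\<^esub>"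
    using SM_inverse by auto
qed (auto simp: SM_one SM_mult matrix_mul_assoc)

lemma bij_Phi: "bij_betw Phi SM S"
  by (rule bij_betw_byWitness[where f' = Psi]) (auto simp: SM_def Psi_Phi_even Psi_S)

lemma smooth_map_bounded_linear:
  assumes "bounded_linear L" "\<And>x. x \<in> T \<Longrightarrow> L x = g x" shows "smooth_map_on T g"
  unfolding smooth_map_on_def
  using smooth_bounded_linear[OF assms(1)] assms(2) by (intro ballI exI[of _ UNIV] exI[of _ L]) auto

lemma lie_group_iso_Phi: "lie_group_iso (Sp2_group m n \<sigma>) (Spin0_group (m + 1) (n + 1)) Phi"
  unfolding lie_group_iso_def
proof (intro conjI)
  show "Phi \<in> iso (Sp2_group m n \<sigma>) (Spin0_group (m + 1) (n + 1))"
    unfolding iso_def hom_def Sp2_group_def Spin0_group_def Sp2_eq Spin0_eq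
    using bij_Phi by (auto simp: SM_def Phi_mult)
  have "Psi X = inv_into SM Phi X" if "X \<in> S" for X
    using bij_Phi Psi_SM[OF that] Psi_S(2)[OF that] by (metis bij_betw_def inv_into_f_f)
  then show "smooth_map_on (carrier (Spin0_group (m + 1) (n + 1))) (inv_into (carrier (Sp2_group m n \<sigma>)) Phi)"
    unfolding Sp2_group_def Spin0_group_def Sp2_eq Spin0_eq
    by (intro smooth_map_bounded_linear[OF bounded_linear_Psi]) simp
qed (simp_all only: group_Sp2 group_Spin0 smooth_map_bounded_linear[OF bounded_linear_Phi])

section \<open>The prescribed values\<close>

abbreviation "Vf \<equiv> Vfix m n \<sigma>"

lemma VfD: "v \<in> Vf \<Longrightarrow> v \<in> V" "v \<in> Vf \<Longrightarrow> fm * v * fm = v"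
  using sigma_V by (auto simp: Vfix_def)

lemma VfI: "v \<in> V \<Longrightarrow> fm * v * fm = v \<Longrightarrow> v \<in> Vf"
  using sigma_V by (auto simp: Vfix_def)

lemma Phi_scalar_diag: "Phi (diag2 (of_real l) (of_real k)) = Th (of_real l) 0 0 (of_real k)"
proof -
  have "fm * of_real k * fm = - of_real k" using fm_sq by (simp add: of_real_def)
  then show ?thesis by (simp add: Phi_mk2)
qed

lemma Phi_values: "Phi_assignments m n \<sigma> Phi"
  unfolding Phi_assignments_def f_def[symmetric] e_def[symmetric] p_def[symmetric] q_def[symmetric]
proof (intro conjI ballI allI impI)
  fix y assume y: "y \<in> Spin m n"
  then obtain r where r: "\<bar>r\<bar> = 1" "Nsp y = of_real r" and yG: "y \<in> ClGr m n"
    by (auto simp: Spin_def)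
  obtain r' where r': "transp y * y = of_real r'" "lipschitz m n y (inverse r' *\<^sub>R transp y)"
    using ClGr_norm[OF yG] by metis
  have "of_real r' = (of_real r :: cliff)" using r(2) r'(1) by (simp add: Nsp_def)
  then have rr: "r' = r" by (simp only: of_real_eq_iff)
  have ay: "alpha y = y" using yG by (simp add: ClGr_iff)
  have yA: "y \<in> A" using r'(2) by (rule lipschitzD)
  have P: "Phi (diag2 y (cinv (\<sigma> y))) = Th y 0 0 (inverse r *\<^sub>R y)"
    using Phi_diag(1)[OF r'(2) ay] by (simp add: rr)
  show "Phi (diag2 y (cinv (\<sigma> y))) = iota0 m n y"
  proof (cases "r = 1")
    case True
    then show ?thesis unfolding P iota0_def using r(2) by (simp add: Th_diagonal)
  next
    case False
    then have r1: "r = - 1" using r(1) by auto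
    have "Nsp y \<noteq> 1"
    proof
      assume "Nsp y = 1"
      then have "of_real r = (of_real 1 :: cliff)" using r(2) by simp
      then show False using False by (simp only: of_real_eq_iff)
    qed
    then have "iota0 m n y = y * (f * e)" by (simp add: iota0_def f_def e_def mult.assoc)
    also have "\<dots> = (f * e) * y"
      using unit_commute(3,4)[OF yA, of 1] by (simp add: f_e algebra_simps)
    also have "\<dots> = Th y 0 0 (- y)" by (simp add: f_e Th_def algebra_simps)
    finally show ?thesis unfolding P by (simp add: r1)
  qed
next
  fix l :: real assume "l > 0"
  have "Th (of_real l) 0 0 (of_real (inverse l))
    = ((l + inverse l) / 2) *\<^sub>R (ep + em) + ((l - inverse l) / 2) *\<^sub>R (ep - em)"
  proof -
    have "l = (l + inverse l) / 2 + (l - inverse l) / 2" "inverse l = (l + inverse l) / 2 - (l - inverse l) / 2"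
      by (simp_all add: field_simps)
    then have "Th (of_real l) 0 0 (of_real (inverse l))
      = ((l + inverse l) / 2 + (l - inverse l) / 2) *\<^sub>R ep + ((l + inverse l) / 2 - (l - inverse l) / 2) *\<^sub>R em"
      by (simp add: Th_def of_real_def)
    then show ?thesis by (simp only: scaleR_left_distrib scaleR_right_distrib scaleR_left_diff_distrib
        scaleR_right_diff_distrib) simp
  qed
  also have "\<dots> = of_real ((l + inverse l) / 2) + f * e * of_real ((l - inverse l) / 2)"
    unfolding ep_em f_e by (simp add: of_real_def)
  finally show "Phi (diag2 (of_real l) (of_real (inverse l)))
      = of_real ((l + inverse l) / 2) + f * e * of_real ((l - inverse l) / 2)"
    unfolding Phi_scalar_diag .
next
  fix v assume v: "v \<in> Vf"
  show "Phi (Rm (fm * v)) = 1 + p * v"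
    using VfD(2)[OF v] fm_sq by (simp add: Phi_mk2 Th_upper)
  show "Phi (Lm (fm * v)) = 1 + q * v"
    using fm_sq by (simp add: Phi_mk2 Th_lower fm_cancel)
next
  show "Phi (Rm 1) = 1 + p * fm" using fm_sq by (simp add: Phi_mk2 Th_upper)
  show "Phi (Lm 1) = 1 - q * fm" using fm_sq by (simp add: Phi_mk2 Th_lower)
qed

text \<open>The map \<open>v \<mapsto> f\<^sub>mvf\<^sub>m\<close> is the reflection in \<open>f\<^sub>m\<close>; it splits \<open>V\<close> into \<open>V\<^sup>\<sigma>\<close> and the line of \<open>f\<^sub>m\<close>.\<close>

lemma Vf_part: assumes "v \<in> V" shows "(v + fm * v * fm) /\<^sub>R 2 \<in> Vf"
proof (rule VfI)
  show "(v + fm * v * fm) /\<^sub>R 2 \<in> V" using V_sandwich[OF fm_V assms] assms by simp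
  show "fm * ((v + fm * v * fm) /\<^sub>R 2) * fm = (v + fm * v * fm) /\<^sub>R 2"
    by (simp add: distrib_left distrib_right left_diff_distrib mult.assoc fm_cancel fm_sq add.commute)
qed

lemma V_split:
  assumes "v \<in> V" obtains c where "v = (v + fm * v * fm) /\<^sub>R 2 + c *\<^sub>R fm"
proof -
  obtain r where r: "fm * v + v * fm = of_real r" using V_polar[OF fm_V assms] .
  have "v - fm * v * fm = v - (fm * v + v * fm) * fm + v * (fm * fm)" by (simp add: distrib_right mult.assoc)
  also have "\<dots> = - r *\<^sub>R fm" unfolding r fm_sq by (simp add: of_real_def)
  finally have "(v + fm * v * fm) + - r *\<^sub>R fm = v + v" by (simp add: algebra_simps)
  then have "((v + fm * v * fm) + - r *\<^sub>R fm) /\<^sub>R 2 = v" by (simp add: scaleR_2[symmetric])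
  then have "v = (v + fm * v * fm) /\<^sub>R 2 + (inverse 2 * - r) *\<^sub>R fm"
    by (simp only: scaleR_right_distrib scaleR_scaleR)
  then show ?thesis by (rule that)
qed

lemma Bs_split:
  assumes "z \<in> Bs" obtains v s where "v \<in> Vf" "z = fm * v + of_real s"
proof -
  have u: "- (fm * z) \<in> V" using Bs_V[OF assms] by simp
  let ?u = "- (fm * z)"
  obtain c where c: "?u = (?u + fm * ?u * fm) /\<^sub>R 2 + c *\<^sub>R fm" using V_split[OF u] .
  have "z = fm * ?u" by (simp add: fm_cancel)
  also have "\<dots> = fm * ((?u + fm * ?u * fm) /\<^sub>R 2 + c *\<^sub>R fm)" using c by (rule arg_cong)
  also have "\<dots> = fm * ((?u + fm * ?u * fm) /\<^sub>R 2) + of_real (- c)"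
    using fm_sq by (simp add: distrib_left of_real_def)
  finally show ?thesis using that[OF Vf_part[OF u]] by blast
qed

lemma one_Bs: "of_real s \<in> Bs"
  using V_Bs(1)[of "- s *\<^sub>R fm"] fm_sq by (simp add: of_real_def)

lemma Rm_SM: "z \<in> Bs \<Longrightarrow> Rm z \<in> SM" and Lm_SM: "z \<in> Bs \<Longrightarrow> Lm z \<in> SM"
  using Phi_Rm Phi_Lm Bs_V S_upper S_lower by (auto simp: SM_def)

lemma scalar_diag_SM:
  assumes "l \<noteq> 0" shows "diag2 (of_real l) (of_real (inverse l)) \<in> SM"
proof -
  have "lipschitz m n (of_real l) (of_real (inverse l))"
    unfolding lipschitz_def using assms by (auto simp flip: of_real_mult)
  from S_diagonal[OF _ this] show ?thesis
    unfolding SM_def mem_Collect_eq Phi_scalar_diag by (simp add: even_mat_mk2)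
qed

text \<open>
  The prescribed values determine a homomorphism: \<open>diag(\<lambda>, \<lambda>\<^sup>-\<^sup>1)\<close> conjugates \<open>R(1)\<close> to
  \<open>R(\<lambda>\<^sup>2)\<close>, so the values on all elementary matrices are known, and these generate the group.
\<close>

lemma Phi_unique:
  assumes hom: "\<Psi> \<in> hom (Sp2_group m n \<sigma>) (Spin0_group (m + 1) (n + 1))"
    and val: "Phi_assignments m n \<sigma> \<Psi>" and M: "M \<in> SM"
  shows "\<Psi> M = Phi M"
proof -
  have mult: "\<Psi> (M ** N) = \<Psi> M * \<Psi> N" if "M \<in> SM" "N \<in> SM" for M N
    using hom that unfolding hom_def Sp2_group_def Spin0_group_def Sp2_eq by simp
  define Q where "Q = {M \<in> SM. \<Psi> M = Phi M}"
  have Q_mult: "M ** N \<in> Q" if "M \<in> Q" "N \<in> Q" for M N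
    using that mult by (auto simp: Q_def SM_mult) (auto simp: SM_def Phi_mult)
  note v1 = val[unfolded Phi_assignments_def] and v2 = Phi_values[unfolded Phi_assignments_def]
  have "0 \<in> Vf" by (rule VfI) auto
  then have "\<Psi> (Rm (fm * 0)) = Phi (Rm (fm * 0))" using v1 v2 by metis
  then have Q_one: "mat 1 \<in> Q" by (simp add: Q_def SM_one mk2_one)
  have Q_inv: "N \<in> Q" if "M \<in> Q" "N \<in> SM" "M ** N = mat 1" "N ** M = mat 1" for M N
  proof -
    have MN: "Phi M * Phi N = 1" using that Phi_one by (auto simp: Q_def SM_def simp flip: Phi_mult)
    have "\<Psi> N * \<Psi> M = 1" using that(1,2,4) mult[of N M] Q_one by (simp add: Q_def Phi_one)
    moreover have "\<Psi> M = Phi M" using that(1) by (simp add: Q_def)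
    ultimately have NM: "\<Psi> N * Phi M = 1" by simp
    have "\<Psi> N = \<Psi> N * Phi M * Phi N" using MN by (simp add: mult.assoc)
    then have "\<Psi> N = Phi N" unfolding NM by simp
    then show ?thesis using that(2) by (simp add: Q_def)
  qed
  have Q_diag: "diag2 (of_real l) (of_real (inverse l)) \<in> Q" if "l > 0" for l
    using scalar_diag_SM[of l] v1 v2 that unfolding Q_def by auto
  have one: "1 \<in> Bs" using one_Bs[of 1] by simp
  have Q_base: "Rm 1 \<in> Q" "Lm 1 \<in> Q"
    using Rm_SM[OF one] Lm_SM[OF one] v1 v2 unfolding Q_def by auto
  have Q_vec: "Rm (fm * v) \<in> Q" "Lm (fm * v) \<in> Q" if "v \<in> Vf" for v
    using Rm_SM Lm_SM V_Bs VfD(1)[OF that] v1 v2 that unfolding Q_def by auto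
  have Q_pos: "Rm (of_real s) \<in> Q" "Lm (of_real s) \<in> Q" if "s > 0" for s
  proof -
    define l where "l = sqrt s"
    have l: "l > 0" "l * l = s" using that by (auto simp: l_def)
    let ?D = "diag2 (of_real l) (of_real (inverse l))"
    let ?E = "diag2 (of_real (inverse l)) (of_real (inverse (inverse l)))"
    have D: "?D \<in> Q" "?E \<in> Q" using l Q_diag[of l] Q_diag[of "inverse l"] by simp_all
    have "?D ** Rm 1 ** ?E = Rm (of_real s)" "?E ** Lm 1 ** ?D = Lm (of_real s)"
      using l by (simp_all add: mk2_mult mk2_inject flip: of_real_mult)
    then show "Rm (of_real s) \<in> Q" "Lm (of_real s) \<in> Q" using D Q_base Q_mult by metis+
  qed
  have Q_real: "Rm (of_real s) \<in> Q" "Lm (of_real s) \<in> Q" for s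
  proof -
    consider "s > 0" | "s = 0" | "s < 0" by linarith
    then have "Rm (of_real s) \<in> Q \<and> Lm (of_real s) \<in> Q"
    proof cases
      case 2
      then show ?thesis using Q_one by (simp add: mk2_one)
    next
      case 3
      then have "Rm (of_real (- s)) \<in> Q" "Lm (of_real (- s)) \<in> Q" using Q_pos[of "- s"] by simp_all
      moreover have "Rm (of_real s) \<in> SM" "Lm (of_real s) \<in> SM" using Rm_SM Lm_SM one_Bs by auto
      moreover have "Rm (of_real (- s)) ** Rm (of_real s) = mat 1" "Rm (of_real s) ** Rm (of_real (- s)) = mat 1"
        "Lm (of_real (- s)) ** Lm (of_real s) = mat 1" "Lm (of_real s) ** Lm (of_real (- s)) = mat 1"
        by (simp_all add: mk2_mult mk2_one[symmetric] mk2_inject)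
      ultimately show ?thesis using Q_inv by blast
    qed (use Q_pos in blast)
    then show "Rm (of_real s) \<in> Q" "Lm (of_real s) \<in> Q" by auto
  qed
  have Q_elem: "Rm z \<in> Q" "Lm z \<in> Q" if z: "z \<in> Bs" for z
  proof -
    obtain v s where v: "v \<in> Vf" and zs: "z = fm * v + of_real s" using Bs_split[OF z] .
    have "Rm z = Rm (fm * v) ** Rm (of_real s)" "Lm z = Lm (fm * v) ** Lm (of_real s)"
      by (simp_all add: mk2_mult mk2_inject zs add.commute)
    then show "Rm z \<in> Q" "Lm z \<in> Q" using Q_mult Q_vec[OF v] Q_real by metis+
  qed
  have "Psi X \<in> Q" if "X \<in> S" for X
    using that
  proof (induction rule: S_induct)
    case one
    then show ?case using Q_one Psi_Phi_even[OF even_mat_one] by (simp add: Phi_one)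
  next
    case (upper X w)
    define z where "z = - (w * fm)"
    have z: "z \<in> Bs" using V_Bs(2)[of "- w"] upper(2) by (simp add: z_def)
    have "Phi (Rm z ** Psi X) = Th 1 w 0 1 * X"
      using Phi_Rm[OF z] Psi_S(2)[OF upper(1)] by (simp add: Phi_mult) (simp add: z_def fm_cancel)
    moreover have "Rm z ** Psi X \<in> Q" using Q_mult Q_elem[OF z] upper.IH by blast
    ultimately show ?case using Psi_Phi_even by (metis (no_types, lifting) Q_def SM_def mem_Collect_eq)
  next
    case (lower X w)
    define z where "z = fm * w"
    have z: "z \<in> Bs" using V_Bs(1)[OF lower(2)] by (simp add: z_def)
    have "Phi (Lm z ** Psi X) = Th 1 0 w 1 * X"
      using Phi_Lm[OF z] Psi_S(2)[OF lower(1)] by (simp add: Phi_mult) (simp add: z_def fm_cancel)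
    moreover have "Lm z ** Psi X \<in> Q" using Q_mult Q_elem[OF z] lower.IH by blast
    ultimately show ?case using Psi_Phi_even by (metis (no_types, lifting) Q_def SM_def mem_Collect_eq)
  qed
  then have "Psi (Phi M) \<in> Q" using M by (simp add: SM_def)
  then show ?thesis using M Psi_Phi_even by (simp add: Q_def SM_def)
qed

section \<open>The isomorphism of Lie algebras\<close>

lemma subspace_sp2: "subspace (sp2 m n \<sigma>)"
  unfolding Psi_spin[symmetric]
  by (rule linear_subspace_image[OF bounded_linear.linear[OF bounded_linear_Psi] subspace_spin])

lemma Phi_linear: "Phi (X + Y) = Phi X + Phi Y" "Phi (X - Y) = Phi X - Phi Y" "Phi (r *\<^sub>R X) = r *\<^sub>R Phi X"
  using bounded_linear.linear[OF bounded_linear_Phi]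
  by (simp_all add: linear_add linear_diff linear_scale)

lemma sp2I: "Phi M \<in> spin (m + 1) (n + 1) \<Longrightarrow> even_mat M \<Longrightarrow> M \<in> sp2 m n \<sigma>"
  using Psi_spin Psi_Phi_even by (metis imageI)

lemma lie_algebra_iso_Phi: "lie_algebra_iso (**) (*) (sp2 m n \<sigma>) (spin (m + 1) (n + 1)) Phi"
proof -
  have com: "Phi (X ** Y - Y ** X) = Phi X * Phi Y - Phi Y * Phi X" if "X \<in> sp2 m n \<sigma>" "Y \<in> sp2 m n \<sigma>" for X Y
    using sp2_even that by (simp add: Phi_linear Phi_mult)
  have Ps: "Phi X \<in> spin (m + 1) (n + 1)" if "X \<in> sp2 m n \<sigma>" for X using Phi_sp2 that by blast
  have closed: "X ** Y - Y ** X \<in> sp2 m n \<sigma>" if XY: "X \<in> sp2 m n \<sigma>" "Y \<in> sp2 m n \<sigma>" for X Y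
  proof (rule sp2I)
    show "Phi (X ** Y - Y ** X) \<in> spin (m + 1) (n + 1)"
      unfolding com[OF XY] by (rule spin_lie[OF Ps[OF XY(1)] Ps[OF XY(2)]])
    have "even_mat (X ** Y)" "even_mat (Y ** X)" using even_mat_mult sp2_even XY by auto
    then show "even_mat (X ** Y - Y ** X)" by (auto simp: even_mat_def)
  qed
  have "bij_betw Phi (sp2 m n \<sigma>) (spin (m + 1) (n + 1))"
    unfolding bij_betw_def Phi_sp2 using Phi_inj sp2_even by (auto intro!: inj_onI)
  moreover have "lie_subalgebra (**) (sp2 m n \<sigma>)"
    unfolding lie_subalgebra_def using subspace_sp2 closed by blast
  moreover have "lie_subalgebra (*) (spin (m + 1) (n + 1))"
    unfolding lie_subalgebra_def using subspace_spin spin_lie by blast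
  moreover have "linear_map_on (sp2 m n \<sigma>) Phi" by (simp add: linear_map_on_def Phi_linear)
  ultimately show ?thesis unfolding lie_algebra_iso_def using com by blast
qed

text \<open>
  Since \<open>x + x\<^sup>t\<close> is a scalar on \<open>B\<close> and \<open>\<sigma>\<close> fixes scalars, the equation \<open>\<sigma>(a) = -a\<close> leaves no scalar
  component in \<open>a\<close>.
\<close>

lemma Bminus_transp:
  assumes "a \<in> Bminus m n \<sigma>" shows "a \<in> Bsp m n" "\<sigma> a = - a" "transp a = - a"
proof -
  show a: "a \<in> Bsp m n" "\<sigma> a = - a" using assms by (auto simp: Bminus_def)
  obtain r where r: "transp a = of_real r - a" using Bsp_transp[OF a(1)] .
  have fa: "fm * transp a * fm = a" using a Bsp_even[OF a(1)] sigma_even by simp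
  have "transp (fm * transp a * fm) = transp a" by (simp only: fa)
  then have "fm * a * fm = of_real r - a" by (simp add: r mult.assoc)
  moreover have "fm * transp a * fm = - of_real r - fm * a * fm"
    unfolding r using fm_sq by (simp add: algebra_simps of_real_def)
  ultimately have "of_real r + of_real r = (0 :: cliff)" using fa by (simp add: algebra_simps)
  then have "of_real (r + r) = (of_real 0 :: cliff)" by (simp only: of_real_add of_real_0)
  then have "r + r = 0" by (simp only: of_real_eq_iff)
  then show "transp a = - a" by (simp add: r)
qed

lemma phi_values: "phi_assignments m n \<sigma> Phi"
  unfolding phi_assignments_def f_def[symmetric] e_def[symmetric]
proof (intro conjI ballI)
  have diag_vec: "Phi (diag2 (fm * v) (- (fm * v))) = fm * v" if "v \<in> Vf" for v
    using VfD(2)[OF that] by (simp add: Phi_mk2 mult.assoc Th_diagonal)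
  show "Phi (diag2 a a) = a" if "a \<in> Bminus m n \<sigma>" for a
    using Phi_sp2_element[of a 0 0] Bminus_transp[OF that] by (simp add: Th_diagonal)
  show "Phi (diag2 (fm * eb i) (- (fm * eb i))) = fm * eb i" if "i \<in> {1..n}" for i
  proof (rule diag_vec)
    have "eb i \<in> V" unfolding eb_def using that by (intro gen_V) (simp add: gens_def)
    then show "eb i \<in> Vf" using sigma_eb that by (simp add: Vfix_def)
  qed
  show "Phi (diag2 (fm * fb i) (- (fm * fb i))) = fm * fb i" if "i \<in> {1..<m}" for i
  proof (rule diag_vec)
    have "fb i \<in> V" unfolding fb_def using that by (intro gen_V) (simp add: gens_def)
    moreover have "i \<in> {1..m - 1}" using that by auto
    ultimately show "fb i \<in> Vf" using sigma_fb by (simp add: Vfix_def)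
  qed
  show "Phi (diag2 1 (- 1)) = f * e"
    using fm_sq by (simp add: Phi_mk2 Th_def f_e)
  show "Phi (Sm (fm * v)) = f * v" if "v \<in> Vf" for v
    using VfD(2)[OF that] by (simp add: Phi_mk2 Th_def fm_cancel p_plus_q[symmetric] distrib_right)
  show "Phi (Am (fm * v)) = v * e" if "v \<in> Vf" for v
  proof -
    have "v * e = - (e * v)" using VfD(1)[OF that] by (simp add: e_comm alpha_V)
    then show ?thesis using VfD(2)[OF that]
      by (simp add: Phi_mk2 Th_def fm_cancel p_minus_q[symmetric] left_diff_distrib)
  qed
  show "Phi (Sm 1) = - (fm * e)"
    by (simp add: Phi_mk2 Th_def e_comm) (simp add: p_minus_q[symmetric] left_diff_distrib)
  show "Phi (Am 1) = fm * f"
    by (simp add: Phi_mk2 Th_def f_comm) (simp add: p_plus_q[symmetric] distrib_right)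
qed

lemma sandwich_Bsp: "x \<in> Bsp m n \<Longrightarrow> fm * x * fm \<in> Bsp m n"
proof (induction rule: Bsp_induct)
  case zero
  show ?case by (simp add: subspace_0)
next
  case (add v w y)
  have "fm * (v * w + y) * fm = - ((fm * v * fm) * (fm * w * fm)) + fm * y * fm"
    by (simp add: algebra_simps fm_cancel)
  also have "\<dots> \<in> Bsp m n"
    by (rule subspace_add[OF subspace_Bsp subspace_neg[OF subspace_Bsp Bsp_mult_V[OF
            V_sandwich[OF fm_V add(1)] V_sandwich[OF fm_V add(2)]]] add(3)])
  finally show ?case .
qed

lemma sigma_Bsp: assumes "x \<in> Bsp m n" shows "\<sigma> x \<in> Bsp m n"
proof -
  obtain r where r: "transp x = of_real r - x" using Bsp_transp[OF assms] .
  have "transp x \<in> Bsp m n" unfolding r by (intro subspace_diff[OF subspace_Bsp] scalar_Bsp assms)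
  then show ?thesis using sandwich_Bsp Bsp_even[OF assms] by (simp add: sigma_even subspace_neg)
qed

text \<open>
  The elements with prescribed values span \<open>sp\<^sub>2\<close>: the diagonal splits according to \<open>B = B\<^sup>-\<^sup>\<sigma> + B\<^sup>\<sigma>\<close>
  and \<open>B\<^sup>\<sigma>\<close> is spanned by \<open>1\<close> and \<open>f\<^sub>mV\<^sup>\<sigma>\<close>, while the off-diagonal parts with entries \<open>z\<close>, \<open>y\<close> are
  \<open>(S(z) - A(z))/2\<close> and \<open>(S(y) + A(y))/2\<close>.
\<close>

lemma phi_unique:
  assumes lin: "linear_map_on (sp2 m n \<sigma>) \<psi>" and val: "phi_assignments m n \<sigma> \<psi>" and X: "X \<in> sp2 m n \<sigma>"
  shows "\<psi> X = Phi X"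
proof -
  define Q where "Q = {X \<in> sp2 m n \<sigma>. \<psi> X = Phi X}"
  have Q: "subspace Q"
  proof (rule subspaceI)
    have "\<psi> (0 *\<^sub>R 0) = 0 *\<^sub>R \<psi> 0" using lin subspace_0[OF subspace_sp2] unfolding linear_map_on_def by blast
    then show "0 \<in> Q" using subspace_0[OF subspace_sp2] Phi_linear(3)[of 0 0] by (simp add: Q_def)
  qed (use lin subspace_sp2 in \<open>auto simp: Q_def linear_map_on_def Phi_linear subspace_add subspace_scale\<close>)
  note v1 = val[unfolded phi_assignments_def] and v2 = phi_values[unfolded phi_assignments_def]
  have sp2I': "mk2 x z y d \<in> sp2 m n \<sigma>" if "x \<in> Bsp m n" "d = - \<sigma> x" "y \<in> Bs" "z \<in> Bs" for x y z d
    using that unfolding sp2_def by blast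
  have zero: "0 \<in> Bs" "\<sigma> 0 = 0" "0 \<in> Bsp m n"
    using one_Bs[of 0] scalar_Bsp[of 0] by (auto simp: Bplus_def)
  have one: "1 \<in> Bs" "\<sigma> 1 = 1" "1 \<in> Bsp m n"
    using one_Bs[of 1] scalar_Bsp[of 1] by (auto simp: Bplus_def)
  have Q_minus: "diag2 a a \<in> Q" if "a \<in> Bminus m n \<sigma>" for a
    using sp2I'[of a a 0 0] Bminus_transp[OF that] zero v1 v2 that unfolding Q_def by auto
  have Q_one: "diag2 1 (- 1) \<in> Q"
    using sp2I'[of 1 "- 1" 0 0] one zero v1 v2 unfolding Q_def by auto
  have BsB: "z \<in> Bsp m n" "\<sigma> z = z" if "z \<in> Bs" for z using that by (auto simp: Bplus_def)
  have Q_diag_vec: "diag2 (fm * v) (- (fm * v)) \<in> Q" if v: "v \<in> Vf" for v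
  proof -
    \<comment> \<open>\<open>P\<close> is the projection to \<open>V\<^sup>\<sigma>\<close>; it fixes the basis of \<open>V\<close> except for \<open>f\<^sub>m\<close>, which it kills.\<close>
    define P where "P w = (w + fm * w * fm) /\<^sub>R 2" for w
    let ?Z = "{w. diag2 (fm * P w) (- (fm * P w)) \<in> Q}"
    have P_lin: "P 0 = 0" "P (x + y) = P x + P y" "P (c *\<^sub>R x) = c *\<^sub>R P x" for x y c
      by (simp_all add: P_def algebra_simps)
    have diag0: "diag2 0 0 = 0" by (simp add: mat2_eq_iff)
    have Z: "subspace ?Z"
    proof (rule subspaceI)
      show "0 \<in> ?Z" using subspace_0[OF Q] by (simp add: P_lin diag0)
      show "x + y \<in> ?Z" if "x \<in> ?Z" "y \<in> ?Z" for x y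
        using subspace_add[OF Q, of "diag2 (fm * P x) (- (fm * P x))" "diag2 (fm * P y) (- (fm * P y))"] that
        by (simp add: P_lin mk2_linear distrib_left)
      show "c *\<^sub>R x \<in> ?Z" if "x \<in> ?Z" for c x
        using subspace_scale[OF Q, of "diag2 (fm * P x) (- (fm * P x))" c] that
        by (simp add: P_lin mk2_linear)
    qed
    have P_fix: "P w = w" if "fm * w * fm = w" for w
      unfolding P_def that by (simp add: scaleR_2[symmetric])
    have sp: "diag2 (fm * w) (- (fm * w)) \<in> sp2 m n \<sigma>" if "w \<in> V" for w
      using V_Bs(1)[OF that] BsB zero by (intro sp2I') auto
    have "fb i \<in> ?Z" if i: "i \<in> {1..m}" for i
    proof (cases "i = m")
      case True
      have "P fm = 0" by (simp add: P_def mult.assoc fm_sq)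
      then show ?thesis using subspace_0[OF Q] by (simp add: True diag0)
    next
      case False
      then have i': "i \<in> {1..<m}" using i by auto
      have V: "fb i \<in> V" unfolding fb_def using i by (intro gen_V) (simp add: gens_def)
      have "P (fb i) = fb i" using i' sigma_fb sigma_V[OF V] by (intro P_fix) auto
      then show ?thesis using sp[OF V] i' v1 v2 unfolding Q_def by auto
    qed
    moreover have "eb i \<in> ?Z" if i: "i \<in> {1..n}" for i
    proof -
      have V: "eb i \<in> V" unfolding eb_def using i by (intro gen_V) (simp add: gens_def)
      have "P (eb i) = eb i" using i sigma_eb sigma_V[OF V] by (intro P_fix) auto
      then show ?thesis using sp[OF V] i v1 v2 unfolding Q_def by auto
    qed
    ultimately have "V \<subseteq> ?Z" unfolding Vsp_def by (intro span_minimal Z) auto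
    then show ?thesis using VfD[OF v] P_fix by auto
  qed
  have Q_S: "Sm z \<in> Q" and Q_A: "Am z \<in> Q" and Q_D: "diag2 z (- z) \<in> Q" if z: "z \<in> Bs" for z
  proof -
    obtain v s where v: "v \<in> Vf" and zs: "z = fm * v + of_real s" using Bs_split[OF z] .
    have fv: "fm * v \<in> Bs" "- (fm * v) \<in> Bs" "- 1 \<in> Bs"
      using V_Bs(1)[OF VfD(1)[OF v]] V_Bs(1)[of "- v"] VfD(1)[OF v] one_Bs[of "- 1"] by auto
    have "Sm (fm * v) \<in> Q" "Sm 1 \<in> Q" "Am (fm * v) \<in> Q" "Am 1 \<in> Q"
      using sp2I'[of 0 0] fv zero one v v1 v2 unfolding Q_def by auto
    moreover have "Sm z = Sm (fm * v) + s *\<^sub>R Sm 1" "Am z = Am (fm * v) + s *\<^sub>R Am 1"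
      "diag2 z (- z) = diag2 (fm * v) (- (fm * v)) + s *\<^sub>R diag2 1 (- 1)"
      by (simp_all add: zs mk2_linear of_real_def mk2_inject)
    ultimately show "Sm z \<in> Q" "Am z \<in> Q" "diag2 z (- z) \<in> Q"
      using Q_diag_vec[OF v] Q_one by (simp_all only: subspace_add[OF Q] subspace_scale[OF Q])
  qed
  obtain x y z where Xe: "X = mk2 x z y (- \<sigma> x)" and x: "x \<in> Bsp m n" and yz: "y \<in> Bs" "z \<in> Bs"
    using X unfolding sp2_def by blast
  define a b where "a = (x - \<sigma> x) /\<^sub>R 2" and "b = (x + \<sigma> x) /\<^sub>R 2"
  have ss: "\<sigma> (\<sigma> x) = x" using anti Bsp_even[OF x] by (auto simp: anti_involution_on_def)
  have lin\<sigma>: "\<sigma> (u + w) = \<sigma> u + \<sigma> w" "\<sigma> (u - w) = \<sigma> u - \<sigma> w" "\<sigma> (r *\<^sub>R u) = r *\<^sub>R \<sigma> u"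
    if "u \<in> A" "w \<in> A" for u w r
    using that by (simp_all add: sigma_eq algebra_simps)
  have xA: "x \<in> A" "\<sigma> x \<in> A" using Bsp_even x sigma_Bsp by blast+
  have "a \<in> Bminus m n \<sigma>"
    unfolding Bminus_def a_def using x sigma_Bsp[OF x] xA
    by (auto intro!: subspace_scale[OF subspace_Bsp] subspace_diff[OF subspace_Bsp] simp: lin\<sigma> ss algebra_simps)
  moreover have "b \<in> Bs"
    unfolding Bplus_def b_def using x sigma_Bsp[OF x] xA
    by (auto intro!: subspace_scale[OF subspace_Bsp] subspace_add[OF subspace_Bsp] simp: lin\<sigma> ss algebra_simps)
  ultimately have "diag2 a a \<in> Q" "diag2 b (- b) \<in> Q" using Q_minus Q_D by auto
  moreover have "(1/2) *\<^sub>R (Sm z - Am z) \<in> Q" "(1/2) *\<^sub>R (Sm y + Am y) \<in> Q"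
    using Q_S Q_A yz by (intro subspace_scale[OF Q] subspace_diff[OF Q] subspace_add[OF Q]; simp)+
  moreover have "X = diag2 a a + diag2 b (- b) + (1/2) *\<^sub>R (Sm z - Am z) + (1/2) *\<^sub>R (Sm y + Am y)"
  proof -
    have half: "(u /\<^sub>R 2) + (u /\<^sub>R 2) = (u :: cliff)" for u by (simp flip: scaleR_left_distrib)
    have "a + b = x" "a - b = - \<sigma> x"
      unfolding a_def b_def scaleR_right_distrib scaleR_right_diff_distrib
      using half[of x] half[of "\<sigma> x"] by (simp_all add: algebra_simps)
    then show ?thesis using half[of y] half[of z]
      by (simp add: Xe mk2_linear mk2_inject scaleR_2[symmetric])
  qed
  ultimately have "X \<in> Q" by (simp only: subspace_add[OF Q])
  then show ?thesis by (simp add: Q_def)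
qed

lemma differential_Phi: "has_differential_at Phi SM S (mat 1) Phi"
  unfolding has_differential_at_def
proof (intro conjI ballI allI impI)
  show "Phi X \<in> tangent_space S (Phi (mat 1))" if "X \<in> tangent_space SM (mat 1)" for X
    using that Phi_sp2 unfolding Phi_one tangent_S tangent_SM by blast
  show "((\<lambda>t. Phi (\<gamma> t)) has_vector_derivative Phi X) (at 0)" if "smooth_curve_at SM (mat 1) X \<gamma>" for \<gamma> X
    using that bounded_linear.has_vector_derivative[OF bounded_linear_Phi] by (auto simp: smooth_curve_at_def)
qed

end

theorem theorem7p22:
  fixes m n :: nat and \<sigma> :: "cliff \<Rightarrow> cliff"
  assumes "m \<ge> 1"
    and "anti_involution_on (Cl m n) \<sigma>"
    and "\<sigma> (fb m) = - fb m"
    and "\<forall>i\<in>{1..m - 1}. \<sigma> (fb i) = fb i"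
    and "\<forall>j\<in>{1..n}. \<sigma> (eb j) = eb j"
  shows "\<exists>\<Phi> \<phi>.
    lie_group_iso (Sp2_group m n \<sigma>) (Spin0_group (m + 1) (n + 1)) \<Phi> \<and>
    Phi_assignments m n \<sigma> \<Phi> \<and>
    (\<forall>\<Psi> \<in> hom (Sp2_group m n \<sigma>) (Spin0_group (m + 1) (n + 1)).
       Phi_assignments m n \<sigma> \<Psi> \<longrightarrow> (\<forall>M\<in>Sp2_ClGr m n \<sigma>. \<Psi> M = \<Phi> M)) \<and>
    tangent_space (Sp2_ClGr m n \<sigma>) (mat 1) = sp2 m n \<sigma> \<and>
    tangent_space (Spin0 (m + 1) (n + 1)) 1 = spin (m + 1) (n + 1) \<and>
    has_differential_at \<Phi> (Sp2_ClGr m n \<sigma>) (Spin0 (m + 1) (n + 1)) (mat 1) \<phi> \<and>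
    lie_algebra_iso (**) (*) (sp2 m n \<sigma>) (spin (m + 1) (n + 1)) \<phi> \<and>
    phi_assignments m n \<sigma> \<phi> \<and>
    (\<forall>\<psi>. linear_map_on (sp2 m n \<sigma>) \<psi> \<and> phi_assignments m n \<sigma> \<psi> \<longrightarrow>
       (\<forall>X\<in>sp2 m n \<sigma>. \<psi> X = \<phi> X))"
proof -
  interpret symplectic_setting m n \<sigma> by unfold_locales (use assms in auto)
  show ?thesis
    unfolding Sp2_eq Spin0_eq
  proof (intro exI[of _ Phi] conjI ballI allI impI)
    show "\<psi> X = Phi X" if "linear_map_on (sp2 m n \<sigma>) \<psi> \<and> phi_assignments m n \<sigma> \<psi>" "X \<in> sp2 m n \<sigma>" for \<psi> X
      using that phi_unique by blast
  qed (fact lie_group_iso_Phi Phi_values Phi_unique tangent_SM tangent_S differential_Phi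
      lie_algebra_iso_Phi phi_values)+
qed

end
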